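(* Let $N>1$, let $\Omega\subset\mathbb{R}^N$ be a smooth bounded domain and let $1<q<p<\infty$. Let $B_\rho$ be a largest open ball contained in $\Omega$ (with radius $\rho$), and let $B_R$ be a ball of radius $R$, centered at a point of $\Omega$, with $\Omega\subseteq B_R$. Set $$k_1=\left(\frac{p-1}{p}\right)^{1-p}N R^{-p},\qquad \gamma=\frac{p}{p-1}\,\frac1\rho,\qquad H(M)=M^{q-p}\left(1+\gamma^pM^p\right)\ (M>0),$$ let $M_*>0$ be given by $\gamma^pM_*^p=\frac pq-1$ (the unique critical point of $H$, at which $H$ attains its minimum), and let $$\lambda^*=\frac{k_1}{H(M_* )}.$$ Then for each $\lambda\in(0,\lambda^*]$ the problem $$-\Delta_pu=\lambda\,u^{q-1}\left(1+|\nabla u|^p\right)\ \text{ in }\Omega,\qquad u=0\ \text{ on }\partial\Omega,$$ has a positive solution.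
   Context: $\Delta_pu=\operatorname{div}(|\nabla u|^{p-2}\nabla u)$ is the $p$-Laplacian. A solution is a weak solution: $u\in W^{1,p}(\Omega)\cap L^\infty(\Omega)$ with $u=0$ on $\partial\Omega$ and $\int_\Omega|\nabla u|^{p-2}\nabla u\cdot\nabla\phi\,dx=\int_\Omega\lambda u^{q-1}(1+|\nabla u|^p)\phi\,dx$ for all $\phi\in C_0^\infty(\Omega)$. *)

theory Defs
  imports "HOL-Analysis.Analysis"
begin

section \<open>Smooth functions and smooth bounded domains\<close>

definition partial_deriv :: "'a::euclidean_space \<Rightarrow> ('a \<Rightarrow> real) \<Rightarrow> 'a \<Rightarrow> real" where
  "partial_deriv b f x = frechet_derivative f (at x) b"

definition grad :: "('a::euclidean_space \<Rightarrow> real) \<Rightarrow> 'a \<Rightarrow> 'a" where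
  "grad f x = (\<Sum>b\<in>Basis. partial_deriv b f x *\<^sub>R b)"

primrec C_k :: "nat \<Rightarrow> ('a::euclidean_space \<Rightarrow> real) \<Rightarrow> bool" where
  "C_k 0 f \<longleftrightarrow> continuous_on UNIV f"
| "C_k (Suc k) f \<longleftrightarrow> f differentiable_on UNIV \<and> (\<forall>b\<in>Basis. C_k k (partial_deriv b f))"

definition C_infinity :: "('a::euclidean_space \<Rightarrow> real) \<Rightarrow> bool" where
  "C_infinity f \<longleftrightarrow> (\<forall>k. C_k k f)"

text \<open>
  Near each boundary point, after a rotation of the coordinates, the domain is the region above the
  graph of a smooth function: \<open>e\<close> is the vertical direction, and \<open>x - (x \<bullet> e) *\<^sub>R e\<close> stands for
  the remaining coordinates of \<open>x\<close>, so only the values of \<open>g\<close> on the hyperplane orthogonal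
  to \<open>e\<close> matter.
\<close>

definition smooth_boundary :: "'a::euclidean_space set \<Rightarrow> bool" where
  "smooth_boundary \<Omega> \<longleftrightarrow>
     (\<forall>x0\<in>frontier \<Omega>. \<exists>r>0. \<exists>e g. norm e = 1 \<and> C_infinity g \<and>
        \<Omega> \<inter> ball x0 r = {x \<in> ball x0 r. g (x - (x \<bullet> e) *\<^sub>R e) < x \<bullet> e})"

definition smooth_bounded_domain :: "'a::euclidean_space set \<Rightarrow> bool" where
  "smooth_bounded_domain \<Omega> \<longleftrightarrow>
     open \<Omega> \<and> connected \<Omega> \<and> \<Omega> \<noteq> {} \<and> bounded \<Omega> \<and> smooth_boundary \<Omega>"

definition largest_ball_in :: "'a::euclidean_space set \<Rightarrow> 'a \<Rightarrow> real \<Rightarrow> bool" where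
  "largest_ball_in \<Omega> x \<rho> \<longleftrightarrow>
     \<rho> > 0 \<and> ball x \<rho> \<subseteq> \<Omega> \<and> (\<forall>y r. ball y r \<subseteq> \<Omega> \<longrightarrow> r \<le> \<rho>)"


section \<open>Lebesgue and Sobolev spaces\<close>

text \<open>
  Elements of these spaces are functions rather than classes modulo null sets, and their values
  outside of \<open>\<Omega>\<close> are irrelevant.
\<close>

definition test_functions :: "'a::euclidean_space set \<Rightarrow> ('a \<Rightarrow> real) set" where
  "test_functions \<Omega> =
     {\<phi>. C_infinity \<phi> \<and> compact (closure {x. \<phi> x \<noteq> 0}) \<and> closure {x. \<phi> x \<noteq> 0} \<subseteq> \<Omega>}"

definition L_p :: "real \<Rightarrow> 'a::euclidean_space set \<Rightarrow> ('a \<Rightarrow> 'b::euclidean_space) set" where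
  "L_p p \<Omega> = {f. f \<in> borel_measurable (lebesgue_on \<Omega>) \<and>
                 integrable (lebesgue_on \<Omega>) (\<lambda>x. norm (f x) powr p)}"

definition L_infinity :: "'a::euclidean_space set \<Rightarrow> ('a \<Rightarrow> real) set" where
  "L_infinity \<Omega> = {f. f \<in> borel_measurable (lebesgue_on \<Omega>) \<and>
                      (\<exists>C. AE x in lebesgue_on \<Omega>. \<bar>f x\<bar> \<le> C)}"

definition locally_integrable ::
  "'a::euclidean_space set \<Rightarrow> ('a \<Rightarrow> 'b::euclidean_space) \<Rightarrow> bool" where
  "locally_integrable \<Omega> f \<longleftrightarrow>
     (\<forall>K. compact K \<and> K \<subseteq> \<Omega> \<longrightarrow> integrable (lebesgue_on K) f)"

definition has_weak_gradient ::
  "'a::euclidean_space set \<Rightarrow> ('a \<Rightarrow> real) \<Rightarrow> ('a \<Rightarrow> 'a) \<Rightarrow> bool" where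
  "has_weak_gradient \<Omega> u Du \<longleftrightarrow>
     locally_integrable \<Omega> u \<and> locally_integrable \<Omega> Du \<and>
     (\<forall>\<phi>\<in>test_functions \<Omega>. \<forall>b\<in>Basis.
        (LINT x|lebesgue_on \<Omega>. u x * partial_deriv b \<phi> x) =
        - (LINT x|lebesgue_on \<Omega>. (Du x \<bullet> b) * \<phi> x))"

definition W1p :: "real \<Rightarrow> 'a::euclidean_space set \<Rightarrow> ('a \<Rightarrow> real) set" where
  "W1p p \<Omega> = {u \<in> L_p p \<Omega>. \<exists>Du\<in>L_p p \<Omega>. has_weak_gradient \<Omega> u Du}"

text \<open>
  The boundary condition \<open>u = 0\<close> on \<open>\<partial>\<Omega>\<close> for a Sobolev function means membership in
  \<open>W\<^sub>0\<^sup>1\<^sup>,\<^sup>p(\<Omega>)\<close>, the closure of the test functions in the \<open>W\<^sup>1\<^sup>,\<^sup>p\<close> norm.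
\<close>

definition W1p_0 :: "real \<Rightarrow> 'a::euclidean_space set \<Rightarrow> ('a \<Rightarrow> real) set" where
  "W1p_0 p \<Omega> = {u \<in> L_p p \<Omega>. \<exists>Du\<in>L_p p \<Omega>. has_weak_gradient \<Omega> u Du \<and>
     (\<exists>\<phi>. (\<forall>n::nat. \<phi> n \<in> test_functions \<Omega>) \<and>
        (\<lambda>n. LINT x|lebesgue_on \<Omega>. \<bar>\<phi> n x - u x\<bar> powr p) \<longlonglongrightarrow> 0 \<and>
        (\<lambda>n. LINT x|lebesgue_on \<Omega>. norm (grad (\<phi> n) x - Du x) powr p) \<longlonglongrightarrow> 0)}"


section \<open>The Dirichlet problem\<close>

text \<open>
  The weak gradient is unique up to null sets, so the choice of \<open>Du\<close> below does not matter. Where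
  \<open>Du x = 0\<close> the field \<open>|Du|\<^sup>p\<^sup>-\<^sup>2 Du\<close> is \<open>0\<close>, also for \<open>p < 2\<close>. Since \<open>powr\<close> is meant for
  nonnegative bases, the notion is intended for \<open>u \<ge> 0\<close> only.
\<close>

definition weak_solution ::
  "real \<Rightarrow> real \<Rightarrow> real \<Rightarrow> 'a::euclidean_space set \<Rightarrow> ('a \<Rightarrow> real) \<Rightarrow> bool" where
  "weak_solution p q lam \<Omega> u \<longleftrightarrow>
     u \<in> W1p p \<Omega> \<and> u \<in> L_infinity \<Omega> \<and> u \<in> W1p_0 p \<Omega> \<and>
     (\<exists>Du\<in>L_p p \<Omega>. has_weak_gradient \<Omega> u Du \<and>
       (\<forall>\<phi>\<in>test_functions \<Omega>.
          (LINT x|lebesgue_on \<Omega>. (norm (Du x) powr (p - 2) *\<^sub>R Du x) \<bullet> grad \<phi> x) =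
          (LINT x|lebesgue_on \<Omega>. lam * u x powr (q - 1) * (1 + norm (Du x) powr p) * \<phi> x)))"

text \<open>
  Requiring \<open>u > 0\<close> at every point of \<open>\<Omega>\<close> selects a representative; a function class has such a
  representative iff it is positive almost everywhere.
\<close>

definition positive_weak_solution ::
  "real \<Rightarrow> real \<Rightarrow> real \<Rightarrow> 'a::euclidean_space set \<Rightarrow> ('a \<Rightarrow> real) \<Rightarrow> bool" where
  "positive_weak_solution p q lam \<Omega> u \<longleftrightarrow>
     weak_solution p q lam \<Omega> u \<and> (\<forall>x\<in>\<Omega>. u x > 0)"

end

theory Submission
  imports Defs "HOL-Computational_Algebra.Polynomial"
begin

text \<open>
  Let \<open>F\<close> be the primitive of \<open>f(u) = \<lambda> u\<^sup>q\<^sup>-\<^sup>1\<close> with \<open>F(0) = 0\<close>. The substitution \<open>v = \<Phi>(u)\<close> with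
  \<open>\<Phi>' = exp (F / (p - 1))\<close> absorbs the gradient term: the equation becomes
  \<open>-\<Delta>\<^sub>p v = g(v)\<close> with \<open>g(v) = f(u) exp (F(u))\<close> nondecreasing. For \<open>M = M\<^sub>*\<close>, \<open>p' = p / (p - 1)\<close> and
  \<open>u\<^sup>* = M (1 - (|x - y\<^sub>0| / R)\<^sup>p\<^sup>')\<close> one has \<open>-\<Delta>\<^sub>p u\<^sup>* = k\<^sub>1 M\<^sup>p\<^sup>-\<^sup>1\<close> and \<open>|\<nabla>u\<^sup>*| \<le> \<gamma> M\<close>, so the condition
  \<open>\<lambda> \<le> k\<^sub>1 / H(M)\<close> says that \<open>\<Phi>(u\<^sup>*)\<close> is a supersolution. The iteration \<open>-\<Delta>\<^sub>p v\<^sub>n\<^sub>+\<^sub>1 = g(v\<^sub>n)\<close>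
  starting there decreases, each step being solved by minimising a strictly convex functional, and
  the gradients converge strongly by monotonicity of \<open>\<xi> \<mapsto> |\<xi>|\<^sup>p\<^sup>-\<^sup>2 \<xi>\<close>. Since \<open>q < p\<close>, every ball in
  \<open>\<Omega>\<close> carries a small subsolution \<open>\<epsilon> (1 - (|x - z| / r)\<^sup>p\<^sup>')\<^sub>+\<^sup>a\<close>, which stays below all iterates; hence
  the limit is positive.
\<close>

section \<open>The vector field of the p-Laplacian\<close>

text \<open>The source grows like |grad u|^p, for which energy bounds alone give no passage to the
  limit. The substitution comes from -\<Delta>_p \<Phi>(u) = \<Phi>'(u)^(p-1) (-\<Delta>_p u - f(u)
  |grad u|^p), which holds when (p-1) \<Phi>'' = f \<Phi>'; it carries sub- and supersolutions over
  unchanged. The barrier is the p-torsion profile of the ball B_R scaled to height M: its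
  p-Laplacian is constant and its gradient is largest on the sphere, where it equals p M / ((p-1) R)
  \<le> \<gamma> M because \<rho> \<le> R. Asking for the inequality at maximal height and maximal
  gradient at once gives \<lambda> M^(q-1) (1 + \<gamma>^p M^p) \<le> k_1 M^(p-1), that is \<lambda>
  H(M) \<le> k_1; the minimum point of H makes this least restrictive. Functions in W_0^{1,p} are
  kept as pairs of a function and its gradient, both limits along one sequence of test functions, so
  that compositions, products and positive parts come with explicit gradients. Quantified strict
  convexity of |.|^p turns minimising sequences into Cauchy sequences, so weak compactness never
  enters.\<close>

lemma GDERIV_norm_powr:
  fixes x :: "'a::real_inner"
  assumes "a > 1"
  shows "GDERIV (\<lambda>x. norm x powr a) x :> (a * norm x powr (a - 2)) *\<^sub>R x"
proof (cases "x = 0")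
  case True
  \<comment> \<open>At the origin the difference quotient is |h|^(a-1), which tends to 0 because a >
    1.\<close>
  have "((\<lambda>h::'a. norm h powr (a - 1)) \<longlongrightarrow> 0) (at 0)"
  proof -
    have "((\<lambda>h::'a. norm h powr (a - 1)) \<longlongrightarrow> 0 powr (a - 1)) (at 0)"
      by (rule tendsto_powr') (use assms in \<open>auto intro!: tendsto_eq_intros\<close>)
    then show ?thesis by simp
  qed
  moreover have "norm (norm h powr a) / norm h = norm h powr (a - 1)" for h :: 'a
    by (simp add: powr_diff)
  ultimately show ?thesis
    using True assms by (simp add: gderiv_def has_derivative_at)
next
  case False
  have "DERIV (\<lambda>t. t powr a) (norm x) :> a * norm x powr (a - 1)"
    using False by (auto intro!: derivative_eq_intros)
  then have "GDERIV (\<lambda>x. norm x powr a) x :> (a * norm x powr (a - 1)) *\<^sub>R sgn x"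
    using GDERIV_DERIV_compose[OF GDERIV_norm[OF False], of "\<lambda>t. t powr a"] by blast
  moreover have "norm x powr (a - 1) / norm x = norm x powr (a - 2)"
    using False by (simp add: powr_diff power2_eq_square)
  ultimately show ?thesis
    using False by (simp add: sgn_div_norm field_simps)
qed

text \<open>The gradient of |x|^p / p, with value 0 at the origin for every p. Working in any real
  inner product space lets it serve on the reals too, and with the conjugate exponent it is the
  inverse of the field for p.\<close>

definition pflux :: "real \<Rightarrow> 'a::real_inner \<Rightarrow> 'a" where
  "pflux p x = norm x powr (p - 2) *\<^sub>R x"

lemma pflux_0 [simp]: "pflux p 0 = 0"
  by (simp add: pflux_def)

lemma norm_pflux: "norm (pflux p x) = norm x powr (p - 1)"
  by (cases "x = 0") (auto simp: pflux_def powr_diff power2_eq_square)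

lemma pflux_inner_self: "pflux p x \<bullet> x = norm x powr p"
  by (cases "x = 0") (auto simp: pflux_def powr_diff power2_eq_square dot_square_norm)

lemma pflux_scale: "t > 0 \<Longrightarrow> pflux p (t *\<^sub>R x) = t powr (p - 1) *\<^sub>R pflux p x"
  by (simp add: pflux_def powr_mult powr_diff power2_eq_square)

lemma continuous_on_pflux:
  assumes "p > 1"
  shows "continuous_on UNIV (pflux p :: 'a::real_inner \<Rightarrow> 'a)"
  unfolding continuous_on_def
proof
  fix x :: 'a
  show "(pflux p \<longlongrightarrow> pflux p x) (at x within UNIV)"
  proof (cases "x = 0")
    case True
    have "((\<lambda>h::'a. norm h powr (p - 1)) \<longlongrightarrow> 0 powr (p - 1)) (at 0)"
      by (rule tendsto_powr') (use assms in \<open>auto intro!: tendsto_eq_intros\<close>)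
    then have "((\<lambda>h::'a. norm (pflux p h)) \<longlongrightarrow> 0) (at 0)"
      using assms by (simp add: norm_pflux)
    then show ?thesis
      using True by (simp add: tendsto_norm_zero_iff)
  next
    case False
    then show ?thesis
      unfolding pflux_def by (auto intro!: tendsto_eq_intros)
  qed
qed

text \<open>Mean value theorem between t and 1: the derivative p z^(p-1) exceeds p to the right of 1
  and stays below p to the left. The point t = 0 is split off because the derivative rule is used at
  positive bases only.\<close>

lemma powr_bernoulli_strict:
  fixes t p :: real
  assumes "p > 1" "t \<ge> 0" "t \<noteq> 1"
  shows "t powr p > 1 + p * (t - 1)"
proof (cases "t = 0")
  case True
  then show ?thesis using assms by simp
next
  case False
  then have t: "t > 0" using assms by simp
  have D: "DERIV (\<lambda>t. t powr p) x :> p * x powr (p - 1)" if "x > 0" for x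
    using that by (auto intro!: derivative_eq_intros)
  show ?thesis
  proof (cases "t > 1")
    case True
    obtain z where z: "1 < z" "z < t" "t powr p - 1 powr p = (t - 1) * (p * z powr (p - 1))"
      using MVT2[OF True, of "\<lambda>t. t powr p" "\<lambda>x. p * x powr (p - 1)"] D by force
    have "z powr (p - 1) > 1" using z assms by (simp add: gr_one_powr)
    then have "(t - 1) * (p * z powr (p - 1)) > (t - 1) * (p * 1)"
      using True assms by (intro mult_strict_left_mono) auto
    then show ?thesis using z by (simp add: algebra_simps)
  next
    case False
    then have lt: "t < 1" using assms by simp
    obtain z where z: "t < z" "z < 1" "1 powr p - t powr p = (1 - t) * (p * z powr (p - 1))"
      using MVT2[OF lt, of "\<lambda>t. t powr p" "\<lambda>x. p * x powr (p - 1)"] D t by force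
    have "z powr (p - 1) < 1 powr (p - 1)"
      using z t assms by (intro powr_less_mono2) auto
    then have "(1 - t) * (p * z powr (p - 1)) < (1 - t) * (p * 1)"
      using lt assms by (intro mult_strict_left_mono) auto
    then show ?thesis using z by (simp add: algebra_simps)
  qed
qed

text \<open>Cauchy-Schwarz reduces the claim to Bernoulli's inequality for t = |b| / |a|. At t = 1
  Bernoulli is an equality, so strictness has to come from Cauchy-Schwarz: equal norms and a
  \<bullet> b = |a|^2 would force a = b.\<close>

lemma norm_powr_subgradient_strict:
  fixes a b :: "'a::real_inner"
  assumes p: "p > 1" and ne: "a \<noteq> b"
  shows "norm b powr p > norm a powr p + p * (pflux p a \<bullet> (b - a))"
proof (cases "a = 0")
  case True
  then show ?thesis using ne p by simp
next
  case False
  define x where "x = norm a"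
  define t where "t = norm b / x"
  have x: "x > 0" using False by (simp add: x_def)
  have nb: "norm b = t * x" using x by (simp add: t_def)
  have t: "t \<ge> 0" using x by (simp add: t_def)
  have ab: "pflux p a \<bullet> (b - a) = x powr (p - 2) * (a \<bullet> b) - x powr p"
    using pflux_inner_self[of p a] by (simp add: inner_diff_right x_def) (simp add: pflux_def)
  have xx: "x powr (p - 2) * (x * x) = x powr p"
    using x by (simp add: powr_diff power2_eq_square)
  have cs: "a \<bullet> b \<le> x * (t * x)"
    using norm_cauchy_schwarz[of a b] by (simp add: x_def[symmetric] nb)
  have "x powr (p - 2) * (a \<bullet> b) \<le> x powr (p - 2) * (x * (t * x))"
    using cs by (intro mult_left_mono) auto
  also have "\<dots> = t * x powr p" using xx by (simp add: algebra_simps)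
  finally have 1: "x powr (p - 2) * (a \<bullet> b) \<le> t * x powr p" .
  show ?thesis
  proof (cases "t = 1")
    case True
    have "a \<bullet> b < x * x"
    proof (rule ccontr)
      assume "\<not> a \<bullet> b < x * x"
      then have "a \<bullet> b \<ge> x * x" by simp
      moreover have "(norm (a - b))\<^sup>2 = x * x + x * x - 2 * (a \<bullet> b)"
        using True nb dot_norm_neg[of a b] by (simp add: x_def power2_eq_square)
      ultimately have "(norm (a - b))\<^sup>2 \<le> 0" by simp
      then show False using ne by simp
    qed
    then have "x powr (p - 2) * (a \<bullet> b) < x powr (p - 2) * (x * x)"
      using x by (intro mult_strict_left_mono) auto
    then have "x powr (p - 2) * (a \<bullet> b) < x powr p" using xx by simp
    then have "p * (x powr (p - 2) * (a \<bullet> b) - x powr p) < 0"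
      using p by (simp add: mult_less_0_iff)
    then show ?thesis using ab nb True by (simp add: x_def)
  next
    case False
    have "x powr p * (1 + p * (t - 1)) < x powr p * t powr p"
      using powr_bernoulli_strict[OF p t False] x by (intro mult_strict_left_mono) auto
    then have "x powr p + p * (t * x powr p - x powr p) < norm b powr p"
      using t x by (simp add: nb powr_mult algebra_simps)
    moreover have "p * (x powr (p - 2) * (a \<bullet> b) - x powr p) \<le> p * (t * x powr p - x powr p)"
      using 1 p by (intro mult_left_mono) auto
    ultimately show ?thesis using ab by (simp add: x_def)
  qed
qed

lemma norm_powr_subgradient:
  fixes a b :: "'a::real_inner"
  assumes "p > 1"
  shows "norm b powr p \<ge> norm a powr p + p * (pflux p a \<bullet> (b - a))"
  using norm_powr_subgradient_strict[OF assms, of a b] by (cases "a = b") auto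

lemma norm_add_powr_le:
  fixes a b :: "'a::real_normed_vector"
  assumes "p > 0"
  shows "norm (a + b) powr p \<le> 2 powr p * (norm a powr p + norm b powr p)"
proof -
  have "norm (a + b) \<le> 2 * max (norm a) (norm b)"
    using norm_triangle_ineq[of a b] by linarith
  then have "norm (a + b) powr p \<le> (2 * max (norm a) (norm b)) powr p"
    using assms by (intro powr_mono2) auto
  also have "\<dots> = 2 powr p * max (norm a) (norm b) powr p" by (simp add: powr_mult)
  also have "max (norm a) (norm b) powr p \<le> norm a powr p + norm b powr p"
    by (simp add: max_def)
  finally show ?thesis by simp
qed

lemma norm_diff_powr_le:
  fixes a b :: "'a::real_normed_vector"
  assumes "p > 0"
  shows "norm (a - b) powr p \<le> 2 powr p * (norm a powr p + norm b powr p)"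
  using norm_add_powr_le[OF assms, of a "- b"] by simp

text \<open>Instead of convexity, a case split at b = \<epsilon> a: below it the first term on the
  right suffices, above it a < b / \<epsilon> gives the second one with C =
  \<epsilon>^(1-p).\<close>

lemma powr_young:
  fixes p \<epsilon> :: real
  assumes "p > 1" "\<epsilon> > 0"
  obtains C where "C > 0" "\<And>a b. a \<ge> 0 \<Longrightarrow> b \<ge> 0 \<Longrightarrow> a powr (p - 1) * b \<le> \<epsilon> * a powr p + C * b powr p"
proof (rule that)
  show "\<epsilon> powr (1 - p) > 0" using assms by simp
  fix a b :: real assume ab: "a \<ge> 0" "b \<ge> 0"
  show "a powr (p - 1) * b \<le> \<epsilon> * a powr p + \<epsilon> powr (1 - p) * b powr p"
  proof (cases "b \<le> \<epsilon> * a")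
    case True
    have "a powr (p - 1) * b \<le> a powr (p - 1) * (\<epsilon> * a)"
      using True by (intro mult_left_mono) auto
    also have "\<dots> = \<epsilon> * a powr p" using ab by (cases "a = 0") (auto simp: powr_diff)
    finally show ?thesis by (smt (verit) powr_ge_zero mult_nonneg_nonneg)
  next
    case False
    then have b: "b > 0" using ab assms by (smt (verit) mult_nonneg_nonneg)
    have "a powr (p - 1) \<le> (b / \<epsilon>) powr (p - 1)"
      using False ab assms by (intro powr_mono2) (auto simp: field_simps)
    then have "a powr (p - 1) * b \<le> (b / \<epsilon>) powr (p - 1) * b"
      using ab by (intro mult_right_mono) auto
    also have "\<dots> = \<epsilon> powr (1 - p) * b powr p"
      using b assms by (simp add: powr_divide powr_diff field_simps)
    finally show ?thesis using assms by (smt (verit) powr_ge_zero mult_nonneg_nonneg)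
  qed
qed

section \<open>Quantified strict convexity of the p-th power of the norm\<close>

lemma norm_le_1_of_powr:
  assumes "p > 1" "norm x powr p \<le> 1"
  shows "norm x \<le> 1"
  using assms gr_one_powr[of "norm x" p] by (meson not_le order_less_trans zero_less_one)

text \<open>Twice the convexity defect of |.|^p at the midpoint. It arises in two ways, from
  comparing two almost-minimisers with their midpoint and from the monotonicity of
  \<open>pflux\<close>, so that a single compactness argument serves both.\<close>

definition midgap :: "real \<Rightarrow> 'a::real_inner \<Rightarrow> 'a \<Rightarrow> real" where
  "midgap p a b = norm a powr p + norm b powr p - 2 * norm ((1/2) *\<^sub>R (a + b)) powr p"

text \<open>Add the strict subgradient inequalities at the midpoint m towards a and b; the linear
  terms cancel because a - m = -(b - m).\<close>

lemma midgap_pos: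
  assumes p: "p > 1" and ne: "a \<noteq> b"
  shows "midgap p a b > 0"
proof -
  define m where "m = (1/2) *\<^sub>R (a + b)"
  have "m + m = a + b"
    unfolding m_def scaleR_right_distrib[symmetric] by (rule scaleR_half_double)
  then have am: "a - m = - (b - m)" by (simp add: algebra_simps)
  have "m \<noteq> a" "m \<noteq> b"
    using am ne by force+
  from norm_powr_subgradient_strict[OF p this(1)] norm_powr_subgradient_strict[OF p this(2)]
  have "norm a powr p + norm b powr p > 2 * norm m powr p + p * (pflux p m \<bullet> (a - m) + pflux p m \<bullet> (b - m))"
    by (simp add: algebra_simps)
  moreover have "pflux p m \<bullet> (a - m) + pflux p m \<bullet> (b - m) = 0"
    unfolding am by (simp only: inner_minus_right add.left_inverse)
  ultimately show ?thesis by (simp add: midgap_def m_def)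
qed

lemma midgap_nonneg: "p > 1 \<Longrightarrow> midgap p a b \<ge> 0"
proof (cases "a = b")
  case True
  show ?thesis unfolding midgap_def True scaleR_half_double by simp
next
  case False
  assume "p > 1" with False show ?thesis using midgap_pos[of p a b] by simp
qed

text \<open>Both sides are homogeneous of degree \<open>p\<close>, so it is enough to bound them on a compact set.\<close>

lemma norm_diff_powr_le_midgap:
  fixes p \<epsilon> :: real
  assumes p: "p > 1" and e: "\<epsilon> > 0"
  obtains C where "C > 0" "\<And>a b::'a::euclidean_space.
    norm (a - b) powr p \<le> \<epsilon> * (norm a powr p + norm b powr p) + C * midgap p a b"
proof -
  \<comment> \<open>Normalised pairs for which the \<epsilon> term alone does not yet give the
    bound. On this compact set a \<noteq> b, hence \<open>midgap\<close> has a positive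
    minimum.\<close>
  define K where "K = {(a::'a, b). norm a powr p + norm b powr p = 1 \<and> norm (a - b) powr p \<ge> \<epsilon>}"
  have cont: "continuous_on UNIV (\<lambda>x. norm (h x) powr p)"
    if "continuous_on UNIV h" for h :: "'a \<times> 'a \<Rightarrow> 'a"
    using p that by (intro continuous_on_powr' continuous_intros) auto
  have c1: "continuous_on UNIV (\<lambda>x::'a\<times>'a. norm (fst x) powr p + norm (snd x) powr p)"
    by (intro continuous_on_add cont continuous_intros)
  have c2: "continuous_on UNIV (\<lambda>x::'a\<times>'a. norm (fst x - snd x) powr p)"
    by (intro cont continuous_intros)
  have c3: "continuous_on UNIV (\<lambda>x::'a\<times>'a. midgap p (fst x) (snd x))"
    unfolding midgap_def by (intro continuous_intros cont continuous_on_mult)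
  have "K = {x. norm (fst x) powr p + norm (snd x) powr p = 1} \<inter> {x. \<epsilon> \<le> norm (fst x - snd x) powr p}"
    by (auto simp: K_def)
  then have "closed K"
    using c1 c2 by (auto intro!: closed_Int closed_Collect_eq closed_Collect_le simp: continuous_on_const)
  moreover have "bounded K"
  proof -
    have "norm x \<le> 2" if "x \<in> K" for x
    proof -
      have "norm (fst x) powr p \<le> 1" "norm (snd x) powr p \<le> 1"
        using that powr_ge_zero[of "norm (fst x)" p] powr_ge_zero[of "norm (snd x)" p]
        unfolding K_def case_prod_unfold mem_Collect_eq by linarith+
      then have "norm (fst x) \<le> 1" "norm (snd x) \<le> 1"
        using norm_le_1_of_powr[OF p] by auto
      then show ?thesis using norm_Pair_le[of "fst x" "snd x"] by simp
    qed
    then show ?thesis unfolding bounded_iff by blast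
  qed
  ultimately have "compact K" by (simp add: compact_eq_bounded_closed)
  obtain \<mu> where mu: "\<mu> > 0" "\<And>a b. (a, b) \<in> K \<Longrightarrow> midgap p a b \<ge> \<mu>"
  proof (cases "K = {}")
    case True then show ?thesis using that[of 1] by simp
  next
    case False
    obtain x where x: "x \<in> K" "\<And>y. y \<in> K \<Longrightarrow> midgap p (fst x) (snd x) \<le> midgap p (fst y) (snd y)"
      using continuous_attains_inf[OF \<open>compact K\<close> False continuous_on_subset[OF c3]] by auto
    have "fst x \<noteq> snd x" using x(1) e by (auto simp: K_def case_prod_unfold)
    then show ?thesis using that[of "midgap p (fst x) (snd x)"] x(2) midgap_pos[OF p] by fastforce
  qed
  \<comment> \<open>With s the sum of the two p-th powers, |a - b|^p \<le> 2^p s always holds, while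
    \<open>midgap\<close> is at least \<mu> s wherever the \<epsilon> term does not suffice.\<close>
  define C where "C = 2 powr p / \<mu>"
  have C: "C > 0" using mu by (simp add: C_def)
  have *: "norm (a - b) powr p \<le> \<epsilon> * (norm a powr p + norm b powr p) + C * midgap p a b" for a b :: 'a
  proof -
    define s where "s = norm a powr p + norm b powr p"
    show ?thesis
    proof (cases "s = 0 \<or> norm (a - b) powr p < \<epsilon> * s")
      case True
      then show ?thesis
      proof
        assume "s = 0"
        then have "norm a powr p = 0" "norm b powr p = 0"
          unfolding s_def by (smt (verit) powr_ge_zero)+
        then show ?thesis by (simp add: midgap_def)
      next
        assume "norm (a - b) powr p < \<epsilon> * s"
        then show ?thesis using midgap_nonneg[OF p, of a b] C
          unfolding s_def by (smt (verit) mult_nonneg_nonneg)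
      qed
    next
      case False
      have s: "s > 0" using False unfolding s_def by (smt (verit) powr_ge_zero)
      define t where "t = s powr (- 1 / p)"
      have t: "t > 0" using s by (simp add: t_def)
      have tp: "t powr p = 1 / s"
        using s p by (simp only: t_def powr_powr) (simp add: powr_minus_divide)
      have sc: "norm (t *\<^sub>R y) powr p = norm y powr p / s" for y :: 'a
        using t tp by (simp add: powr_mult)
      have sc2: "norm ((1/2) *\<^sub>R (t *\<^sub>R a + t *\<^sub>R b)) powr p = norm ((1/2) *\<^sub>R (a + b)) powr p / s"
        using sc[of "(1/2) *\<^sub>R (a + b)"] by (simp add: scaleR_add_right mult.commute)
      have sc3: "norm (t *\<^sub>R a - t *\<^sub>R b) powr p = norm (a - b) powr p / s"
        using sc[of "a - b"] by (simp add: scaleR_diff_right)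
      have "(t *\<^sub>R a, t *\<^sub>R b) \<in> K"
      proof -
        have "norm (t *\<^sub>R a) powr p + norm (t *\<^sub>R b) powr p = s / s"
          unfolding sc s_def by (simp only: add_divide_distrib)
        moreover have "norm (t *\<^sub>R a - t *\<^sub>R b) powr p \<ge> \<epsilon>"
          unfolding sc3 using False s by (simp add: field_simps)
        ultimately show ?thesis unfolding K_def using s by simp
      qed
      then have "\<mu> \<le> midgap p (t *\<^sub>R a) (t *\<^sub>R b)" using mu by blast
      also have "\<dots> = midgap p a b / s"
        unfolding midgap_def sc sc2 by (simp add: diff_divide_distrib add_divide_distrib)
      finally have "\<mu> * s \<le> midgap p a b" using s by (simp add: field_simps)
      moreover have "norm (a - b) powr p \<le> 2 powr p * s"
        using norm_diff_powr_le[of p a b] p by (simp add: s_def)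
      moreover have "2 powr p * s = C * (\<mu> * s)" using mu by (simp add: C_def)
      ultimately have "norm (a - b) powr p \<le> C * midgap p a b"
        using C mult_left_mono[of "\<mu> * s" "midgap p a b" C] by linarith
      moreover have "\<epsilon> * s > 0" using e s by simp
      ultimately show ?thesis unfolding s_def by linarith
    qed
  qed
  show ?thesis by (rule that[OF C *])
qed

text \<open>Add the subgradient inequalities at a and at b, both evaluated at the midpoint. The two
  displacements are opposite halves of b - a, so the linear terms combine into the monotonicity
  expression.\<close>

lemma midgap_le_pflux_mono:
  assumes p: "p > 1"
  shows "midgap p a b \<le> p / 2 * ((pflux p a - pflux p b) \<bullet> (a - b))"
proof -
  define m where "m = (1/2) *\<^sub>R (a + b)"
  have "m - a = (1/2) *\<^sub>R (a + b) - (1/2) *\<^sub>R (a + a)"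
    by (simp add: m_def scaleR_half_double)
  also have "\<dots> = (1/2) *\<^sub>R (b - a)" by (simp only: scaleR_diff_right[symmetric] add_diff_cancel_left)
  finally have e1: "m - a = (1/2) *\<^sub>R (b - a)" .
  have "m - b = (1/2) *\<^sub>R (a + b) - (1/2) *\<^sub>R (b + b)"
    by (simp add: m_def scaleR_half_double)
  also have "\<dots> = - ((1/2) *\<^sub>R (b - a))" 
    by (simp only: scaleR_diff_right[symmetric] scaleR_minus_right[symmetric] add_diff_cancel_right minus_diff_eq)
  finally have e2: "m - b = - ((1/2) *\<^sub>R (b - a))" .
  have "2 * norm m powr p \<ge> norm a powr p + norm b powr p + p * (pflux p a \<bullet> (m - a) + pflux p b \<bullet> (m - b))"
    using norm_powr_subgradient[OF p, of a m] norm_powr_subgradient[OF p, of b m]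
    by (simp add: algebra_simps)
  also have "pflux p a \<bullet> (m - a) + pflux p b \<bullet> (m - b) = - ((pflux p a - pflux p b) \<bullet> (a - b)) / 2"
    unfolding e1 e2 by (simp add: inner_diff_left inner_diff_right field_simps)
  finally show ?thesis by (simp add: midgap_def m_def)
qed

lemma pflux_mono:
  assumes p: "p > 1"
  shows "(pflux p a - pflux p b) \<bullet> (a - b) \<ge> 0"
  using midgap_le_pflux_mono[OF p, of a b] midgap_nonneg[OF p, of a b] p
  by (smt (verit) divide_pos_pos mult_pos_neg)

text \<open>The \<epsilon> term lets one statement cover every p > 1: for p < 2 no multiple of the
  monotonicity expression bounds |a - b|^p.\<close>

lemma norm_diff_powr_le_pflux_mono:
  fixes p \<epsilon> :: real
  assumes p: "p > 1" and e: "\<epsilon> > 0"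
  obtains C where "C > 0" "\<And>a b::'a::euclidean_space.
    norm (a - b) powr p \<le> \<epsilon> * (norm a powr p + norm b powr p) + C * ((pflux p a - pflux p b) \<bullet> (a - b))"
proof -
  obtain C where C: "C > 0" "\<And>a b::'a. norm (a - b) powr p \<le> \<epsilon> * (norm a powr p + norm b powr p) + C * midgap p a b"
    using norm_diff_powr_le_midgap[OF p e] by blast
  have "C * midgap p a b \<le> C * p / 2 * ((pflux p a - pflux p b) \<bullet> (a - b))" for a b :: 'a
    using mult_left_mono[OF midgap_le_pflux_mono[OF p, of a b], of C] C(1) by simp
  then show ?thesis
    by (intro that[of "C * p / 2"]) (use C p in \<open>auto intro: order_trans[OF C(2)]\<close>)
qed

text \<open>Uniform continuity of the field on the unit ball, extended to all vectors by homogeneity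
  of degree p. Integrated, it says that the flux depends continuously on a gradient converging in
  L^p when paired with a fixed field.\<close>

lemma pflux_diff_le:
  fixes p \<epsilon> :: real
  assumes p: "p > 1" and e: "\<epsilon> > 0"
  obtains C where "C > 0" "\<And>(a::'a::euclidean_space) b (c::'a).
    norm (pflux p a - pflux p b) * norm c
      \<le> \<epsilon> * (norm a powr p + norm b powr p + norm c powr p) + C * norm (a - b) powr p"
proof -
  have "uniformly_continuous_on (cball 0 1) (pflux p :: 'a \<Rightarrow> 'a)"
    by (rule compact_uniformly_continuous) (auto intro: continuous_on_subset[OF continuous_on_pflux[OF p]])
  then obtain d where d: "d > 0"
    "\<And>a b::'a. norm a \<le> 1 \<Longrightarrow> norm b \<le> 1 \<Longrightarrow> norm (a - b) < d \<Longrightarrow> norm (pflux p a - pflux p b) < \<epsilon>"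
    using e unfolding uniformly_continuous_on_def by (fastforce simp: dist_norm)
  \<comment> \<open>If |a - b| is at least the modulus d, the left side is at most 2 on the unit
    ball, and C d^p = 2.\<close>
  define C where "C = 2 * d powr (- p)"
  have C: "C > 0" using d by (simp add: C_def)
  have unit: "norm (pflux p a - pflux p b) * norm c \<le> \<epsilon> + C * norm (a - b) powr p"
    if "norm a \<le> 1" "norm b \<le> 1" "norm c \<le> 1" for a b c :: 'a
  proof (cases "norm (a - b) < d")
    case True
    have "norm (pflux p a - pflux p b) * norm c \<le> \<epsilon> * 1"
      using d(2)[of a b] True that e by (intro mult_mono) auto
    then show ?thesis using C by (smt (verit) mult_nonneg_nonneg powr_ge_zero)
  next
    case False
    have "norm (pflux p a) \<le> 1" "norm (pflux p b) \<le> 1"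
      using that p by (auto simp: norm_pflux powr_le1)
    then have "norm (pflux p a - pflux p b) * norm c \<le> 2 * 1"
      using that norm_triangle_ineq4[of "pflux p a" "pflux p b"] by (intro mult_mono) auto
    also have "\<dots> \<le> C * d powr p" using d by (simp add: C_def powr_minus)
    also have "\<dots> \<le> C * norm (a - b) powr p"
      using False C d p by (intro mult_left_mono powr_mono2) auto
    finally show ?thesis using e by simp
  qed
  have *: "norm (pflux p a - pflux p b) * norm c
      \<le> \<epsilon> * (norm a powr p + norm b powr p + norm c powr p) + C * norm (a - b) powr p" for a b c :: 'a
  proof -
    define s where "s = norm a powr p + norm b powr p + norm c powr p"
    show ?thesis
    proof (cases "s = 0")
      case True
      then have "norm a powr p = 0" "norm b powr p = 0"
        unfolding s_def by (smt (verit) powr_ge_zero)+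
      then show ?thesis using e C by simp
    next
      case False
      have s: "s > 0" using False unfolding s_def by (smt (verit) powr_ge_zero)
      define t where "t = s powr (- 1 / p)"
      have t: "t > 0" using s by (simp add: t_def)
      have tp: "t powr p = 1 / s"
        using s p by (simp only: t_def powr_powr) (simp add: powr_minus_divide)
      have sc: "norm (t *\<^sub>R y) powr p = norm y powr p / s" for y :: 'a
        using t tp by (simp add: powr_mult)
      have le1: "norm (t *\<^sub>R y) \<le> 1" if "norm y powr p \<le> s" for y :: 'a
      proof (rule ccontr)
        assume "\<not> ?thesis"
        then have "norm (t *\<^sub>R y) powr p > 1" using p by (intro gr_one_powr) auto
        then show False using that s unfolding sc by simp
      qed
      have "norm (pflux p (t *\<^sub>R a) - pflux p (t *\<^sub>R b)) * norm (t *\<^sub>R c)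
          \<le> \<epsilon> + C * norm (t *\<^sub>R a - t *\<^sub>R b) powr p"
        by (intro unit le1) (auto simp: s_def)
      also have "norm (t *\<^sub>R a - t *\<^sub>R b) powr p = norm (a - b) powr p / s"
        using sc[of "a - b"] by (simp add: scaleR_diff_right)
      also have "norm (pflux p (t *\<^sub>R a) - pflux p (t *\<^sub>R b)) * norm (t *\<^sub>R c)
          = norm (pflux p a - pflux p b) * norm c * (t powr (p - 1) * t)"
        using t by (simp add: pflux_scale flip: scaleR_diff_right)
      also have "t powr (p - 1) * t = 1 / s"
        using t tp by (simp add: powr_diff)
      finally have "norm (pflux p a - pflux p b) * norm c \<le> \<epsilon> * s + C * norm (a - b) powr p"
        using s by (simp add: field_simps)
      then show ?thesis by (simp only: s_def)
    qed
  qed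
  show ?thesis by (rule that[OF C *])
qed

section \<open>Smooth functions\<close>

lemma partial_deriv_eq:
  assumes "(f has_derivative D) (at x)"
  shows "partial_deriv b f x = D b"
  using frechet_derivative_at[OF assms] by (simp add: partial_deriv_def)

lemma C_k_SucI:
  assumes "\<And>x. (f has_derivative D x) (at x)" and "\<And>b. b \<in> Basis \<Longrightarrow> C_k k (\<lambda>x. D x b)"
  shows "C_k (Suc k) f"
proof -
  have "partial_deriv b f = (\<lambda>x. D x b)" for b
    using partial_deriv_eq[OF assms(1)] by blast
  moreover have "f differentiable_on UNIV"
    using assms(1) by (auto simp: differentiable_on_def differentiable_def intro: has_derivative_at_withinI)
  ultimately show ?thesis using assms(2) by simp
qed

lemma C_k_has_derivative:
  assumes "C_k (Suc k) f"
  shows "(f has_derivative (\<lambda>h. frechet_derivative f (at x) h)) (at x)"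
  using assms by (simp add: differentiable_on_def frechet_derivative_works flip: frechet_derivative_works)

lemma C_k_frechet_derivative:
  assumes "C_k (Suc k) f" "b \<in> Basis"
  shows "C_k k (\<lambda>x. frechet_derivative f (at x) b)"
  using assms by (auto simp: partial_deriv_def[abs_def])

lemma C_k_Suc_imp: "C_k (Suc k) f \<Longrightarrow> C_k k f"
proof (induction k arbitrary: f)
  case 0
  then show ?case by (auto simp: differentiable_imp_continuous_on)
next
  case (Suc k)
  have "C_k k (partial_deriv b f)" if "b \<in> Basis" for b
    using Suc.prems that by (intro Suc.IH) auto
  with Suc.prems show ?case by auto
qed

lemma C_k_const: "C_k k (\<lambda>x. c)"
proof (induction k arbitrary: c)
  case 0 then show ?case by simp
next
  case (Suc k)
  then show ?case by (intro C_k_SucI[where D="\<lambda>x h. 0"]) auto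
qed

lemma C_k_add:
  assumes "C_k k f" "C_k k g"
  shows "C_k k (\<lambda>x. f x + g x)"
  using assms
proof (induction k arbitrary: f g)
  case 0
  then show ?case by (auto intro: continuous_intros)
next
  case (Suc k)
  show ?case
  proof (rule C_k_SucI)
    show "((\<lambda>x. f x + g x) has_derivative
       (\<lambda>h. frechet_derivative f (at x) h + frechet_derivative g (at x) h)) (at x)" for x
      by (intro has_derivative_add C_k_has_derivative[OF Suc.prems(1)] C_k_has_derivative[OF Suc.prems(2)])
    show "C_k k (\<lambda>x. frechet_derivative f (at x) b + frechet_derivative g (at x) b)" if "b \<in> Basis" for b
      using Suc.prems that by (intro Suc.IH C_k_frechet_derivative)
  qed
qed

lemma C_k_mult:
  assumes "C_k k f" "C_k k g"
  shows "C_k k (\<lambda>x. f x * g x)"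
  using assms
proof (induction k arbitrary: f g)
  case 0
  then show ?case by (auto intro: continuous_intros)
next
  case (Suc k)
  show ?case
  proof (rule C_k_SucI)
    show "((\<lambda>x. f x * g x) has_derivative
       (\<lambda>h. f x * frechet_derivative g (at x) h + frechet_derivative f (at x) h * g x)) (at x)" for x
      by (intro has_derivative_mult C_k_has_derivative[OF Suc.prems(1)] C_k_has_derivative[OF Suc.prems(2)])
    show "C_k k (\<lambda>x. f x * frechet_derivative g (at x) b + frechet_derivative f (at x) b * g x)"
      if "b \<in> Basis" for b
      by (intro C_k_add Suc.IH C_k_frechet_derivative Suc.prems that
          C_k_Suc_imp[OF Suc.prems(1)] C_k_Suc_imp[OF Suc.prems(2)])
  qed
qed

lemma C_k_inner: "C_k k (\<lambda>x. x \<bullet> c)"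
proof (cases k)
  case 0 then show ?thesis by (auto intro: continuous_intros)
next
  case (Suc j)
  have "C_k (Suc j) (\<lambda>x. x \<bullet> c)"
    by (rule C_k_SucI[where D="\<lambda>x h. h \<bullet> c"]) (auto intro!: derivative_eq_intros C_k_const)
  then show ?thesis using Suc by simp
qed

lemma C_infinity_GDERIV:
  assumes "C_infinity f"
  shows "GDERIV f x :> grad f x"
proof -
  have D: "(f has_derivative frechet_derivative f (at x)) (at x)"
    using assms C_k_has_derivative[of 0 f x] by (auto simp: C_infinity_def simp del: C_k.simps)
  then interpret linear "frechet_derivative f (at x)" by (rule has_derivative_linear)
  have "frechet_derivative f (at x) h = h \<bullet> grad f x" for h
  proof -
    have "frechet_derivative f (at x) h = frechet_derivative f (at x) (\<Sum>b\<in>Basis. (h \<bullet> b) *\<^sub>R b)"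
      by (simp add: euclidean_representation)
    also have "\<dots> = (\<Sum>b\<in>Basis. (h \<bullet> b) * frechet_derivative f (at x) b)"
      by (simp add: sum scale)
    also have "\<dots> = h \<bullet> grad f x"
      by (simp add: grad_def partial_deriv_def inner_sum_right mult.commute)
    finally show ?thesis .
  qed
  then have "frechet_derivative f (at x) = (\<lambda>h. h \<bullet> grad f x)" by blast
  then show ?thesis using D unfolding gderiv_def by (simp only:)
qed

lemma C_infinity_partial_deriv: "C_infinity f \<Longrightarrow> b \<in> Basis \<Longrightarrow> C_infinity (partial_deriv b f)"
  using C_k.simps(2) unfolding C_infinity_def by blast

lemma C_infinity_continuous: "C_infinity f \<Longrightarrow> continuous_on UNIV f"
  using C_k.simps(1) unfolding C_infinity_def by blast

lemma C_infinity_continuous_grad: "C_infinity f \<Longrightarrow> continuous_on UNIV (grad f)"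
  unfolding grad_def
  by (intro continuous_intros) (auto intro: C_infinity_continuous C_infinity_partial_deriv)

lemma partial_deriv_eq_grad: "b \<in> Basis \<Longrightarrow> partial_deriv b f x = grad f x \<bullet> b"
  by (simp add: grad_def inner_sum_left inner_Basis if_distrib cong: if_cong)

lemma grad_eq:
  assumes "GDERIV f x :> D"
  shows "grad f x = D"
proof (rule euclidean_eqI)
  fix b :: 'a assume b: "b \<in> Basis"
  show "grad f x \<bullet> b = D \<bullet> b"
    using partial_deriv_eq_grad[OF b, of f x] partial_deriv_eq[of f "\<lambda>h. h \<bullet> D" x b] assms
    by (simp add: gderiv_def inner_commute)
qed

section \<open>Smooth bump functions\<close>

lemma poly_times_exp_minus_tendsto_0:
  fixes P :: "real poly"
  shows "((\<lambda>x. x ^ k * poly P x * exp (- x)) \<longlongrightarrow> 0) at_top"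
proof (induction P arbitrary: k)
  case 0
  then show ?case by simp
next
  case (pCons a P)
  \<comment> \<open>Peeling the constant coefficient off the polynomial raises the outer power by
    one, which is why k is kept arbitrary.\<close>
  have "((\<lambda>x. a * (x ^ k / exp x) + x ^ Suc k * poly P x * exp (- x)) \<longlongrightarrow> a * 0 + 0) at_top"
    by (intro tendsto_intros tendsto_power_div_exp_0 pCons.IH)
  then show ?case by (simp add: algebra_simps exp_minus divide_inverse)
qed

text \<open>The family P(1/t) exp(-1/t), extended by 0 to t \<le> 0, is closed under
  differentiation; carrying the polynomial along reaches all derivatives by one induction.\<close>

definition bump_fun :: "real poly \<Rightarrow> real \<Rightarrow> real" where
  "bump_fun P t = (if t > 0 then poly P (inverse t) * exp (- inverse t) else 0)"

text \<open>For t > 0 the derivative is t^(-2) (P - P')(1/t) exp(-1/t), hence the factor X^2 =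
  \<open>[:0, 0, 1:]\<close>. At 0 the right difference quotient is x P(x) exp(-x) with x = 1/h,
  which tends to 0, and the left one is 0.\<close>

lemma bump_fun_DERIV: "DERIV (bump_fun P) t :> bump_fun ([:0, 0, 1:] * (P - pderiv P)) t"
proof -
  consider "t > 0" | "t < 0" | "t = 0" by linarith
  then show ?thesis
  proof cases
    case 1
    have "DERIV (\<lambda>t. poly P (inverse t) * exp (- inverse t)) t :>
        bump_fun ([:0, 0, 1:] * (P - pderiv P)) t"
      using 1 by (auto intro!: derivative_eq_intros poly_DERIV[THEN DERIV_chain2]
          simp: bump_fun_def field_simps power2_eq_square)
    then show ?thesis
      by (rule has_field_derivative_transform_within_open[where S="{0<..}"]) (use 1 in \<open>auto simp: bump_fun_def\<close>)
  next
    case 2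
    have "DERIV (\<lambda>t. 0) t :> bump_fun ([:0, 0, 1:] * (P - pderiv P)) t"
      using 2 by (auto simp: bump_fun_def)
    then show ?thesis
      by (rule has_field_derivative_transform_within_open[where S="{..<0}"]) (use 2 in \<open>auto simp: bump_fun_def\<close>)
  next
    case 3
    have "((\<lambda>x. x ^ 1 * poly P x * exp (- x)) \<longlongrightarrow> 0) at_top"
      by (rule poly_times_exp_minus_tendsto_0)
    then have "((\<lambda>h. inverse h ^ 1 * poly P (inverse h) * exp (- inverse h)) \<longlongrightarrow> 0) (at_right 0)"
      by (rule filterlim_compose) (rule filterlim_inverse_at_top_right)
    then have "((\<lambda>h. bump_fun P h / h) \<longlongrightarrow> 0) (at_right 0)"
      by (rule Lim_transform_eventually)
        (auto simp: bump_fun_def eventually_at_right_less divide_inverse mult_ac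
          intro!: eventually_mono[OF eventually_at_right_less])
    moreover have "((\<lambda>h. bump_fun P h / h) \<longlongrightarrow> 0) (at_left 0)"
      by (rule Lim_transform_eventually[of "\<lambda>h. 0"])
        (auto simp: bump_fun_def eventually_at_left_field intro!: exI[of _ "-1"])
    ultimately have "((\<lambda>h. bump_fun P h / h) \<longlongrightarrow> 0) (at 0)"
      by (simp add: filterlim_split_at)
    then show ?thesis using 3 by (simp add: DERIV_def bump_fun_def)
  qed
qed

lemma C_k_bump_fun: "C_k k (\<lambda>x::'a::euclidean_space. bump_fun P (r - x \<bullet> x))"
proof (induction k arbitrary: P)
  case 0
  have "continuous_on UNIV (bump_fun P)"
    using bump_fun_DERIV by (auto intro!: continuous_at_imp_continuous_on DERIV_isCont)
  then have "continuous_on UNIV (bump_fun P \<circ> (\<lambda>x::'a. r - x \<bullet> x))"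
    by (intro continuous_on_compose continuous_intros) (auto intro: continuous_on_subset)
  then show ?case by (simp add: o_def)
next
  case (Suc k)
  let ?Q = "[:0, 0, 1:] * (P - pderiv P)"
  show ?case
  proof (rule C_k_SucI)
    show "((\<lambda>x::'a. bump_fun P (r - x \<bullet> x)) has_derivative
       (\<lambda>h. bump_fun ?Q (r - x \<bullet> x) * (-2 * (x \<bullet> h)))) (at x)" for x
    proof -
      have "((\<lambda>x::'a. r - x \<bullet> x) has_derivative (\<lambda>h. -2 * (x \<bullet> h))) (at x)"
        by (auto intro!: derivative_eq_intros simp: inner_commute)
      from has_derivative_compose[OF this bump_fun_DERIV[of P "r - x \<bullet> x", unfolded has_field_derivative_def]]
      show ?thesis by simp
    qed
    show "C_k k (\<lambda>x::'a. bump_fun ?Q (r - x \<bullet> x) * (-2 * (x \<bullet> b)))" for b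
      by (intro C_k_mult Suc.IH C_k_const C_k_inner)
  qed
qed

section \<open>Gradients of compactly supported functions integrate to zero\<close>

lemma lborel_translation:
  fixes f :: "'a::euclidean_space \<Rightarrow> real"
  assumes "continuous_on UNIV f" "integrable lborel f"
  shows "integrable lborel (\<lambda>x. f (x + z))" "(LINT x|lborel. f (x + z)) = (LINT x|lborel. f x)"
proof -
  have bf: "f \<in> borel_measurable borel" using assms(1) by (rule borel_measurable_continuous_onI)
  have "integrable (distr lborel borel ((+) z)) f" using assms(2) by (simp add: lborel_distr_plus)
  then show "integrable lborel (\<lambda>x. f (x + z))"
    using bf by (subst (asm) integrable_distr_eq) (auto simp: add.commute)
  have "(LINT x|lborel. f x) = (LINT x|distr lborel borel ((+) z). f x)" by (simp add: lborel_distr_plus)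
  also have "\<dots> = (LINT x|lborel. f (x + z))"
    using bf by (subst integral_distr) (auto simp: add.commute)
  finally show "(LINT x|lborel. f (x + z)) = (LINT x|lborel. f x)" by simp
qed

lemma integrable_lborel_bounded_support:
  fixes g :: "'a::euclidean_space \<Rightarrow> real"
  assumes "continuous_on UNIV g" "\<And>x. norm x > r \<Longrightarrow> g x = 0"
  shows "integrable lborel g"
proof -
  have "integrable lborel (\<lambda>x. indicator (cball 0 r) x *\<^sub>R g x)"
    by (intro borel_integrable_compact continuous_on_subset[OF assms(1)]) auto
  also have "(\<lambda>x. indicator (cball 0 r) x *\<^sub>R g x) = g"
    using assms(2) by (auto simp: fun_eq_iff indicator_def)
  finally show ?thesis .
qed

text \<open>Translation invariance makes the integrals of the difference quotients vanish.\<close>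

lemma integral_gradient_eq_0:
  fixes f :: "'a::euclidean_space \<Rightarrow> real"
  assumes D: "\<And>x. GDERIV f x :> G x" and cont: "continuous_on UNIV G"
    and supp: "\<And>x. norm x > r \<Longrightarrow> f x = 0" "\<And>x. norm x > r \<Longrightarrow> G x = 0"
  shows "integrable lborel (\<lambda>x. G x \<bullet> b)" "(LINT x|lborel. G x \<bullet> b) = 0"
proof -
  have contf: "continuous_on UNIV f"
    using D by (auto simp: gderiv_def intro!: continuous_at_imp_continuous_on has_derivative_continuous)
  note ig = integrable_lborel_bounded_support
  have contGb: "continuous_on UNIV (\<lambda>x. G x \<bullet> b)" using cont by (intro continuous_intros)
  show "integrable lborel (\<lambda>x. G x \<bullet> b)" using contGb supp by (intro ig[of _ r]) auto
  \<comment> \<open>A bound on the gradient makes f Lipschitz, which is what dominates the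
    difference quotients.\<close>
  have "\<exists>L. \<forall>x. norm (G x) \<le> L"
  proof -
    have "compact (G ` cball 0 r)" by (intro compact_continuous_image continuous_on_subset[OF cont]) auto
    from compact_imp_bounded[OF this] obtain L where L: "\<And>x. norm x \<le> r \<Longrightarrow> norm (G x) \<le> L"
      unfolding bounded_iff by (metis image_eqI mem_cball_0)
    have "norm (G x) \<le> max L 0" for x
      using L[of x] supp(2)[of x] by (cases "norm x \<le> r") auto
    then show ?thesis by blast
  qed
  then obtain L where L: "\<And>x. norm (G x) \<le> L" by blast
  have lip: "norm (f x - f y) \<le> L * norm (x - y)" for x y
  proof -
    have "norm (h \<bullet> G z) \<le> L * norm h" for h z
    proof -
      have "norm (h \<bullet> G z) \<le> norm h * norm (G z)" by (simp add: Cauchy_Schwarz_ineq2)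
      also have "\<dots> \<le> norm h * L" by (intro mult_left_mono L) auto
      finally show ?thesis by (simp add: mult.commute)
    qed
    then have "onorm (\<lambda>h. h \<bullet> G z) \<le> L" for z by (intro onorm_le) auto
    then show ?thesis
      using D by (intro differentiable_bound[of UNIV f "\<lambda>x h. h \<bullet> G x" L]) (auto simp: gderiv_def)
  qed
  define c where "c n = inverse (real (Suc n))" for n
  have c: "c n > 0" "c n \<le> 1" for n by (auto simp: c_def field_simps)
  define F where "F n x = (f (x + c n *\<^sub>R b) - f x) / c n" for n x
  have intf: "integrable lborel f" using contf supp by (intro ig[of _ r])
  note intt = lborel_translation(1)[OF contf intf] and eqt = lborel_translation(2)[OF contf intf]
  have F0: "(LINT x|lborel. F n x) = 0" for n
    unfolding F_def using intf intt eqt by (simp add: Bochner_Integration.integral_diff)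
  have "(\<lambda>n. LINT x|lborel. F n x) \<longlonglongrightarrow> (LINT x|lborel. G x \<bullet> b)"
  proof (rule integral_dominated_convergence)
    \<comment> \<open>Steps have length at most |b|, so all difference quotients vanish outside the
      ball enlarged by |b|; inside, the Lipschitz constant bounds them.\<close>
    let ?w = "\<lambda>x. indicator (cball 0 (\<bar>r\<bar> + norm b)) x *\<^sub>R (L * norm b)"
    show "integrable lborel ?w"
      by (intro borel_integrable_compact) (auto intro: continuous_intros)
    show "(\<lambda>x. G x \<bullet> b) \<in> borel_measurable lborel"
      using contGb borel_measurable_continuous_onI by simp
    show "F n \<in> borel_measurable lborel" for n
      unfolding F_def using contf
      by (auto intro!: borel_measurable_continuous_onI continuous_intros continuous_on_compose2[OF contf] simp: c_def)
    show "AE x in lborel. (\<lambda>n. F n x) \<longlonglongrightarrow> G x \<bullet> b"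
    proof (intro AE_I2)
      fix x
      have "((\<lambda>t. x + t *\<^sub>R b) has_derivative (\<lambda>t. t *\<^sub>R b)) (at 0)"
        by (auto intro!: derivative_eq_intros)
      from has_derivative_compose[OF this, of f "\<lambda>h. h \<bullet> G x"] D[of x]
      have "((\<lambda>t. f (x + t *\<^sub>R b)) has_field_derivative (G x \<bullet> b)) (at 0)"
        by (simp add: gderiv_def has_field_derivative_def inner_commute mult_commute_abs)
      then have "((\<lambda>t. (f (x + t *\<^sub>R b) - f x) / t) \<longlongrightarrow> G x \<bullet> b) (at 0)"
        by (simp add: DERIV_def)
      moreover have "filterlim c (at 0) sequentially"
        unfolding filterlim_at c_def using LIMSEQ_inverse_real_of_nat by auto
      ultimately show "(\<lambda>n. F n x) \<longlonglongrightarrow> G x \<bullet> b"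
        unfolding F_def by (rule filterlim_compose)
    qed
    show "AE x in lborel. norm (F n x) \<le> ?w x" for n
    proof (intro AE_I2)
      fix x
      show "norm (F n x) \<le> ?w x"
      proof (cases "norm x \<le> \<bar>r\<bar> + norm b")
        case True
        have "norm (f (x + c n *\<^sub>R b) - f x) \<le> L * norm b * c n"
          using lip[of "x + c n *\<^sub>R b" x] c[of n] by (simp add: mult_ac)
        then show ?thesis using True c[of n] by (simp add: F_def field_simps)
      next
        case False
        have "norm (c n *\<^sub>R b) \<le> norm b" using c[of n] by (simp add: mult_left_le_one_le)
        then have "norm (x + c n *\<^sub>R b) > \<bar>r\<bar>"
          using False norm_diff_ineq[of x "c n *\<^sub>R b"] by linarith
        moreover have "norm x > \<bar>r\<bar>" using False norm_ge_zero[of b] by linarith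
        ultimately show ?thesis using supp(1) False by (simp add: F_def)
      qed
    qed
  qed
  then show "(LINT x|lborel. G x \<bullet> b) = 0"
    using F0 by (simp add: LIMSEQ_const_iff)
qed

section \<open>Mollification\<close>

text \<open>The integral runs over a fixed box and x occurs only in the mollifier, so the derivative
  falls on \<eta> and f enters through its continuity alone. The derivative is first a
  \<open>blinfun\<close>-valued integral and is then evaluated at h.\<close>

lemma convolution_has_derivative:
  fixes f \<eta> :: "'a::euclidean_space \<Rightarrow> real"
  assumes f: "continuous_on UNIV f" and \<eta>: "C_infinity \<eta>"
  obtains D where
    "\<And>x. ((\<lambda>x. integral (cbox l u) (\<lambda>y. f y * \<eta> (x - y))) has_derivative D x) (at x)"
    "\<And>x h. D x h = integral (cbox l u) (\<lambda>y. f y * (grad \<eta> (x - y) \<bullet> h))"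
proof -
  note ceta = continuous_on_compose2[OF C_infinity_continuous[OF \<eta>]]
  note cgrad = continuous_on_compose2[OF C_infinity_continuous_grad[OF \<eta>]]
  note cf = continuous_on_compose2[OF f]
  define fx where "fx x y = blinfun_inner_right (f y *\<^sub>R grad \<eta> (x - y))" for x y
  have cfx: "continuous_on (UNIV \<times> cbox l u) (\<lambda>(x, y). fx x y)"
    unfolding fx_def case_prod_unfold
    by (intro continuous_intros cf cgrad bounded_linear.continuous_on[OF bounded_linear_blinfun_inner_right]) auto
  have ifx: "fx x integrable_on cbox l u" for x
    unfolding fx_def
    by (intro integrable_continuous continuous_intros cf cgrad
        bounded_linear.continuous_on[OF bounded_linear_blinfun_inner_right]) auto
  have D: "((\<lambda>x. integral (cbox l u) (\<lambda>y. f y * \<eta> (x - y)))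
      has_derivative integral (cbox l u) (fx x)) (at x)" for x
  proof (rule leibniz_rule[where U=UNIV])
    fix x y :: 'a
    have "((\<lambda>x. x - y) has_derivative (\<lambda>h. h)) (at x)"
      by (auto intro!: derivative_eq_intros)
    from has_derivative_compose[OF this] C_infinity_GDERIV[OF \<eta>, of "x - y"]
    have "((\<lambda>x. \<eta> (x - y)) has_derivative (\<lambda>h. h \<bullet> grad \<eta> (x - y))) (at x)"
      by (auto simp: gderiv_def)
    then show "((\<lambda>x. f y * \<eta> (x - y)) has_derivative blinfun_apply (fx x y)) (at x)"
      by (auto simp: fx_def inner_commute intro!: derivative_eq_intros)
  qed (auto intro!: integrable_continuous continuous_intros cf ceta cfx)
  show thesis
    by (rule that[OF D]) (simp add: blinfun_apply_integral[OF ifx] fx_def)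
qed

lemma C_k_convolution:
  fixes f \<eta> :: "'a::euclidean_space \<Rightarrow> real"
  assumes f: "continuous_on UNIV f" and \<eta>: "C_infinity \<eta>"
  shows "C_k k (\<lambda>x. integral (cbox l u) (\<lambda>y. f y * \<eta> (x - y)))"
  using \<eta>
proof (induction k arbitrary: \<eta>)
  case 0
  have "continuous_on UNIV (\<lambda>x. integral (cbox l u) (\<lambda>y. f y * \<eta> (x - y)))"
    by (intro integral_continuous_on_param)
      (auto simp: case_prod_unfold intro!: continuous_intros continuous_on_compose2[OF f]
        continuous_on_compose2[OF C_infinity_continuous[OF 0]])
  then show ?case by simp
next
  case (Suc k)
  obtain D where D: "\<And>x. ((\<lambda>x. integral (cbox l u) (\<lambda>y. f y * \<eta> (x - y))) has_derivative D x) (at x)"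
    "\<And>x h. D x h = integral (cbox l u) (\<lambda>y. f y * (grad \<eta> (x - y) \<bullet> h))"
    by (rule convolution_has_derivative[OF f Suc.prems, where l=l and u=u]) blast
  show ?case
  proof (rule C_k_SucI[OF D(1)])
    fix b :: 'a assume b: "b \<in> Basis"
    show "C_k k (\<lambda>x. D x b)"
      using Suc.IH[OF C_infinity_partial_deriv[OF Suc.prems b]] by (simp add: D(2) partial_deriv_eq_grad[OF b])
  qed
qed

lemma GDERIV_eq_0_outside:
  fixes f :: "'a::euclidean_space \<Rightarrow> real"
  assumes D: "\<And>x. GDERIV f x :> G x" and "closed K" and f: "\<And>x. x \<notin> K \<Longrightarrow> f x = 0" and x: "x \<notin> K"
  shows "G x = 0"
proof -
  have "(f has_derivative (\<lambda>h. h \<bullet> 0)) (at x)"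
    by (rule has_derivative_transform_within_open[of "\<lambda>x. 0" _ _ _ "- K"]) (use assms in auto)
  then have "GDERIV f x :> 0" by (simp add: gderiv_def)
  then show ?thesis using D[of x] grad_eq by metis
qed

lemma exists_mollifier:
  assumes d: "\<delta> > 0"
  obtains \<eta> :: "'a::euclidean_space \<Rightarrow> real" where "C_infinity \<eta>" "\<And>z. \<eta> z \<ge> 0" "\<And>z. norm z \<ge> \<delta> \<Longrightarrow> \<eta> z = 0"
    "\<And>x. integrable lborel (\<lambda>y. \<eta> (x - y))" "\<And>x. (LINT y|lborel. \<eta> (x - y)) = 1"
proof -
  define \<eta>0 where "\<eta>0 z = bump_fun [:1:] (\<delta>\<^sup>2 - z \<bullet> z)" for z :: 'a
  have pos: "\<eta>0 z > 0" if "norm z < \<delta>" for z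
  proof -
    have "(norm z)\<^sup>2 < \<delta>\<^sup>2" using that by (intro power_strict_mono) auto
    then show ?thesis by (simp add: \<eta>0_def bump_fun_def power2_norm_eq_inner)
  qed
  have zero: "\<eta>0 z = 0" if "norm z \<ge> \<delta>" for z
  proof -
    have "(norm z)\<^sup>2 \<ge> \<delta>\<^sup>2" using that d by (intro power_mono) auto
    then show ?thesis by (simp add: \<eta>0_def bump_fun_def power2_norm_eq_inner)
  qed
  have nn: "\<eta>0 z \<ge> 0" for z using pos[of z] zero[of z] by fastforce
  have Ck: "C_k k \<eta>0" for k unfolding \<eta>0_def by (rule C_k_bump_fun)
  then have cont: "continuous_on UNIV \<eta>0" using C_k.simps(1) by blast
  have int: "integrable lborel \<eta>0"
    by (rule integrable_lborel_bounded_support[OF cont, of \<delta>]) (use zero in auto)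
  define I where "I = (LINT z|lborel. \<eta>0 z)"
  \<comment> \<open>Normalisation needs a positive integral: were it zero, the ball on which \<eta>0
    is positive would be a null set.\<close>
  have "I \<noteq> 0"
  proof
    assume "I = 0"
    then have "AE z in lborel. \<eta>0 z = 0"
      using integral_nonneg_eq_0_iff_AE[OF int] nn by (auto simp: I_def)
    then have "AE z in lborel. z \<notin> ball (0::'a) \<delta>"
      by eventually_elim (use pos in fastforce)
    then have "ball (0::'a) \<delta> \<in> null_sets lborel"
      by (subst (asm) AE_iff_null_sets[symmetric]) auto
    then have "negligible (ball (0::'a) \<delta>)"
      by (simp add: negligible_iff_null_sets null_sets_completionI)
    then show False using open_not_negligible[of "ball (0::'a) \<delta>"] d by simp
  qed
  moreover have "I \<ge> 0" unfolding I_def using nn by (intro Bochner_Integration.integral_nonneg) auto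
  ultimately have I: "I > 0" by simp
  define \<eta> where "\<eta> z = inverse I * \<eta>0 z" for z
  have sym: "\<eta>0 (x - y) = \<eta>0 (y + (- x))" for x y
    by (simp add: \<eta>0_def algebra_simps)
  show thesis
  proof (rule that[of \<eta>])
    show "C_infinity \<eta>" unfolding C_infinity_def \<eta>_def by (intro allI C_k_mult C_k_const Ck)
    show "\<eta> z \<ge> 0" for z using nn I by (simp add: \<eta>_def)
    show "\<eta> z = 0" if "norm z \<ge> \<delta>" for z using zero[OF that] by (simp add: \<eta>_def)
    show "integrable lborel (\<lambda>y. \<eta> (x - y))" for x
      unfolding \<eta>_def sym using lborel_translation(1)[OF cont int, of "-x"] by auto
    show "(LINT y|lborel. \<eta> (x - y)) = 1" for x
      unfolding \<eta>_def sym using lborel_translation(2)[OF cont int, of "-x"] I by (simp add: I_def)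
  qed
qed

text \<open>Uniform continuity on the ball of radius r + 1 is enough: if two points at distance
  below 1 do not both lie in it, then both lie beyond r, where g vanishes.\<close>

lemma uniform_modulus_bounded_support:
  fixes g :: "'a::euclidean_space \<Rightarrow> 'b::real_normed_vector"
  assumes g: "continuous_on UNIV g" "\<And>x. norm x > r \<Longrightarrow> g x = 0" and e: "e > 0"
  obtains d where "d > 0" "\<And>x y. norm (x - y) < d \<Longrightarrow> norm (g x - g y) \<le> e"
proof -
  have "uniformly_continuous_on (cball 0 (r + 1)) g"
    by (intro compact_uniformly_continuous continuous_on_subset[OF g(1)]) auto
  then obtain d where d: "d > 0" "\<And>x y. x \<in> cball 0 (r + 1) \<Longrightarrow> y \<in> cball 0 (r + 1) \<Longrightarrow>
      dist y x < d \<Longrightarrow> dist (g y) (g x) < e"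
    using e unfolding uniformly_continuous_on_def by metis
  show thesis
  proof (rule that[of "min d 1"])
    fix x y :: 'a assume xy: "norm (x - y) < min d 1"
    show "norm (g x - g y) \<le> e"
    proof (cases "norm x \<le> r + 1 \<and> norm y \<le> r + 1")
      case True
      then show ?thesis using d(2)[of y x] xy by (auto simp: dist_norm)
    next
      case False
      then have "norm x > r" "norm y > r"
        using xy norm_triangle_ineq2[of x y] norm_triangle_ineq3[of x y] by auto
      then show ?thesis using g(2) e by simp
    qed
  qed (use d in auto)
qed

text \<open>Mollify at a scale below the moduli of continuity of f and G and below the width of a
  neighbourhood of K inside \<Omega>. The gradient of the mollified function is the mollification of
  G, by moving the derivative from \<eta> to f; both approximations are then local averages with
  small oscillation.\<close>

lemma mollify_C1:
  fixes f :: "'a::euclidean_space \<Rightarrow> real"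
  assumes D: "\<And>x. GDERIV f x :> G x" and G: "continuous_on UNIV G"
    and K: "compact K" and f0: "\<And>x. x \<notin> K \<Longrightarrow> f x = 0"
    and \<Omega>: "open \<Omega>" "K \<subseteq> \<Omega>" and e: "e > 0"
  obtains \<phi> where "\<phi> \<in> test_functions \<Omega>" "\<And>x. \<bar>\<phi> x - f x\<bar> \<le> e" "\<And>x. norm (grad \<phi> x - G x) \<le> e"
proof (cases "K = {}")
  case True
  have "G x = 0" for x using GDERIV_eq_0_outside[OF D, of "{}"] f0 True by auto
  moreover have "grad (\<lambda>x. 0) x = 0" for x :: 'a by (rule grad_eq) (rule GDERIV_const)
  moreover have "(\<lambda>x. 0) \<in> test_functions \<Omega>"
    by (simp add: test_functions_def C_infinity_def C_k_const)
  ultimately show ?thesis using that[of "\<lambda>x. 0"] f0 True e by simp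
next
  case False
  have G0: "G x = 0" if "x \<notin> K" for x
    by (rule GDERIV_eq_0_outside[OF D _ f0 that]) (use K compact_imp_closed in auto)
  have f: "continuous_on UNIV f"
    using D by (auto simp: gderiv_def intro!: continuous_at_imp_continuous_on has_derivative_continuous)
  obtain r where r: "\<And>x. x \<in> K \<Longrightarrow> norm x \<le> r"
    using compact_imp_bounded[OF K] by (auto simp: bounded_iff)
  have f0_r: "f x = 0" and G0_r: "G x = 0" if "norm x > r" for x
    using that f0[of x] G0[of x] r[of x] by (meson not_le)+
  obtain l u where lu: "K \<subseteq> cbox l u"
    using bounded_subset_cbox_symmetric[OF compact_imp_bounded[OF K]] by metis
  \<comment> \<open>The gradient is estimated coordinate by coordinate, and its norm is at most the
    sum of the coordinates.\<close>
  define e' where "e' = e / DIM('a)"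
  have e': "e' > 0" "e' \<le> e" using e by (auto simp: e'_def field_simps)
  obtain d1 where d1: "d1 > 0" "\<And>x y. norm (x - y) < d1 \<Longrightarrow> norm (f x - f y) \<le> e'"
    using uniform_modulus_bounded_support[OF f _ e'(1), of r] f0 r by (metis not_le)
  obtain d2 where d2: "d2 > 0" "\<And>x y. norm (x - y) < d2 \<Longrightarrow> norm (G x - G y) \<le> e'"
    using uniform_modulus_bounded_support[OF G _ e'(1), of r] G0 r by (metis not_le)
  obtain d3 where d3: "d3 > 0" "{x. infdist x K \<le> d3} \<subseteq> \<Omega>"
    using compact_in_open_separated[OF False K \<Omega>] by metis
  define \<delta> where "\<delta> = min d1 (min d2 d3)"
  have \<delta>: "\<delta> > 0" "\<delta> \<le> d1" "\<delta> \<le> d2" "\<delta> \<le> d3" using d1 d2 d3 by (auto simp: \<delta>_def)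
  obtain \<eta> :: "'a \<Rightarrow> real" where \<eta>: "C_infinity \<eta>" "\<And>z. \<eta> z \<ge> 0" "\<And>z. norm z \<ge> \<delta> \<Longrightarrow> \<eta> z = 0"
    "\<And>x. integrable lborel (\<lambda>y. \<eta> (x - y))" "\<And>x. (LINT y|lborel. \<eta> (x - y)) = 1"
    by (rule exists_mollifier[OF \<delta>(1)]) blast
  note ceta = continuous_on_compose2[OF C_infinity_continuous[OF \<eta>(1)]]
  note cgrad = continuous_on_compose2[OF C_infinity_continuous_grad[OF \<eta>(1)]]
  have int: "integrable lborel g" if "continuous_on UNIV g" "\<And>y. y \<notin> K \<Longrightarrow> g y = 0" for g :: "'a \<Rightarrow> real"
    by (rule integrable_lborel_bounded_support[OF that(1), of r]) (use r that(2) in \<open>metis not_le\<close>)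
  have eq: "integral (cbox l u) g = (LINT y|lborel. g y)"
    if "continuous_on UNIV g" "\<And>y. y \<notin> K \<Longrightarrow> g y = 0" for g :: "'a \<Rightarrow> real"
  proof -
    have "integral (cbox l u) g = integral UNIV (\<lambda>y. if y \<in> cbox l u then g y else 0)"
      by (rule integral_restrict_UNIV[symmetric])
    also have "(\<lambda>y. if y \<in> cbox l u then g y else 0) = g" using that(2) lu by (auto simp: fun_eq_iff)
    also have "integral UNIV g = (LINT y|lborel. g y)" by (rule integral_lborel[OF int[OF that]])
    finally show ?thesis .
  qed
  have average: "\<bar>(LINT y|lborel. g y * \<eta> (x - y)) - g x\<bar> \<le> e'"
    if g: "continuous_on UNIV g" "\<And>y. y \<notin> K \<Longrightarrow> g y = 0"
      and osc: "\<And>x y. norm (x - y) < \<delta> \<Longrightarrow> \<bar>g x - g y\<bar> \<le> e'" for g x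
  proof -
    have i1: "integrable lborel (\<lambda>y. g y * \<eta> (x - y))"
      by (intro int continuous_intros g ceta) (use g in auto)
    have i2: "integrable lborel (\<lambda>y. (g y - g x) * \<eta> (x - y))"
      using i1 \<eta>(4)[of x] by (simp add: left_diff_distrib)
    have "(LINT y|lborel. g y * \<eta> (x - y)) - g x = (LINT y|lborel. (g y - g x) * \<eta> (x - y))"
      using i1 \<eta>(4,5)[of x] by (simp add: left_diff_distrib Bochner_Integration.integral_diff)
    also have "\<bar>\<dots>\<bar> \<le> (LINT y|lborel. \<bar>(g y - g x) * \<eta> (x - y)\<bar>)"
      using integral_norm_bound[of lborel "\<lambda>y. (g y - g x) * \<eta> (x - y)"] by simp
    also have "\<dots> \<le> (LINT y|lborel. e' * \<eta> (x - y))"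
    proof (rule integral_mono)
      fix y
      show "\<bar>(g y - g x) * \<eta> (x - y)\<bar> \<le> e' * \<eta> (x - y)"
      proof (cases "norm (x - y) < \<delta>")
        case True
        then show ?thesis using osc[of y x] \<eta>(2) by (auto simp: abs_mult norm_minus_commute intro!: mult_right_mono)
      next
        case False
        then show ?thesis using \<eta>(3)[of "x - y"] by simp
      qed
    qed (use i2 \<eta>(4) in auto)
    also have "\<dots> = e'" using \<eta>(5) by simp
    finally show ?thesis .
  qed
  define \<phi> where "\<phi> x = integral (cbox l u) (\<lambda>y. f y * \<eta> (x - y))" for x
  have smooth: "C_infinity \<phi>"
    unfolding C_infinity_def \<phi>_def using C_k_convolution[OF f \<eta>(1)] by blast
  have \<phi>: "\<phi> x = (LINT y|lborel. f y * \<eta> (x - y))" for x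
    unfolding \<phi>_def by (intro eq continuous_intros f ceta) (use f0 in auto)
  obtain D' where D': "\<And>x. (\<phi> has_derivative D' x) (at x)"
    "\<And>x h. D' x h = integral (cbox l u) (\<lambda>y. f y * (grad \<eta> (x - y) \<bullet> h))"
    unfolding \<phi>_def[abs_def] by (rule convolution_has_derivative[OF f \<eta>(1), where l=l and u=u]) blast
  have grad\<phi>: "grad \<phi> x \<bullet> b = (LINT y|lborel. (G y \<bullet> b) * \<eta> (x - y))" if b: "b \<in> Basis" for x b
  proof -
    have "grad \<phi> x \<bullet> b = D' x b"
      using partial_deriv_eq[OF D'(1)] partial_deriv_eq_grad[OF b] by metis
    also have "\<dots> = (LINT y|lborel. f y * (grad \<eta> (x - y) \<bullet> b))"
      unfolding D'(2) by (intro eq continuous_intros f cgrad) (use f0 in auto)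
    finally have 1: "grad \<phi> x \<bullet> b = (LINT y|lborel. f y * (grad \<eta> (x - y) \<bullet> b))" .
    \<comment> \<open>Integration by parts in y: the gradient of this product has integral zero, and
      the inner derivative of x - y contributes the sign.\<close>
    have Dy: "GDERIV (\<lambda>y. f y * \<eta> (x - y)) y :> f y *\<^sub>R (- grad \<eta> (x - y)) + \<eta> (x - y) *\<^sub>R G y" for y
    proof (rule GDERIV_mult[OF D])
      have "((\<lambda>y. x - y) has_derivative (\<lambda>h. - h)) (at y)"
        by (auto intro!: derivative_eq_intros)
      from has_derivative_compose[OF this, of \<eta> "\<lambda>h. h \<bullet> grad \<eta> (x - y)"] C_infinity_GDERIV[OF \<eta>(1), of "x - y"]
      show "GDERIV (\<lambda>y. \<eta> (x - y)) y :> - grad \<eta> (x - y)"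
        by (auto simp: gderiv_def)
    qed
    have "(LINT y|lborel. (f y *\<^sub>R (- grad \<eta> (x - y)) + \<eta> (x - y) *\<^sub>R G y) \<bullet> b) = 0"
    proof (rule integral_gradient_eq_0(2)[OF Dy, of r])
      show "continuous_on UNIV (\<lambda>y. f y *\<^sub>R - grad \<eta> (x - y) + \<eta> (x - y) *\<^sub>R G y)"
        by (intro continuous_intros f cgrad ceta G) auto
    qed (use f0_r G0_r in auto)
    moreover have "integrable lborel (\<lambda>y. f y * (grad \<eta> (x - y) \<bullet> b))"
      by (intro int continuous_intros f cgrad) (use f0 in auto)
    moreover have "integrable lborel (\<lambda>y. (G y \<bullet> b) * \<eta> (x - y))"
      by (intro int continuous_intros G ceta) (use G0 in auto)
    ultimately show ?thesis using 1 by (simp add: inner_add_left inner_diff_left mult.commute)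
  qed
  show thesis
  proof (rule that)
    have "closure {x. \<phi> x \<noteq> 0} \<subseteq> {x. infdist x K \<le> d3}"
    proof (rule closure_minimal)
      show "closed {x. infdist x K \<le> d3}"
        using compact_infdist_le[OF False K d3(1)] by (rule compact_imp_closed)
      show "{x. \<phi> x \<noteq> 0} \<subseteq> {x. infdist x K \<le> d3}"
      proof safe
        fix x assume "\<phi> x \<noteq> 0"
        have "\<exists>y. f y * \<eta> (x - y) \<noteq> 0"
        proof (rule ccontr)
          assume "\<not> ?thesis"
          then have "(\<lambda>y. f y * \<eta> (x - y)) = (\<lambda>y. 0)" by blast
          then have "\<phi> x = 0" by (simp only: \<phi> Bochner_Integration.integral_zero)
          with \<open>\<phi> x \<noteq> 0\<close> show False by simp
        qed
        then obtain y where y: "f y \<noteq> 0" "\<eta> (x - y) \<noteq> 0" by auto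
        have "y \<in> K" using f0[of y] y by blast
        moreover have "norm (x - y) < \<delta>" using \<eta>(3)[of "x - y"] y by (meson not_le)
        ultimately show "infdist x K \<le> d3"
          using infdist_le[of y K x] \<delta> by (auto simp: dist_norm)
      qed
    qed
    then show "\<phi> \<in> test_functions \<Omega>"
      unfolding test_functions_def using smooth d3(2) compact_infdist_le[OF False K d3(1)]
      by (auto simp: compact_eq_bounded_closed intro: bounded_subset)
    show "\<bar>\<phi> x - f x\<bar> \<le> e" for x
      unfolding \<phi> using average[OF f f0, of x] d1(2) \<delta> e' by fastforce
    show "norm (grad \<phi> x - G x) \<le> e" for x
    proof -
      have "\<bar>(grad \<phi> x - G x) \<bullet> b\<bar> \<le> e'" if b: "b \<in> Basis" for b
      proof -
        have "\<bar>G x \<bullet> b - G y \<bullet> b\<bar> \<le> e'" if "norm (x - y) < \<delta>" for x y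
          using d2(2)[of x y] that \<delta> Basis_le_norm[OF b, of "G x - G y"] by (simp add: inner_diff_left)
        moreover have "continuous_on UNIV (\<lambda>y. G y \<bullet> b)" by (intro continuous_intros G)
        ultimately show ?thesis
          using average[of "\<lambda>y. G y \<bullet> b" x] G0 by (simp add: inner_diff_left grad\<phi>[OF b])
      qed
      then have "(\<Sum>b\<in>Basis. \<bar>(grad \<phi> x - G x) \<bullet> b\<bar>) \<le> (\<Sum>b\<in>(Basis::'a set). e')"
        by (rule sum_mono)
      then show ?thesis
        using norm_le_l1[of "grad \<phi> x - G x"] by (simp add: e'_def)
    qed
  qed
qed

section \<open>Convergence in \<open>L\<^sup>p\<close>\<close>

text \<open>The common end of the convergence proofs below: inequalities of Young type bound X by a
  small multiple of a fixed quantity plus a large multiple of something that tends to 0.\<close>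

lemma tendsto_0_eps_bound:
  fixes X :: "nat \<Rightarrow> 'b::real_normed_vector"
  assumes Y: "Y \<longlonglongrightarrow> 0" and K: "K \<ge> 0"
    and le: "\<And>\<epsilon>::real. \<epsilon> > 0 \<Longrightarrow> \<exists>C>0. \<forall>n. norm (X n) \<le> \<epsilon> * K + C * Y n"
  shows "X \<longlonglongrightarrow> 0"
proof (rule LIMSEQ_I)
  fix e :: real assume e: "e > 0"
  define \<epsilon> where "\<epsilon> = e / (2 * (K + 1))"
  have "\<epsilon> > 0" using e K by (simp add: \<epsilon>_def)
  then obtain C where C: "C > 0" "\<And>n. norm (X n) \<le> \<epsilon> * K + C * Y n" using le by blast
  have "\<epsilon> * K < e / 2" using e K by (simp add: \<epsilon>_def field_simps)
  moreover obtain N where N: "\<And>n. n \<ge> N \<Longrightarrow> norm (Y n - 0) < e / (2 * C)"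
    using LIMSEQ_D[OF Y, of "e / (2 * C)"] e C by auto
  moreover have "C * Y n < e / 2" if "n \<ge> N" for n
    using N[OF that] C by (simp add: field_simps abs_less_iff)
  ultimately show "\<exists>N. \<forall>n\<ge>N. norm (X n - 0) < e"
    using C(2) by (intro exI[of _ N]) (smt (verit) diff_zero field_sum_of_halves)
qed

lemma powr_le_1_plus_powr:
  fixes t p q :: real
  assumes "t \<ge> 0" "0 \<le> q" "q \<le> p"
  shows "t powr q \<le> 1 + t powr p"
proof (cases "t \<le> 1")
  case True
  then have "t powr q \<le> 1" using assms by (simp add: powr_le1)
  then show ?thesis by (smt (verit) powr_ge_zero)
next
  case False
  then have "t powr q \<le> t powr p" using assms by (intro powr_mono) auto
  then show ?thesis by simp
qed

lemma integral_tendsto_bound_Fatou: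
  fixes h :: "nat \<Rightarrow> 'a \<Rightarrow> real"
  assumes i: "\<And>n. integrable M (h n)" "\<And>n x. h n x \<ge> 0" and b: "\<And>n. n \<ge> N \<Longrightarrow> (LINT x|M. h n x) \<le> e"
    and m: "g \<in> borel_measurable M" and c: "AE x in M. (\<lambda>n. h n x) \<longlonglongrightarrow> g x"
  shows "integrable M g" "(LINT x|M. g x) \<le> e"
proof -
  have e: "e \<ge> 0" 
    using order_trans[OF Bochner_Integration.integral_nonneg[of M "h N"] b[OF order_refl]] i(2) by blast
  have g0: "AE x in M. g x \<ge> 0"
    using c by eventually_elim (use i(2) in \<open>auto intro: LIMSEQ_le_const\<close>)
  have "(\<integral>\<^sup>+x. ennreal (g x) \<partial>M) = (\<integral>\<^sup>+x. liminf (\<lambda>n. ennreal (h n x)) \<partial>M)"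
  proof (rule nn_integral_cong_AE)
    show "AE x in M. ennreal (g x) = liminf (\<lambda>n. ennreal (h n x))"
      using c by eventually_elim
        (metis lim_imp_Liminf tendsto_ennrealI trivial_limit_sequentially)
  qed
  also have "\<dots> \<le> liminf (\<lambda>n. \<integral>\<^sup>+x. ennreal (h n x) \<partial>M)"
    using i by (intro nn_integral_liminf) (auto dest: borel_measurable_integrable)
  also have "\<dots> \<le> ennreal e"
  proof (rule order_trans[OF Liminf_le_Limsup Limsup_bounded])
    show "\<forall>\<^sub>F n in sequentially. (\<integral>\<^sup>+x. ennreal (h n x) \<partial>M) \<le> ennreal e"
      using eventually_ge_at_top[of N] by eventually_elim (simp add: nn_integral_eq_integral i b ennreal_leI)
  qed simp
  finally have le: "(\<integral>\<^sup>+x. ennreal (g x) \<partial>M) \<le> ennreal e" .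
  show ig: "integrable M g"
    by (rule integrableI_nonneg[OF m g0]) (use le in \<open>auto intro: le_less_trans\<close>)
  show "(LINT x|M. g x) \<le> e"
    using le nn_integral_eq_integral[OF ig g0] e by (simp add: ennreal_le_iff)
qed

lemma norm_integral_le_AE:
  fixes f :: "'a \<Rightarrow> 'b::{banach, second_countable_topology}"
  assumes "integrable M f" "integrable M g" "AE x in M. norm (f x) \<le> g x"
  shows "norm (LINT x|M. f x) \<le> (LINT x|M. g x)"
  using order_trans[OF integral_norm_bound integral_mono_AE] assms integrable_norm by blast

section \<open>The space L^p over a bounded open set\<close>

locale lebesgue_domain =
  fixes \<Omega> :: "'a::euclidean_space set" and p :: real
  assumes open_domain: "open \<Omega>" and bounded_domain: "bounded \<Omega>" and p_gt_1: "p > 1"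
begin

abbreviation M where "M \<equiv> lebesgue_on \<Omega>"

lemma p_pos: "p > 0" using p_gt_1 by simp

lemma lmeasurable_domain: "\<Omega> \<in> lmeasurable"
  using open_domain bounded_domain by (simp add: lmeasurable_open)

lemma sets_domain: "\<Omega> \<in> sets lebesgue"
  using lmeasurable_domain by (rule fmeasurableD)

lemma finite_measure_M: "finite_measure M"
  by (rule finite_measure_lebesgue_on[OF lmeasurable_domain])

lemma AE_mem_domain: "AE x in M. x \<in> \<Omega>"
  using AE_space[of M] by simp

lemma measurable_continuous:
  fixes f :: "'a \<Rightarrow> 'b::euclidean_space"
  shows "continuous_on UNIV f \<Longrightarrow> f \<in> borel_measurable M"
  by (rule continuous_imp_measurable_on_sets_lebesgue[OF _ sets_domain]) (auto intro: continuous_on_subset)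

lemma L_p_measurable [measurable_dest]: "f \<in> L_p p \<Omega> \<Longrightarrow> f \<in> borel_measurable M"
  by (simp add: L_p_def)

lemma L_p_integrable_powr: "f \<in> L_p p \<Omega> \<Longrightarrow> integrable M (\<lambda>x. norm (f x) powr p)"
  by (simp add: L_p_def)

lemma L_pI_bound:
  assumes "f \<in> borel_measurable M" "integrable M g" "AE x in M. norm (f x) powr p \<le> g x"
  shows "f \<in> L_p p \<Omega>"
proof -
  have "integrable M (\<lambda>x. norm (f x) powr p)"
    by (rule Bochner_Integration.integrable_bound[OF assms(2)])
      (use assms in \<open>auto elim!: eventually_mono\<close>)
  then show ?thesis using assms(1) by (simp add: L_p_def)
qed

lemma L_p_dominated:
  assumes "f \<in> borel_measurable M" "g \<in> L_p p \<Omega>" "AE x in M. norm (f x) \<le> norm (g x)"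
  shows "f \<in> L_p p \<Omega>"
  by (rule L_pI_bound[OF assms(1) L_p_integrable_powr[OF assms(2)]])
    (use assms(3) p_gt_1 in \<open>auto elim!: eventually_mono intro!: powr_mono2\<close>)

lemma L_p_bounded:
  assumes "f \<in> borel_measurable M" "AE x in M. norm (f x) \<le> B"
  shows "f \<in> L_p p \<Omega>"
  by (rule L_pI_bound[where g="\<lambda>x. B powr p", OF assms(1)])
    (use assms(2) p_gt_1 in \<open>auto elim!: eventually_mono intro!: powr_mono2
      finite_measure.integrable_const[OF finite_measure_M]\<close>)

lemma L_p_add:
  assumes "f \<in> L_p p \<Omega>" "g \<in> L_p p \<Omega>"
  shows "(\<lambda>x. f x + g x) \<in> L_p p \<Omega>"
proof (rule L_pI_bound)
  show "integrable M (\<lambda>x. 2 powr p * (norm (f x) powr p + norm (g x) powr p))"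
    using assms by (intro integrable_mult_right Bochner_Integration.integrable_add L_p_integrable_powr)
qed (use assms p_gt_1 in \<open>auto intro!: borel_measurable_add norm_add_powr_le L_p_measurable\<close>)

lemma L_p_scaleR: "f \<in> L_p p \<Omega> \<Longrightarrow> (\<lambda>x. c *\<^sub>R f x) \<in> L_p p \<Omega>"
  by (auto simp: L_p_def powr_mult)

lemma L_p_diff:
  assumes "f \<in> L_p p \<Omega>" "g \<in> L_p p \<Omega>"
  shows "(\<lambda>x. f x - g x) \<in> L_p p \<Omega>"
  using L_p_add[OF assms(1) L_p_scaleR[OF assms(2), of "-1"]] by simp

lemma L_p_integrable:
  assumes "f \<in> L_p p \<Omega>" shows "integrable M f"
proof (rule Bochner_Integration.integrable_bound)
  show "integrable M (\<lambda>x. 1 + norm (f x) powr p)"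
    using assms by (intro Bochner_Integration.integrable_add L_p_integrable_powr)
      (auto intro: finite_measure.integrable_const[OF finite_measure_M])
  show "AE x in M. norm (f x) \<le> norm (1 + norm (f x) powr p)"
    using powr_le_1_plus_powr[of "norm (f x)" 1 p for x] p_gt_1
    by (auto intro: order_trans[OF _ abs_ge_self])
qed (use assms L_p_measurable in auto)

lemma L_p_integrable_mult_bounded:
  fixes w :: "'a \<Rightarrow> real"
  assumes f: "f \<in> L_p p \<Omega>" and w: "w \<in> borel_measurable M" "AE x in M. \<bar>w x\<bar> \<le> B"
  shows "integrable M (\<lambda>x. w x * f x)"
proof (rule Bochner_Integration.integrable_bound)
  show "integrable M (\<lambda>x. B * norm (f x))" using L_p_integrable[OF f] by simp
  show "AE x in M. norm (w x * f x) \<le> norm (B * norm (f x))"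
    using w(2) by eventually_elim (auto simp: abs_mult intro!: mult_right_mono)
qed (use assms L_p_measurable in auto)

lemma measurable_pflux [measurable]: "U \<in> borel_measurable M \<Longrightarrow> (\<lambda>x. pflux p (U x)) \<in> borel_measurable M"
  using borel_measurable_continuous_onI[OF continuous_on_pflux[OF p_gt_1]] by (rule measurable_compose_rev)

lemma pflux_young:
  assumes "\<epsilon> > 0"
  obtains C where "C > 0" "\<And>a b::'b::real_inner. \<bar>pflux p a \<bullet> b\<bar> \<le> \<epsilon> * norm a powr p + C * norm b powr p"
proof -
  obtain C where C: "C > 0" "\<And>a b. a \<ge> 0 \<Longrightarrow> b \<ge> 0 \<Longrightarrow> a powr (p - 1) * b \<le> \<epsilon> * a powr p + C * b powr p"
    using powr_young[OF p_gt_1 assms] by blast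
  show thesis
  proof (rule that[OF C(1)])
    fix a b :: 'b
    show "\<bar>pflux p a \<bullet> b\<bar> \<le> \<epsilon> * norm a powr p + C * norm b powr p"
      using Cauchy_Schwarz_ineq2[of "pflux p a" b] C(2)[of "norm a" "norm b"] by (simp add: norm_pflux)
  qed
qed

lemma pflux_integrable:
  assumes U: "U \<in> L_p p \<Omega>" and V: "V \<in> L_p p \<Omega>"
  shows "integrable M (\<lambda>x. pflux p (U x) \<bullet> V x)"
proof -
  obtain C where C: "C > 0" "\<And>a b::'b. \<bar>pflux p a \<bullet> b\<bar> \<le> 1 * norm a powr p + C * norm b powr p"
    using pflux_young[of 1] by auto
  show ?thesis
  proof (rule Bochner_Integration.integrable_bound)
    show "integrable M (\<lambda>x. 1 * norm (U x) powr p + C * norm (V x) powr p)"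
      using assms by (intro Bochner_Integration.integrable_add integrable_mult_right L_p_integrable_powr)
    show "AE x in M. norm (pflux p (U x) \<bullet> V x) \<le> norm (1 * norm (U x) powr p + C * norm (V x) powr p)"
      using C(2) by (auto intro: order_trans[OF _ abs_ge_self])
  qed (use assms L_p_measurable in measurable)
qed

text \<open>Functions are not identified modulo null sets, so convergence is expressed by the p-th
  power of the norm itself; the inequality |a + b|^p \<le> 2^p (|a|^p + |b|^p) stands in for the
  triangle inequality.\<close>

definition Lp_tendsto :: "(nat \<Rightarrow> 'a \<Rightarrow> 'b::euclidean_space) \<Rightarrow> ('a \<Rightarrow> 'b) \<Rightarrow> bool" where
  "Lp_tendsto f g \<longleftrightarrow> (\<lambda>n. LINT x|M. norm (f n x - g x) powr p) \<longlonglongrightarrow> 0"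

lemma Lp_tendsto_bounded:
  assumes f: "\<And>n. f n \<in> L_p p \<Omega>" and g: "g \<in> L_p p \<Omega>" and "Lp_tendsto f g"
  obtains K where "K \<ge> 0" "\<And>n. (LINT x|M. norm (f n x) powr p) \<le> K"
proof -
  obtain B where B: "\<And>n. \<bar>LINT x|M. norm (f n x - g x) powr p\<bar> \<le> B"
    using convergent_imp_Bseq assms(3) by (force simp: Lp_tendsto_def convergent_def Bseq_def)
  define K where "K = 2 powr p * (B + (LINT x|M. norm (g x) powr p))"
  have "(LINT x|M. norm (f n x) powr p) \<le> K" for n
  proof -
    have "(LINT x|M. norm (f n x) powr p) \<le> (LINT x|M. 2 powr p * (norm (f n x - g x) powr p + norm (g x) powr p))"
    proof (rule integral_mono)
      show "norm (f n x) powr p \<le> 2 powr p * (norm (f n x - g x) powr p + norm (g x) powr p)" for x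
        using norm_add_powr_le[of p "f n x - g x" "g x"] p_gt_1 by simp
    qed (intro integrable_mult_right Bochner_Integration.integrable_add L_p_integrable_powr L_p_diff f g)+
    also have "\<dots> = 2 powr p * ((LINT x|M. norm (f n x - g x) powr p) + (LINT x|M. norm (g x) powr p))"
      by (simp add: L_p_integrable_powr L_p_diff f g)
    also have "\<dots> \<le> K" unfolding K_def using B[of n] by (intro mult_left_mono) auto
    finally show ?thesis .
  qed
  moreover have "(LINT x|M. norm (f 0 x) powr p) \<ge> 0"
    by (intro Bochner_Integration.integral_nonneg) auto
  ultimately show thesis using that by (meson order_trans)
qed

text \<open>Young's inequality with a = 1 gives |t| \<le> \<epsilon> + C |t|^p; the constant
  integrates to \<epsilon> times the finite measure of \<Omega>.\<close>

lemma Lp_tendsto_integral_norm: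
  assumes f: "\<And>n. f n \<in> L_p p \<Omega>" and g: "g \<in> L_p p \<Omega>" and c: "Lp_tendsto f g"
  shows "(\<lambda>n. LINT x|M. norm (f n x - g x)) \<longlonglongrightarrow> 0"
proof (rule tendsto_0_eps_bound[of _ "measure M \<Omega>"])
  show "(\<lambda>n. LINT x|M. norm (f n x - g x) powr p) \<longlonglongrightarrow> 0" using c by (simp add: Lp_tendsto_def)
  fix \<epsilon> :: real assume "\<epsilon> > 0"
  then obtain C where C: "C > 0" "\<And>a b. a \<ge> 0 \<Longrightarrow> b \<ge> 0 \<Longrightarrow> a powr (p - 1) * b \<le> \<epsilon> * a powr p + C * b powr p"
    using powr_young[OF p_gt_1] by metis
  have "norm (LINT x|M. norm (f n x - g x)) \<le> \<epsilon> * measure M \<Omega> + C * (LINT x|M. norm (f n x - g x) powr p)" for n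
  proof -
    have "norm (LINT x|M. norm (f n x - g x)) = (LINT x|M. norm (f n x - g x))"
      by simp
    also have "\<dots> \<le> (LINT x|M. \<epsilon> + C * norm (f n x - g x) powr p)"
    proof (rule integral_mono)
      show "norm (f n x - g x) \<le> \<epsilon> + C * norm (f n x - g x) powr p" for x
        using C(2)[of 1 "norm (f n x - g x)"] by simp
    qed (intro Bochner_Integration.integrable_add finite_measure.integrable_const[OF finite_measure_M]
      integrable_norm integrable_mult_right L_p_integrable L_p_integrable_powr L_p_diff f g)+
    also have "\<dots> = \<epsilon> * measure M \<Omega> + C * (LINT x|M. norm (f n x - g x) powr p)"
      by (simp add: finite_measure.integrable_const[OF finite_measure_M] L_p_integrable_powr L_p_diff f g)
    finally show ?thesis .
  qed
  then show "\<exists>C>0. \<forall>n. norm (LINT x|M. norm (f n x - g x)) \<le> \<epsilon> * measure M \<Omega> + C * (LINT x|M. norm (f n x - g x) powr p)"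
    using C(1) by blast
qed auto

lemma Lp_tendsto_integral_mult:
  fixes f :: "nat \<Rightarrow> 'a \<Rightarrow> real"
  assumes f: "\<And>n. f n \<in> L_p p \<Omega>" and g: "g \<in> L_p p \<Omega>" and c: "Lp_tendsto f g"
    and w: "w \<in> borel_measurable M" "AE x in M. \<bar>w x\<bar> \<le> B"
  shows "(\<lambda>n. LINT x|M. w x * f n x) \<longlonglongrightarrow> (LINT x|M. w x * g x)"
proof (rule LIM_zero_cancel, rule Lim_null_comparison)
  show "(\<lambda>n. B * (LINT x|M. norm (f n x - g x))) \<longlonglongrightarrow> 0"
    using tendsto_mult_right_zero[OF Lp_tendsto_integral_norm[OF f g c]] .
  show "\<forall>\<^sub>F n in sequentially. norm ((LINT x|M. w x * f n x) - (LINT x|M. w x * g x)) \<le> B * (LINT x|M. norm (f n x - g x))"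
  proof (intro always_eventually allI)
    fix n
    note i = L_p_integrable_mult_bounded[OF _ w]
    have "(LINT x|M. w x * f n x) - (LINT x|M. w x * g x) = (LINT x|M. w x * (f n x - g x))"
      by (simp add: right_diff_distrib i f g)
    also have "norm \<dots> \<le> (LINT x|M. B * norm (f n x - g x))"
    proof (rule norm_integral_le_AE)
      show "AE x in M. norm (w x * (f n x - g x)) \<le> B * norm (f n x - g x)"
        using w(2) by eventually_elim (auto simp: abs_mult intro!: mult_right_mono)
    qed (intro i integrable_mult_right integrable_norm L_p_integrable L_p_diff f g)+
    finally show "norm ((LINT x|M. w x * f n x) - (LINT x|M. w x * g x)) \<le> B * (LINT x|M. norm (f n x - g x))"
      by simp
  qed
qed

lemma Lp_tendsto_AE_subseq:
  assumes f: "\<And>n. f n \<in> L_p p \<Omega>" and g: "g \<in> L_p p \<Omega>" and c: "Lp_tendsto f g"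
  obtains r where "strict_mono r" "AE x in M. (\<lambda>n. f (r n) x) \<longlonglongrightarrow> g x"
proof -
  obtain r where r: "strict_mono r" "AE x in M. (\<lambda>n. f (r n) x - g x) \<longlonglongrightarrow> 0"
    using tendsto_L1_AE_subseq[of M "\<lambda>n x. f n x - g x", OF L_p_integrable[OF L_p_diff[OF f g]]
        Lp_tendsto_integral_norm[OF f g c]] by auto
  show thesis
    by (rule that[OF r(1)]) (use r(2) in \<open>auto elim!: eventually_mono intro: LIM_zero_cancel\<close>)
qed

lemma Lp_tendsto_subseq: "Lp_tendsto f g \<Longrightarrow> strict_mono r \<Longrightarrow> Lp_tendsto (\<lambda>n. f (r n)) g"
  unfolding Lp_tendsto_def by (drule LIMSEQ_subseq_LIMSEQ) (auto simp: o_def)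

lemma Lp_tendsto_le:
  assumes f: "\<And>n. f n \<in> L_p p \<Omega>" and g: "g \<in> L_p p \<Omega>"
    and Y: "Y \<longlonglongrightarrow> 0" and le: "\<And>n. (LINT x|M. norm (f n x - g x) powr p) \<le> Y n"
  shows "Lp_tendsto f g"
  unfolding Lp_tendsto_def
proof (rule tendsto_sandwich[OF _ _ tendsto_const Y])
  show "\<forall>\<^sub>F n in sequentially. 0 \<le> (LINT x|M. norm (f n x - g x) powr p)"
    by (intro always_eventually allI Bochner_Integration.integral_nonneg) auto
qed (use le in auto)

lemma Lp_tendsto_dominated:
  assumes f: "\<And>n. f n \<in> borel_measurable M" and g: "g \<in> L_p p \<Omega>" and h: "h \<in> L_p p \<Omega>"
    and b: "\<And>n. AE x in M. norm (f n x) \<le> norm (h x)" and c: "AE x in M. (\<lambda>n. f n x) \<longlonglongrightarrow> g x"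
  shows "Lp_tendsto f g"
  unfolding Lp_tendsto_def
proof -
  have "(\<lambda>n. LINT x|M. norm (f n x - g x) powr p) \<longlonglongrightarrow> (LINT x|M. 0)"
  proof (rule integral_dominated_convergence)
    show "integrable M (\<lambda>x. 2 powr p * (norm (h x) powr p + norm (g x) powr p))"
      by (intro integrable_mult_right Bochner_Integration.integrable_add L_p_integrable_powr g h)
    show "(\<lambda>x. norm (f n x - g x) powr p) \<in> borel_measurable M" for n
      using f L_p_measurable[OF g] by measurable
    show "AE x in M. norm (norm (f n x - g x) powr p) \<le> 2 powr p * (norm (h x) powr p + norm (g x) powr p)" for n
      using b[of n]
    proof eventually_elim
      case (elim x)
      have "norm (f n x) powr p \<le> norm (h x) powr p" using elim p_gt_1 by (intro powr_mono2) auto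
      then have "2 powr p * (norm (f n x) powr p + norm (g x) powr p) \<le> 2 powr p * (norm (h x) powr p + norm (g x) powr p)"
        by (intro mult_left_mono) auto
      with norm_diff_powr_le[OF p_pos, of "f n x" "g x"] show ?case
        
        unfolding real_norm_def abs_of_nonneg[OF powr_ge_zero] by (rule order_trans)
    qed
    show "AE x in M. (\<lambda>n. norm (f n x - g x) powr p) \<longlonglongrightarrow> 0"
      using c
    proof eventually_elim
      case (elim x)
      have "(\<lambda>n. norm (f n x - g x) powr p) \<longlonglongrightarrow> 0 powr p"
        by (rule tendsto_powr') (use elim p_gt_1 in \<open>auto simp: LIM_zero_iff tendsto_norm_zero_iff\<close>)
      then show ?case by simp
    qed
  qed simp
  then show "(\<lambda>n. LINT x|M. norm (f n x - g x) powr p) \<longlonglongrightarrow> 0" by simp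
qed

lemma Lp_integral_add_le:
  fixes f g :: "'a \<Rightarrow> 'b::euclidean_space"
  assumes "f \<in> L_p p \<Omega>" "g \<in> L_p p \<Omega>"
  shows "(LINT x|M. norm (f x + g x) powr p) \<le> 2 powr p * ((LINT x|M. norm (f x) powr p) + (LINT x|M. norm (g x) powr p))"
proof -
  have "(LINT x|M. norm (f x + g x) powr p) \<le> (LINT x|M. 2 powr p * (norm (f x) powr p + norm (g x) powr p))"
    by (rule integral_mono) (use norm_add_powr_le[OF p_pos] assms in \<open>auto intro!: L_p_integrable_powr L_p_add\<close>)
  then show ?thesis using assms by (simp add: L_p_integrable_powr)
qed

lemma Lp_tendsto_add:
  assumes f: "\<And>n. f n \<in> L_p p \<Omega>" "g \<in> L_p p \<Omega>" "Lp_tendsto f g"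
    and f': "\<And>n. f' n \<in> L_p p \<Omega>" "g' \<in> L_p p \<Omega>" "Lp_tendsto f' g'"
  shows "Lp_tendsto (\<lambda>n x. f n x + f' n x) (\<lambda>x. g x + g' x)"
proof (rule Lp_tendsto_le)
  show "(\<lambda>n. 2 powr p * ((LINT x|M. norm (f n x - g x) powr p) + (LINT x|M. norm (f' n x - g' x) powr p))) \<longlonglongrightarrow> 0"
    using tendsto_mult_right_zero[OF tendsto_add_zero[OF f(3)[unfolded Lp_tendsto_def] f'(3)[unfolded Lp_tendsto_def]]] .
  show "(LINT x|M. norm (f n x + f' n x - (g x + g' x)) powr p)
      \<le> 2 powr p * ((LINT x|M. norm (f n x - g x) powr p) + (LINT x|M. norm (f' n x - g' x) powr p))" for n
    using Lp_integral_add_le[OF L_p_diff[OF f(1,2)] L_p_diff[OF f'(1,2)]] by (simp add: algebra_simps)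
qed (intro L_p_add f f')+

lemma Lp_tendsto_scaleR:
  assumes "Lp_tendsto f g"
  shows "Lp_tendsto (\<lambda>n x. c *\<^sub>R f n x) (\<lambda>x. c *\<^sub>R g x)"
  using tendsto_mult_right_zero[OF assms[unfolded Lp_tendsto_def], of "\<bar>c\<bar> powr p"]
  unfolding Lp_tendsto_def by (simp flip: scaleR_diff_right add: powr_mult)

text \<open>A flux is a continuous functional on L^p. Young's inequality with a small parameter
  takes the place of Hoelder's.\<close>

lemma Lp_tendsto_pflux_fixed:
  assumes U: "U \<in> L_p p \<Omega>" and f: "\<And>n. f n \<in> L_p p \<Omega>" "g \<in> L_p p \<Omega>" "Lp_tendsto f g"
  shows "(\<lambda>n. LINT x|M. pflux p (U x) \<bullet> f n x) \<longlonglongrightarrow> (LINT x|M. pflux p (U x) \<bullet> g x)"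
proof (rule LIM_zero_cancel, rule tendsto_0_eps_bound)
  show "(\<lambda>n. LINT x|M. norm (f n x - g x) powr p) \<longlonglongrightarrow> 0" using f(3) by (simp add: Lp_tendsto_def)
  show "(LINT x|M. norm (U x) powr p) \<ge> 0" by (intro Bochner_Integration.integral_nonneg) auto
  fix \<epsilon> :: real assume "\<epsilon> > 0"
  then obtain C where C: "C > 0" "\<And>a b::'b. \<bar>pflux p a \<bullet> b\<bar> \<le> \<epsilon> * norm a powr p + C * norm b powr p"
    by (rule pflux_young) blast
  have "norm ((LINT x|M. pflux p (U x) \<bullet> f n x) - (LINT x|M. pflux p (U x) \<bullet> g x))
      \<le> \<epsilon> * (LINT x|M. norm (U x) powr p) + C * (LINT x|M. norm (f n x - g x) powr p)" for n
  proof -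
    have "(LINT x|M. pflux p (U x) \<bullet> f n x) - (LINT x|M. pflux p (U x) \<bullet> g x) = (LINT x|M. pflux p (U x) \<bullet> (f n x - g x))"
      by (simp add: inner_diff_right pflux_integrable U f)
    also have "norm \<dots> \<le> (LINT x|M. \<epsilon> * norm (U x) powr p + C * norm (f n x - g x) powr p)"
      by (rule Bochner_Integration.integral_norm_bound_integral)
        (use C(2) in \<open>auto intro!: pflux_integrable L_p_diff U f L_p_integrable_powr\<close>)
    also have "\<dots> = \<epsilon> * (LINT x|M. norm (U x) powr p) + C * (LINT x|M. norm (f n x - g x) powr p)"
      by (simp add: L_p_integrable_powr L_p_diff U f)
    finally show ?thesis .
  qed
  then show "\<exists>C>0. \<forall>n. norm ((LINT x|M. pflux p (U x) \<bullet> f n x) - (LINT x|M. pflux p (U x) \<bullet> g x))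
      \<le> \<epsilon> * (LINT x|M. norm (U x) powr p) + C * (LINT x|M. norm (f n x - g x) powr p)" using C(1) by blast
qed

text \<open>Strong convergence of gradients passes through the nonlinear field: the \<epsilon> part
  of \<open>pflux_diff_le\<close> is controlled by the uniform L^p bound of a convergent sequence,
  the rest by the convergence.\<close>

lemma Lp_tendsto_pflux:
  assumes f: "\<And>n. f n \<in> L_p p \<Omega>" "g \<in> L_p p \<Omega>" "Lp_tendsto f g" and V: "V \<in> L_p p \<Omega>"
  shows "(\<lambda>n. LINT x|M. pflux p (f n x) \<bullet> V x) \<longlonglongrightarrow> (LINT x|M. pflux p (g x) \<bullet> V x)"
proof -
  obtain K where K: "K \<ge> 0" "\<And>n. (LINT x|M. norm (f n x) powr p) \<le> K"
    using Lp_tendsto_bounded[OF f] by metis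
  let ?K = "K + (LINT x|M. norm (g x) powr p) + (LINT x|M. norm (V x) powr p)"
  show ?thesis
  proof (rule LIM_zero_cancel, rule tendsto_0_eps_bound)
    show "(\<lambda>n. LINT x|M. norm (f n x - g x) powr p) \<longlonglongrightarrow> 0" using f(3) by (simp add: Lp_tendsto_def)
    show "?K \<ge> 0" using K(1) by (intro add_nonneg_nonneg Bochner_Integration.integral_nonneg) auto
    fix \<epsilon> :: real assume e: "\<epsilon> > 0"
    obtain C where C: "C > 0" "\<And>(a::'b) b (c::'b). norm (pflux p a - pflux p b) * norm c
      \<le> \<epsilon> * (norm a powr p + norm b powr p + norm c powr p) + C * norm (a - b) powr p"
      by (rule pflux_diff_le[OF p_gt_1 e, where 'a='b]) blast
    have "norm ((LINT x|M. pflux p (f n x) \<bullet> V x) - (LINT x|M. pflux p (g x) \<bullet> V x))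
      \<le> \<epsilon> * ?K + C * (LINT x|M. norm (f n x - g x) powr p)" for n
    proof -
      have "(LINT x|M. pflux p (f n x) \<bullet> V x) - (LINT x|M. pflux p (g x) \<bullet> V x)
          = (LINT x|M. (pflux p (f n x) - pflux p (g x)) \<bullet> V x)"
        by (simp add: inner_diff_left pflux_integrable V f)
      also have "norm \<dots> \<le> (LINT x|M. \<epsilon> * (norm (f n x) powr p + norm (g x) powr p + norm (V x) powr p)
          + C * norm (f n x - g x) powr p)"
      proof (rule Bochner_Integration.integral_norm_bound_integral)
        show "norm ((pflux p (f n x) - pflux p (g x)) \<bullet> V x) \<le> \<epsilon> * (norm (f n x) powr p + norm (g x) powr p + norm (V x) powr p)
          + C * norm (f n x - g x) powr p" for x
          using Cauchy_Schwarz_ineq2[of "pflux p (f n x) - pflux p (g x)" "V x"] C(2)[of "f n x" "g x" "V x"]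
          by simp
        show "integrable M (\<lambda>x. (pflux p (f n x) - pflux p (g x)) \<bullet> V x)"
          unfolding inner_diff_left by (intro Bochner_Integration.integrable_diff pflux_integrable V f)
      qed (intro Bochner_Integration.integrable_add integrable_mult_right L_p_diff V f L_p_integrable_powr)+
      also have "\<dots> = \<epsilon> * ((LINT x|M. norm (f n x) powr p) + (LINT x|M. norm (g x) powr p) + (LINT x|M. norm (V x) powr p))
          + C * (LINT x|M. norm (f n x - g x) powr p)"
        by (simp add: L_p_integrable_powr L_p_diff V f)
      also have "\<dots> \<le> \<epsilon> * ?K + C * (LINT x|M. norm (f n x - g x) powr p)"
        using K(2)[of n] e by (intro add_right_mono mult_left_mono) auto
      finally show ?thesis .
    qed
    then show "\<exists>C>0. \<forall>n. norm ((LINT x|M. pflux p (f n x) \<bullet> V x) - (LINT x|M. pflux p (g x) \<bullet> V x))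
      \<le> \<epsilon> * ?K + C * (LINT x|M. norm (f n x - g x) powr p)" using C(1) by blast
  qed
qed

text \<open>A Cauchy sequence is also Cauchy in L^1, and some subsequence converges almost
  everywhere. Fatou's lemma along it turns the Cauchy estimate into an estimate of the distance to
  the limit.\<close>

lemma Lp_complete:
  fixes f :: "nat \<Rightarrow> 'a \<Rightarrow> 'b::euclidean_space"
  assumes f: "\<And>n. f n \<in> L_p p \<Omega>"
    and cauchy: "\<And>e. e > 0 \<Longrightarrow> \<exists>N. \<forall>m\<ge>N. \<forall>n\<ge>N. (LINT x|M. norm (f m x - f n x) powr p) < e"
  obtains g where "g \<in> L_p p \<Omega>" "Lp_tendsto f g"
proof -
  have c1: "\<exists>N. \<forall>i\<ge>N. \<forall>j\<ge>N. (LINT x|M. norm (f i x - f j x)) < e" if e: "e > 0" for e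
  proof -
    define m where "m = measure M \<Omega> + 1"
    have m: "m > 0" by (simp add: m_def add_nonneg_pos)
    define \<epsilon> where "\<epsilon> = e / (2 * m)"
    have \<epsilon>: "\<epsilon> > 0" using e m by (simp add: \<epsilon>_def)
    then obtain C where C: "C > 0" "\<And>a b. a \<ge> 0 \<Longrightarrow> b \<ge> 0 \<Longrightarrow> a powr (p - 1) * b \<le> \<epsilon> * a powr p + C * b powr p"
      using powr_young[OF p_gt_1] by metis
    obtain N where N: "\<And>m n. m \<ge> N \<Longrightarrow> n \<ge> N \<Longrightarrow> (LINT x|M. norm (f m x - f n x) powr p) < e / (2 * C)"
      using cauchy[of "e / (2 * C)"] e C(1) by (metis divide_pos_pos mult_pos_pos zero_less_numeral)
    have "(LINT x|M. norm (f i x - f j x)) < e" if "i \<ge> N" "j \<ge> N" for i j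
    proof -
      have "(LINT x|M. norm (f i x - f j x)) \<le> (LINT x|M. \<epsilon> + C * norm (f i x - f j x) powr p)"
      proof (rule integral_mono)
        show "norm (f i x - f j x) \<le> \<epsilon> + C * norm (f i x - f j x) powr p" for x
          using C(2)[of 1 "norm (f i x - f j x)"] by simp
      qed (intro Bochner_Integration.integrable_add finite_measure.integrable_const[OF finite_measure_M]
        integrable_norm integrable_mult_right L_p_integrable L_p_integrable_powr L_p_diff f)+
      also have "\<dots> = \<epsilon> * measure M \<Omega> + C * (LINT x|M. norm (f i x - f j x) powr p)"
        by (simp add: finite_measure.integrable_const[OF finite_measure_M] L_p_integrable_powr L_p_diff f)
      also have "C * (LINT x|M. norm (f i x - f j x) powr p) < e / 2"
        using N[OF that] C(1) by (simp add: field_simps)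
      also have "\<epsilon> * measure M \<Omega> \<le> e / 2"
      proof -
        have "\<epsilon> * measure M \<Omega> \<le> \<epsilon> * m" using \<epsilon> by (simp add: m_def)
        also have "\<dots> = e / 2" using m by (simp add: \<epsilon>_def)
        finally show ?thesis .
      qed
      finally show ?thesis by simp
    qed
    then show ?thesis by blast
  qed
  obtain r where r: "strict_mono r" "AE x in M. Cauchy (\<lambda>i. f (r i) x)"
    using cauchy_L1_AE_cauchy_subseq[of M f, OF L_p_integrable[OF f] c1] by metis
  define g where "g x = lim (\<lambda>i. f (r i) x)" for x
  have gm: "g \<in> borel_measurable M"
    unfolding g_def using L_p_measurable[OF f] by (rule borel_measurable_lim_metric)
  have lim: "AE x in M. (\<lambda>i. f (r i) x) \<longlonglongrightarrow> g x"
    using r(2) by eventually_elim (simp add: g_def Cauchy_convergent_iff convergent_LIMSEQ_iff)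
  have key: "(\<lambda>x. f n x - g x) \<in> L_p p \<Omega> \<and> (LINT x|M. norm (f n x - g x) powr p) \<le> e"
    if N: "\<And>m n. m \<ge> N \<Longrightarrow> n \<ge> N \<Longrightarrow> (LINT x|M. norm (f m x - f n x) powr p) < e" and n: "n \<ge> N" for e N n
  proof -
    have i: "integrable M (\<lambda>x. norm (f n x - f (r i) x) powr p)" for i
      by (intro L_p_integrable_powr L_p_diff f)
    have b: "(LINT x|M. norm (f n x - f (r i) x) powr p) \<le> e" if "i \<ge> N" for i
      using N[OF n, of "r i"] seq_suble[OF r(1), of i] that by simp
    have m: "(\<lambda>x. norm (f n x - g x) powr p) \<in> borel_measurable M"
      using L_p_measurable[OF f] gm by measurable
    have c: "AE x in M. (\<lambda>i. norm (f n x - f (r i) x) powr p) \<longlonglongrightarrow> norm (f n x - g x) powr p"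
      using lim by eventually_elim (rule tendsto_powr', use p_gt_1 in \<open>auto intro!: tendsto_intros\<close>)
    note F = integral_tendsto_bound_Fatou[OF i _ b m c]
    have "(\<lambda>x. f n x - g x) \<in> L_p p \<Omega>"
      using F(1) L_p_measurable[OF f] gm by (auto simp: L_p_def)
    with F(2) show ?thesis by simp
  qed
  obtain N where N: "\<And>m n. m \<ge> N \<Longrightarrow> n \<ge> N \<Longrightarrow> (LINT x|M. norm (f m x - f n x) powr p) < 1"
    using cauchy[of 1] by (metis zero_less_one)
  \<comment> \<open>Fatou places only the difference from the limit in L^p; the limit itself is
    recovered from it.\<close>
  have "(\<lambda>x. f N x - (f N x - g x)) \<in> L_p p \<Omega>"
    by (rule L_p_diff[OF f conjunct1[OF key[OF N order_refl]]])
  then have g: "g \<in> L_p p \<Omega>" by simp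
  moreover have "Lp_tendsto f g"
    unfolding Lp_tendsto_def
  proof (rule LIMSEQ_I)
    fix e :: real assume e: "e > 0"
    obtain N where N: "\<And>m n. m \<ge> N \<Longrightarrow> n \<ge> N \<Longrightarrow> (LINT x|M. norm (f m x - f n x) powr p) < e / 2"
      using cauchy[of "e / 2"] e by (metis half_gt_zero)
    show "\<exists>N. \<forall>n\<ge>N. norm ((LINT x|M. norm (f n x - g x) powr p) - 0) < e"
      using key[OF N] e by (intro exI[of _ N]) force
  qed
  ultimately show thesis by (rule that)
qed

end

section \<open>Sobolev functions with zero boundary values\<close>

context lebesgue_domain
begin

text \<open>An intermediate class between the test functions and W_0^{1,p}: unlike smoothness, C^1
  regularity survives composition with the C^1 functions that occur below.\<close>

definition C1c :: "('a \<Rightarrow> real) \<Rightarrow> ('a \<Rightarrow> 'a) \<Rightarrow> bool" where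
  "C1c f G \<longleftrightarrow> (\<forall>x. GDERIV f x :> G x) \<and> continuous_on UNIV G \<and>
     (\<exists>K. compact K \<and> K \<subseteq> \<Omega> \<and> (\<forall>x. x \<notin> K \<longrightarrow> f x = 0))"

lemma C1cD:
  assumes "C1c f G"
  shows "GDERIV f x :> G x" "continuous_on UNIV G" "continuous_on UNIV f"
proof -
  show D: "GDERIV f x :> G x" for x using assms by (auto simp: C1c_def)
  show "continuous_on UNIV G" using assms by (auto simp: C1c_def)
  show "continuous_on UNIV f"
    using D by (auto simp: gderiv_def intro!: continuous_at_imp_continuous_on has_derivative_continuous)
qed

lemma C1cE:
  assumes "C1c f G"
  obtains K where "compact K" "K \<subseteq> \<Omega>" "\<And>x. x \<notin> K \<Longrightarrow> f x = 0" "\<And>x. x \<notin> K \<Longrightarrow> G x = 0"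
proof -
  obtain K where K: "compact K" "K \<subseteq> \<Omega>" "\<And>x. x \<notin> K \<Longrightarrow> f x = 0"
    using assms unfolding C1c_def by blast
  show thesis
    using that[OF K] GDERIV_eq_0_outside[OF C1cD(1)[OF assms] compact_imp_closed[OF K(1)] K(3)] by blast
qed

lemma continuous_bounded_support:
  fixes g :: "'a \<Rightarrow> 'b::real_normed_vector"
  assumes "continuous_on UNIV g" "compact K" "\<And>x. x \<notin> K \<Longrightarrow> g x = 0"
  obtains B where "B \<ge> 0" "\<And>x. norm (g x) \<le> B"
proof -
  have "bounded (g ` K)"
    using assms by (intro compact_imp_bounded compact_continuous_image) (auto intro: continuous_on_subset)
  then obtain B where B: "\<And>x. x \<in> K \<Longrightarrow> norm (g x) \<le> B" by (auto simp: bounded_iff)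
  have "norm (g x) \<le> max B 0" for x using B[of x] assms(3)[of x] by (cases "x \<in> K") auto
  then show thesis using that[of "max B 0"] by simp
qed

lemma C1c_bounded:
  assumes "C1c f G"
  obtains B where "B \<ge> 0" "\<And>x. \<bar>f x\<bar> \<le> B" "\<And>x. norm (G x) \<le> B"
proof -
  obtain K where K: "compact K" "K \<subseteq> \<Omega>" "\<And>x. x \<notin> K \<Longrightarrow> f x = 0" "\<And>x. x \<notin> K \<Longrightarrow> G x = 0"
    using C1cE[OF assms] by metis
  obtain B1 where "B1 \<ge> 0" "\<And>x. norm (f x) \<le> B1"
    using continuous_bounded_support[OF C1cD(3)[OF assms] K(1,3)] by blast
  moreover obtain B2 where "B2 \<ge> 0" "\<And>x. norm (G x) \<le> B2"
    using continuous_bounded_support[OF C1cD(2)[OF assms] K(1,4)] by blast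
  ultimately show thesis using that[of "max B1 B2"] by (force simp: le_max_iff_disj)
qed

lemma C1c_L_p:
  assumes "C1c f G" shows "f \<in> L_p p \<Omega>" "G \<in> L_p p \<Omega>"
proof -
  obtain B where B: "\<And>x. \<bar>f x\<bar> \<le> B" "\<And>x. norm (G x) \<le> B" using C1c_bounded[OF assms] by metis
  show "f \<in> L_p p \<Omega>" "G \<in> L_p p \<Omega>"
    using B C1cD[OF assms] by (auto intro!: L_p_bounded[of _ B] measurable_continuous)
qed

lemma test_functions_C1c: "\<phi> \<in> test_functions \<Omega> \<Longrightarrow> C1c \<phi> (grad \<phi>)"
  unfolding C1c_def test_functions_def
  using C_infinity_GDERIV C_infinity_continuous_grad closure_subset[of "{x. \<phi> x \<noteq> 0}"] by blast

lemma C1c_integral_gradient: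
  assumes "C1c f G"
  shows "(LINT x|M. G x \<bullet> b) = 0"
proof -
  obtain K where K: "compact K" "K \<subseteq> \<Omega>" "\<And>x. x \<notin> K \<Longrightarrow> f x = 0" "\<And>x. x \<notin> K \<Longrightarrow> G x = 0"
    using C1cE[OF assms] by metis
  obtain r where r: "\<And>x. x \<in> K \<Longrightarrow> norm x \<le> r"
    using compact_imp_bounded[OF K(1)] by (auto simp: bounded_iff)
  have "(LINT x|M. G x \<bullet> b) = (LINT x|lebesgue. indicator \<Omega> x *\<^sub>R (G x \<bullet> b))"
    by (rule integral_restrict_space) (use sets_domain in simp)
  also have "(\<lambda>x. indicator \<Omega> x *\<^sub>R (G x \<bullet> b)) = (\<lambda>x. G x \<bullet> b)"
  proof
    fix x :: 'a show "indicator \<Omega> x *\<^sub>R (G x \<bullet> b) = G x \<bullet> b"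
      using K(2) K(4)[of x] by (cases "x \<in> K"; cases "x \<in> \<Omega>") auto
  qed
  also have "(LINT x|lebesgue. G x \<bullet> b) = (LINT x|lborel. G x \<bullet> b)"
    using C1cD(2)[OF assms] by (intro integral_completion) (auto intro!: borel_measurable_continuous_onI continuous_intros)
  also have "\<dots> = 0"
  proof (rule integral_gradient_eq_0(2)[OF C1cD(1,2)[OF assms], of r])
    fix x :: 'a assume "norm x > r"
    then have "x \<notin> K" using r[of x] by auto
    then show "f x = 0" "G x = 0" using K by auto
  qed
  finally show ?thesis .
qed

lemma C1c_mult:
  assumes f: "C1c f G" and g: "\<And>x. GDERIV g x :> H x" "continuous_on UNIV H"
  shows "C1c (\<lambda>x. f x * g x) (\<lambda>x. f x *\<^sub>R H x + g x *\<^sub>R G x)"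
proof -
  obtain K where K: "compact K" "K \<subseteq> \<Omega>" "\<And>x. x \<notin> K \<Longrightarrow> f x = 0" "\<And>x. x \<notin> K \<Longrightarrow> G x = 0"
    using C1cE[OF f] by metis
  have "continuous_on UNIV g"
    using g by (auto simp: gderiv_def intro!: continuous_at_imp_continuous_on has_derivative_continuous)
  then have "continuous_on UNIV (\<lambda>x. f x *\<^sub>R H x + g x *\<^sub>R G x)"
    using C1cD[OF f] g(2) by (intro continuous_intros)
  moreover have "GDERIV (\<lambda>x. f x * g x) x :> (f x *\<^sub>R H x + g x *\<^sub>R G x)" for x
    by (rule GDERIV_mult[OF C1cD(1)[OF f] g(1)])
  ultimately show ?thesis unfolding C1c_def using K by (metis mult_zero_left)
qed

text \<open>The pairs \<open>(u, U)\<close> of a function in \<open>W\<^sub>0\<^sup>1\<^sup>,\<^sup>p(\<Omega>)\<close> and its weak gradient.\<close>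

definition W0 :: "('a \<Rightarrow> real) \<Rightarrow> ('a \<Rightarrow> 'a) \<Rightarrow> bool" where
  "W0 u U \<longleftrightarrow> u \<in> L_p p \<Omega> \<and> U \<in> L_p p \<Omega> \<and> (\<exists>\<phi>. (\<forall>n. \<phi> n \<in> test_functions \<Omega>) \<and>
     Lp_tendsto \<phi> u \<and> Lp_tendsto (\<lambda>n. grad (\<phi> n)) U)"

lemma W0_L_p: "W0 u U \<Longrightarrow> u \<in> L_p p \<Omega>" "W0 u U \<Longrightarrow> U \<in> L_p p \<Omega>"
  by (auto simp: W0_def)

lemma W0E:
  assumes "W0 u U"
  obtains \<phi> where "\<And>n. \<phi> n \<in> test_functions \<Omega>" "\<And>n. C1c (\<phi> n) (grad (\<phi> n))"
    "Lp_tendsto \<phi> u" "Lp_tendsto (\<lambda>n. grad (\<phi> n)) U"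
  using assms test_functions_C1c unfolding W0_def by blast

text \<open>A diagonal choice: a test function within 1/(n+1) of the n-th pair, in the function and
  in the gradient, gives a sequence approximating the limit pair.\<close>

lemma W0_closed:
  assumes W: "\<And>n. W0 (u n) (U n)" and lim: "u' \<in> L_p p \<Omega>" "U' \<in> L_p p \<Omega>" "Lp_tendsto u u'" "Lp_tendsto U U'"
  shows "W0 u' U'"
proof -
  define \<delta> where "\<delta> n = inverse (real (Suc n))" for n
  have \<delta>: "\<delta> n > 0" "\<delta> \<longlonglongrightarrow> 0" for n unfolding \<delta>_def using LIMSEQ_inverse_real_of_nat by auto
  have "\<forall>n. \<exists>\<phi>. \<phi> \<in> test_functions \<Omega> \<and> (LINT x|M. norm (\<phi> x - u n x) powr p) < \<delta> n \<and>
      (LINT x|M. norm (grad \<phi> x - U n x) powr p) < \<delta> n"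
  proof
    fix n
    obtain \<phi> where \<phi>: "\<And>n. \<phi> n \<in> test_functions \<Omega>" "Lp_tendsto \<phi> (u n)" "Lp_tendsto (\<lambda>n. grad (\<phi> n)) (U n)"
      using W0E[OF W[of n]] by metis
    have "\<forall>\<^sub>F k in sequentially. (LINT x|M. norm (\<phi> k x - u n x) powr p) < \<delta> n"
      "\<forall>\<^sub>F k in sequentially. (LINT x|M. norm (grad (\<phi> k) x - U n x) powr p) < \<delta> n"
      using order_tendstoD(2)[OF \<phi>(2)[unfolded Lp_tendsto_def] \<delta>(1)]
        order_tendstoD(2)[OF \<phi>(3)[unfolded Lp_tendsto_def] \<delta>(1)] by blast+
    then have "\<exists>k. (LINT x|M. norm (\<phi> k x - u n x) powr p) < \<delta> n \<and> (LINT x|M. norm (grad (\<phi> k) x - U n x) powr p) < \<delta> n"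
      using eventually_happens'[OF sequentially_bot eventually_conj] by blast
    then show "\<exists>\<phi>. \<phi> \<in> test_functions \<Omega> \<and> (LINT x|M. norm (\<phi> x - u n x) powr p) < \<delta> n \<and>
      (LINT x|M. norm (grad \<phi> x - U n x) powr p) < \<delta> n" using \<phi>(1) by blast
  qed
  from choice[OF this] obtain \<phi> where \<phi>: "\<And>n. \<phi> n \<in> test_functions \<Omega>"
    "\<And>n. (LINT x|M. norm (\<phi> n x - u n x) powr p) < \<delta> n"
    "\<And>n. (LINT x|M. norm (grad (\<phi> n) x - U n x) powr p) < \<delta> n" by blast
  have key: "Lp_tendsto f g'" if f: "\<And>n. f n \<in> L_p p \<Omega>" and g: "\<And>n. g n \<in> L_p p \<Omega>" "g' \<in> L_p p \<Omega>" "Lp_tendsto g g'"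
    and d: "\<And>n. (LINT x|M. norm (f n x - g n x) powr p) < \<delta> n" for f g :: "nat \<Rightarrow> 'a \<Rightarrow> 'b::euclidean_space" and g'
  proof (rule Lp_tendsto_le[OF f g(2)])
    show "(\<lambda>n. 2 powr p * (\<delta> n + (LINT x|M. norm (g n x - g' x) powr p))) \<longlonglongrightarrow> 0"
      using tendsto_mult_right_zero[OF tendsto_add_zero[OF \<delta>(2) g(3)[unfolded Lp_tendsto_def]]] .
    fix n
    have "(LINT x|M. norm ((f n x - g n x) + (g n x - g' x)) powr p)
       \<le> 2 powr p * ((LINT x|M. norm (f n x - g n x) powr p) + (LINT x|M. norm (g n x - g' x) powr p))"
      by (rule Lp_integral_add_le[OF L_p_diff[OF f g(1)] L_p_diff[OF g(1) g(2)]])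
    also have "\<dots> \<le> 2 powr p * (\<delta> n + (LINT x|M. norm (g n x - g' x) powr p))"
      using d[of n] by (intro mult_left_mono) auto
    finally show "(LINT x|M. norm (f n x - g' x) powr p) \<le> 2 powr p * (\<delta> n + (LINT x|M. norm (g n x - g' x) powr p))"
      by simp
  qed
  note c = C1c_L_p[OF test_functions_C1c[OF \<phi>(1)]]
  have "Lp_tendsto \<phi> u'" by (rule key[OF c(1) W0_L_p(1)[OF W] lim(1) lim(3) \<phi>(2)])
  moreover have "Lp_tendsto (\<lambda>n. grad (\<phi> n)) U'" by (rule key[OF c(2) W0_L_p(2)[OF W] lim(2) lim(4) \<phi>(3)])
  ultimately show ?thesis unfolding W0_def using lim \<phi>(1) by blast
qed

text \<open>Mollification approximates uniformly together with the gradient, and on a set of finite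
  measure uniform convergence implies L^p convergence.\<close>

lemma W0_C1c:
  assumes f: "C1c f G"
  shows "W0 f G"
proof -
  obtain K where K: "compact K" "K \<subseteq> \<Omega>" "\<And>x. x \<notin> K \<Longrightarrow> f x = 0"
    using C1cE[OF f] by metis
  define \<delta> where "\<delta> n = inverse (real (Suc n))" for n
  have \<delta>: "\<delta> n > 0" "\<delta> n \<le> 1" "\<delta> \<longlonglongrightarrow> 0" for n
    unfolding \<delta>_def using LIMSEQ_inverse_real_of_nat by (auto simp: field_simps)
  have "\<forall>n. \<exists>\<phi>. \<phi> \<in> test_functions \<Omega> \<and> (\<forall>x. norm (\<phi> x - f x) \<le> \<delta> n) \<and> (\<forall>x. norm (grad \<phi> x - G x) \<le> \<delta> n)"
    unfolding real_norm_def
    using mollify_C1[OF C1cD(1,2)[OF f] K(1,3) open_domain K(2) \<delta>(1)] by metis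
  from choice[OF this] obtain \<phi> where \<phi>: "\<And>n. \<phi> n \<in> test_functions \<Omega>"
    "\<And>n x. norm (\<phi> n x - f x) \<le> \<delta> n" "\<And>n x. norm (grad (\<phi> n) x - G x) \<le> \<delta> n" by blast
  have key: "Lp_tendsto h g" if h: "\<And>n. h n \<in> L_p p \<Omega>" "g \<in> L_p p \<Omega>" and d: "\<And>n x. norm (h n x - g x) \<le> \<delta> n"
    for h and g :: "'a \<Rightarrow> 'b::euclidean_space"
  proof (rule Lp_tendsto_le[OF h])
    have "(\<lambda>n. \<delta> n powr p) \<longlonglongrightarrow> 0 powr p"
      by (rule tendsto_powr') (use \<delta> p_gt_1 in \<open>auto intro!: always_eventually less_imp_le\<close>)
    then show "(\<lambda>n. \<delta> n powr p * measure M \<Omega>) \<longlonglongrightarrow> 0" by (auto intro!: tendsto_mult_left_zero)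
    fix n
    have "(LINT x|M. norm (h n x - g x) powr p) \<le> (LINT x|M. \<delta> n powr p)"
      using d p_gt_1 by (intro integral_mono powr_mono2 L_p_integrable_powr L_p_diff h
          finite_measure.integrable_const[OF finite_measure_M]) auto
    then show "(LINT x|M. norm (h n x - g x) powr p) \<le> \<delta> n powr p * measure M \<Omega>" by (simp add: mult.commute)
  qed
  note c = C1c_L_p[OF test_functions_C1c[OF \<phi>(1)]]
  have "Lp_tendsto \<phi> f" "Lp_tendsto (\<lambda>n. grad (\<phi> n)) G"
    by (rule key[OF c(1) C1c_L_p(1)[OF f] \<phi>(2)], rule key[OF c(2) C1c_L_p(2)[OF f] \<phi>(3)])
  then show ?thesis unfolding W0_def using C1c_L_p[OF f] \<phi>(1) by blast
qed

lemma C1c_add: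
  assumes f: "C1c f G" and g: "C1c g H"
  shows "C1c (\<lambda>x. f x + g x) (\<lambda>x. G x + H x)"
proof -
  obtain K where K: "compact K" "K \<subseteq> \<Omega>" "\<And>x. x \<notin> K \<Longrightarrow> f x = 0" using C1cE[OF f] by metis
  obtain L where L: "compact L" "L \<subseteq> \<Omega>" "\<And>x. x \<notin> L \<Longrightarrow> g x = 0" using C1cE[OF g] by metis
  have "compact (K \<union> L) \<and> K \<union> L \<subseteq> \<Omega> \<and> (\<forall>x. x \<notin> K \<union> L \<longrightarrow> f x + g x = 0)"
    using K L by auto
  then show ?thesis unfolding C1c_def
    using GDERIV_add[OF C1cD(1)[OF f] C1cD(1)[OF g]] continuous_on_add[OF C1cD(2)[OF f] C1cD(2)[OF g]]
    by blast
qed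

lemma C1c_scaleR:
  assumes f: "C1c f G"
  shows "C1c (\<lambda>x. c *\<^sub>R f x) (\<lambda>x. c *\<^sub>R G x)"
  using C1c_mult[OF f GDERIV_const, of c] by (simp add: mult.commute)

lemma W0_add:
  assumes u: "W0 u U" and v: "W0 v V"
  shows "W0 (\<lambda>x. u x + v x) (\<lambda>x. U x + V x)"
proof -
  obtain \<phi> where \<phi>: "\<And>n. C1c (\<phi> n) (grad (\<phi> n))" "Lp_tendsto \<phi> u" "Lp_tendsto (\<lambda>n. grad (\<phi> n)) U"
    using W0E[OF u] by metis
  obtain \<psi> where \<psi>: "\<And>n. C1c (\<psi> n) (grad (\<psi> n))" "Lp_tendsto \<psi> v" "Lp_tendsto (\<lambda>n. grad (\<psi> n)) V"
    using W0E[OF v] by metis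
  show ?thesis
    by (rule W0_closed[OF W0_C1c[OF C1c_add[OF \<phi>(1) \<psi>(1)]] L_p_add[OF W0_L_p(1)[OF u] W0_L_p(1)[OF v]]
        L_p_add[OF W0_L_p(2)[OF u] W0_L_p(2)[OF v]]
        Lp_tendsto_add[OF C1c_L_p(1)[OF \<phi>(1)] W0_L_p(1)[OF u] \<phi>(2) C1c_L_p(1)[OF \<psi>(1)] W0_L_p(1)[OF v] \<psi>(2)]
        Lp_tendsto_add[OF C1c_L_p(2)[OF \<phi>(1)] W0_L_p(2)[OF u] \<phi>(3) C1c_L_p(2)[OF \<psi>(1)] W0_L_p(2)[OF v] \<psi>(3)]])
qed

lemma W0_scaleR:
  assumes u: "W0 u U"
  shows "W0 (\<lambda>x. c *\<^sub>R u x) (\<lambda>x. c *\<^sub>R U x)"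
proof -
  obtain \<phi> where \<phi>: "\<And>n. C1c (\<phi> n) (grad (\<phi> n))" "Lp_tendsto \<phi> u" "Lp_tendsto (\<lambda>n. grad (\<phi> n)) U"
    using W0E[OF u] by metis
  show ?thesis
    by (rule W0_closed[OF W0_C1c[OF C1c_scaleR[OF \<phi>(1)]] L_p_scaleR[OF W0_L_p(1)[OF u]]
        L_p_scaleR[OF W0_L_p(2)[OF u]] Lp_tendsto_scaleR[OF \<phi>(2)] Lp_tendsto_scaleR[OF \<phi>(3)]])
qed

lemma W0_diff:
  assumes u: "W0 u U" and v: "W0 v V"
  shows "W0 (\<lambda>x. u x - v x) (\<lambda>x. U x - V x)"
  using W0_add[OF u W0_scaleR[OF v, of "-1"]] by simp

text \<open>It identifies almost everywhere limits with L^p limits and, at the end, permits a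
  representative that is positive at every point.\<close>

lemma W0_AE_cong:
  assumes W: "W0 u U" and m: "v \<in> borel_measurable M" and eq: "AE x in M. v x = u x"
  shows "W0 v U"
proof (rule W0_closed[OF W])
  have "AE x in M. norm (v x) \<le> norm (u x)" using eq by eventually_elim simp
  then show "v \<in> L_p p \<Omega>" by (rule L_p_dominated[OF m W0_L_p(1)[OF W]])
  have "(LINT x|M. norm (u x - v x) powr p) = (LINT x|M. 0)"
    by (rule integral_cong_AE) (use m L_p_measurable[OF W0_L_p(1)[OF W]] eq in \<open>auto elim!: eventually_mono\<close>)
  then show "Lp_tendsto (\<lambda>n. u) v" by (simp add: Lp_tendsto_def)
  show "Lp_tendsto (\<lambda>n. U) U" by (simp add: Lp_tendsto_def)
qed (rule W0_L_p(2)[OF W])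

lemma Lp_tendsto_inner:
  fixes f :: "nat \<Rightarrow> 'a \<Rightarrow> 'b::euclidean_space"
  assumes f: "\<And>n. f n \<in> L_p p \<Omega>" "g \<in> L_p p \<Omega>" "Lp_tendsto f g" and b: "b \<in> Basis"
  shows "\<And>n. (\<lambda>x. f n x \<bullet> b) \<in> L_p p \<Omega>" "(\<lambda>x. g x \<bullet> b) \<in> L_p p \<Omega>"
    "Lp_tendsto (\<lambda>n x. f n x \<bullet> b) (\<lambda>x. g x \<bullet> b)"
proof -
  have m: "(\<lambda>x. h x \<bullet> b) \<in> L_p p \<Omega>" if "h \<in> L_p p \<Omega>" for h :: "'a \<Rightarrow> 'b"
    by (rule L_p_dominated[OF _ that]) (use L_p_measurable[OF that] Basis_le_norm[OF b] in auto)
  show 1: "\<And>n. (\<lambda>x. f n x \<bullet> b) \<in> L_p p \<Omega>" and 2: "(\<lambda>x. g x \<bullet> b) \<in> L_p p \<Omega>" by (intro m f)+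
  show "Lp_tendsto (\<lambda>n x. f n x \<bullet> b) (\<lambda>x. g x \<bullet> b)"
  proof (rule Lp_tendsto_le[OF 1 2 f(3)[unfolded Lp_tendsto_def]])
    show "(LINT x|M. norm (f n x \<bullet> b - g x \<bullet> b) powr p) \<le> (LINT x|M. norm (f n x - g x) powr p)" for n
      unfolding inner_diff_left[symmetric]
      using Basis_le_norm[OF b] p_gt_1
      by (intro integral_mono L_p_integrable_powr m L_p_diff f powr_mono2) auto
  qed
qed

text \<open>For the approximating test functions this is integration by parts, since the gradient of
  their product with \<psi> integrates to zero; both sides pass to the limit because \<psi> and its
  gradient are bounded.\<close>

lemma W0_has_weak_gradient:
  assumes W: "W0 u U"
  shows "has_weak_gradient \<Omega> u U"
proof -
  have loc: "locally_integrable \<Omega> f" if f: "f \<in> L_p p \<Omega>" for f :: "'a \<Rightarrow> 'b::euclidean_space"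
    unfolding locally_integrable_def
  proof safe
    fix K assume K: "compact K" "K \<subseteq> \<Omega>"
    have Km: "K \<in> sets lebesgue" using K(1) by (simp add: lmeasurable_compact fmeasurableD)
    have "integrable lebesgue (\<lambda>x. indicator \<Omega> x *\<^sub>R f x)"
      using L_p_integrable[OF f] sets_domain by (simp add: integrable_restrict_space)
    from integrable_mult_indicator[OF Km this]
    have "integrable lebesgue (\<lambda>x. indicator K x *\<^sub>R indicator \<Omega> x *\<^sub>R f x)" .
    also have "(\<lambda>x. indicator K x *\<^sub>R indicator \<Omega> x *\<^sub>R f x) = (\<lambda>x. indicator K x *\<^sub>R f x)"
      using K(2) by (auto simp: fun_eq_iff indicator_def)
    finally show "integrable (lebesgue_on K) f" using Km by (simp add: integrable_restrict_space)
  qed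
  obtain \<phi> where \<phi>: "\<And>n. C1c (\<phi> n) (grad (\<phi> n))" "Lp_tendsto \<phi> u" "Lp_tendsto (\<lambda>n. grad (\<phi> n)) U"
    using W0E[OF W] by metis
  note in_Lp = C1c_L_p[OF \<phi>(1)] and W_Lp = W0_L_p[OF W]
  have "(LINT x|M. u x * partial_deriv b \<psi> x) = - (LINT x|M. (U x \<bullet> b) * \<psi> x)"
    if \<psi>: "\<psi> \<in> test_functions \<Omega>" and b: "b \<in> Basis" for \<psi> b
  proof -
    note c\<psi> = test_functions_C1c[OF \<psi>]
    obtain B where B: "\<And>x. \<bar>\<psi> x\<bar> \<le> B" "\<And>x. norm (grad \<psi> x) \<le> B" using C1c_bounded[OF c\<psi>] by metis
    have w1: "(\<lambda>x. grad \<psi> x \<bullet> b) \<in> borel_measurable M" "AE x in M. \<bar>grad \<psi> x \<bullet> b\<bar> \<le> B"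
      using L_p_measurable[OF C1c_L_p(2)[OF c\<psi>]] B(2) Basis_le_norm[OF b] by (auto intro: order_trans)
    have w2: "\<psi> \<in> borel_measurable M" "AE x in M. \<bar>\<psi> x\<bar> \<le> B"
      using L_p_measurable[OF C1c_L_p(1)[OF c\<psi>]] B(1) by auto
    note g = Lp_tendsto_inner[OF in_Lp(2) W_Lp(2) \<phi>(3) b]
    have 1: "(\<lambda>n. LINT x|M. (grad \<psi> x \<bullet> b) * \<phi> n x) \<longlonglongrightarrow> (LINT x|M. (grad \<psi> x \<bullet> b) * u x)"
      by (rule Lp_tendsto_integral_mult[OF in_Lp(1) W_Lp(1) \<phi>(2) w1])
    have 2: "(\<lambda>n. LINT x|M. \<psi> x * (grad (\<phi> n) x \<bullet> b)) \<longlonglongrightarrow> (LINT x|M. \<psi> x * (U x \<bullet> b))"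
      by (rule Lp_tendsto_integral_mult[OF g w2])
    have "(LINT x|M. (grad \<psi> x \<bullet> b) * \<phi> n x) = - (LINT x|M. \<psi> x * (grad (\<phi> n) x \<bullet> b))" for n
    proof -
      have "(LINT x|M. (\<phi> n x *\<^sub>R grad \<psi> x + \<psi> x *\<^sub>R grad (\<phi> n) x) \<bullet> b) = 0"
        by (rule C1c_integral_gradient[OF C1c_mult[OF \<phi>(1) C1cD(1,2)[OF c\<psi>]]])
      moreover have "(\<lambda>x. (\<phi> n x *\<^sub>R grad \<psi> x + \<psi> x *\<^sub>R grad (\<phi> n) x) \<bullet> b)
          = (\<lambda>x. (grad \<psi> x \<bullet> b) * \<phi> n x + \<psi> x * (grad (\<phi> n) x \<bullet> b))"
        by (simp add: inner_add_left mult.commute)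
      ultimately show ?thesis
        using L_p_integrable_mult_bounded[OF in_Lp(1) w1] L_p_integrable_mult_bounded[OF g(1) w2] by simp
    qed
    then have "(\<lambda>n. LINT x|M. (grad \<psi> x \<bullet> b) * \<phi> n x) \<longlonglongrightarrow> - (LINT x|M. \<psi> x * (U x \<bullet> b))"
      using tendsto_minus[OF 2] by simp
    from LIMSEQ_unique[OF 1 this] show ?thesis
      by (simp add: partial_deriv_eq_grad[OF b] mult.commute)
  qed
  then show ?thesis
    unfolding has_weak_gradient_def using loc[OF W_Lp(1)] loc[OF W_Lp(2)] by blast
qed

lemma W0_W1p_0: "W0 u U \<Longrightarrow> u \<in> W1p_0 p \<Omega>" "W0 u U \<Longrightarrow> u \<in> W1p p \<Omega>"
  using W0_has_weak_gradient[of u U]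
  by (auto simp: W0_def W1p_0_def W1p_def Lp_tendsto_def)

text \<open>Where \<phi> vanishes inside \<Omega>, so does the composition, by
  \<open>B x 0 = 0\<close>; hence the support stays in K. Extension by 0 keeps the gradient
  continuous, because a point outside \<Omega> has a neighbourhood missing K.\<close>

lemma C1c_compose:
  assumes f: "C1c \<phi> G"
    and D: "\<And>x t. ((\<lambda>z. B (fst z) (snd z)) has_derivative (\<lambda>z. fst z \<bullet> Bx x t + snd z * Bt x t)) (at (x, t))"
    and cont: "continuous_on UNIV (\<lambda>z. Bx (fst z) (snd z))" "continuous_on UNIV (\<lambda>z. Bt (fst z) (snd z))"
    and B0: "\<And>x. x \<in> \<Omega> \<Longrightarrow> B x 0 = 0"
  shows "C1c (\<lambda>x. if x \<in> \<Omega> then B x (\<phi> x) else 0)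
    (\<lambda>x. if x \<in> \<Omega> then Bx x (\<phi> x) + Bt x (\<phi> x) *\<^sub>R G x else 0)"
proof -
  define g where "g x = (if x \<in> \<Omega> then B x (\<phi> x) else 0)" for x
  define H where "H x = Bx x (\<phi> x) + Bt x (\<phi> x) *\<^sub>R G x" for x
  obtain K where K: "compact K" "K \<subseteq> \<Omega>" "\<And>x. x \<notin> K \<Longrightarrow> \<phi> x = 0" using C1cE[OF f] by metis
  have g0: "g x = 0" if "x \<notin> K" for x using that K B0 by (auto simp: g_def)
  have D\<Omega>: "GDERIV g x :> H x" if x: "x \<in> \<Omega>" for x
  proof -
    have "((\<lambda>x. (x, \<phi> x)) has_derivative (\<lambda>h. (h, h \<bullet> G x))) (at x)"
      using C1cD(1)[OF f, of x] unfolding gderiv_def by (intro has_derivative_Pair) auto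
    from has_derivative_compose[OF this D]
    have "GDERIV (\<lambda>x. B x (\<phi> x)) x :> H x"
      by (simp add: gderiv_def H_def inner_add_right algebra_simps)
    then show ?thesis unfolding gderiv_def
      by (rule has_derivative_transform_within_open[OF _ open_domain x]) (simp add: g_def)
  qed
  have D0: "GDERIV g x :> 0" if x: "x \<notin> K" for x
    unfolding gderiv_def
    by (rule has_derivative_transform_within_open[of "\<lambda>x. 0" _ _ _ "- K"])
      (use x g0 compact_imp_closed[OF K(1)] in auto)
  have D': "GDERIV g x :> (if x \<in> \<Omega> then H x else 0)" for x
    using D\<Omega>[of x] D0[of x] K(2) by auto
  have cH: "continuous_on UNIV H"
  proof -
    have c1: "continuous_on UNIV (\<lambda>x. (x, \<phi> x))" by (intro continuous_intros C1cD(3)[OF f])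
    show ?thesis unfolding H_def
      using continuous_on_compose2[OF cont(1) c1] continuous_on_compose2[OF cont(2) c1]
      by (auto intro!: continuous_intros C1cD(2)[OF f])
  qed
  have "isCont (\<lambda>x. if x \<in> \<Omega> then H x else 0) x" for x
  proof (cases "x \<in> \<Omega>")
    case True
    have "\<forall>\<^sub>F y in nhds x. H y = (if y \<in> \<Omega> then H y else 0)"
      using eventually_nhds_in_open[OF open_domain True] by eventually_elim simp
    moreover have "isCont H x" using cH by (simp add: continuous_on_eq_continuous_at)
    ultimately show ?thesis using isCont_cong[of H "\<lambda>y. if y \<in> \<Omega> then H y else 0" x] by blast
  next
    case False
    then have xK: "x \<notin> K" using K by auto
    have "\<forall>\<^sub>F y in nhds x. y \<in> - K"
      using xK compact_imp_closed[OF K(1)] by (intro eventually_nhds_in_open) auto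
    then have "\<forall>\<^sub>F y in nhds x. (0::'a) = (if y \<in> \<Omega> then H y else 0)"
    proof eventually_elim
      case (elim y)
      show ?case using elim grad_eq[OF D\<Omega>[of y]] grad_eq[OF D0[of y]] by simp
    qed
    moreover have "isCont (\<lambda>x. 0::'a) x" by simp
    ultimately show ?thesis using isCont_cong[of "\<lambda>y. 0" "\<lambda>y. if y \<in> \<Omega> then H y else 0" x] by blast
  qed
  then have "continuous_on UNIV (\<lambda>x. if x \<in> \<Omega> then H x else 0)"
    by (simp add: continuous_at_imp_continuous_on)
  then show ?thesis
    unfolding C1c_def using D' K g0 unfolding g_def H_def by blast
qed

text \<open>The hypothesis \<open>B x 0 = 0\<close> preserves the boundary values.\<close>

lemma W0_compose:
  assumes W: "W0 u U"
    and D: "\<And>x t. ((\<lambda>z. B (fst z) (snd z)) has_derivative (\<lambda>z. fst z \<bullet> Bx x t + snd z * Bt x t)) (at (x, t))"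
    and cont: "continuous_on UNIV (\<lambda>z. Bx (fst z) (snd z))" "continuous_on UNIV (\<lambda>z. Bt (fst z) (snd z))"
    and B0: "\<And>x. x \<in> \<Omega> \<Longrightarrow> B x 0 = 0"
    and K: "\<And>x t. x \<in> \<Omega> \<Longrightarrow> norm (Bx x t) \<le> K" "\<And>x t. x \<in> \<Omega> \<Longrightarrow> \<bar>Bt x t\<bar> \<le> K"
  shows "W0 (\<lambda>x. B x (u x)) (\<lambda>x. Bx x (u x) + Bt x (u x) *\<^sub>R U x)"
proof -
  obtain \<phi>' where \<phi>': "\<And>n. C1c (\<phi>' n) (grad (\<phi>' n))" "Lp_tendsto \<phi>' u" "Lp_tendsto (\<lambda>n. grad (\<phi>' n)) U"
    using W0E[OF W] by metis
  note W_Lp = W0_L_p[OF W]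
  \<comment> \<open>The coefficients \<open>Bx\<close> and \<open>Bt\<close> are merely continuous
    and bounded, so their convergence rests on pointwise limits and dominated convergence.\<close>
  obtain r where r: "strict_mono r" "AE x in M. (\<lambda>n. \<phi>' (r n) x) \<longlonglongrightarrow> u x"
    using Lp_tendsto_AE_subseq[OF C1c_L_p(1)[OF \<phi>'(1)] W_Lp(1) \<phi>'(2)] by metis
  define \<phi> where "\<phi> n = \<phi>' (r n)" for n
  have \<phi>: "\<And>n. C1c (\<phi> n) (grad (\<phi> n))" "Lp_tendsto \<phi> u" "Lp_tendsto (\<lambda>n. grad (\<phi> n)) U"
    "AE x in M. (\<lambda>n. \<phi> n x) \<longlonglongrightarrow> u x"
    using \<phi>'(1) Lp_tendsto_subseq[OF \<phi>'(2) r(1)] Lp_tendsto_subseq[OF \<phi>'(3) r(1)] r(2)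
    by (auto simp: \<phi>_def[abs_def])
  note \<phi>_Lp = C1c_L_p[OF \<phi>(1)]
  define f where "f n x = (if x \<in> \<Omega> then B x (\<phi> n x) else 0)" for n x
  define F where "F n x = (if x \<in> \<Omega> then Bx x (\<phi> n x) + Bt x (\<phi> n x) *\<^sub>R grad (\<phi> n) x else 0)" for n x
  have fF: "C1c (f n) (F n)" for n
    unfolding f_def[abs_def] F_def[abs_def] by (rule C1c_compose[OF \<phi>(1) D cont B0])
  have contB: "continuous_on UNIV (\<lambda>z. B (fst z) (snd z))"
    using D by (auto intro!: continuous_at_imp_continuous_on has_derivative_continuous)
  have meas: "(\<lambda>x. Q x (w x)) \<in> borel_measurable M"
    if "continuous_on UNIV (\<lambda>z. Q (fst z) (snd z))" "w \<in> L_p p \<Omega>" for Q :: "'a \<Rightarrow> real \<Rightarrow> 'b::euclidean_space" and w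
  proof -
    have "(\<lambda>x. (x, w x)) \<in> borel_measurable M"
      by (intro borel_measurable_Pair measurable_continuous[OF continuous_on_id] L_p_measurable[OF that(2)])
    from measurable_compose[OF this borel_measurable_continuous_onI[OF that(1)]] show ?thesis by simp
  qed
  \<comment> \<open>The bound on the t-derivative makes B Lipschitz in t, so the functions
    themselves converge in L^p without passing to pointwise limits.\<close>
  have lip: "\<bar>B x s - B x t\<bar> \<le> K * \<bar>s - t\<bar>" if x: "x \<in> \<Omega>" for x s t
  proof -
    have d: "(B x has_real_derivative Bt x s) (at s within UNIV)" for s
    proof -
      have "((\<lambda>s. (x, s)) has_derivative (\<lambda>h. (0, h))) (at s)"
        by (intro has_derivative_Pair) auto
      from has_derivative_compose[OF this D] show ?thesis
        by (simp add: has_field_derivative_def mult_commute_abs)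
    qed
    show ?thesis
      using field_differentiable_bound[OF convex_UNIV d, of K s t] K(2)[OF x] by simp
  qed
  have Kn: "K \<ge> 0" if "x \<in> \<Omega>" for x using K(2)[OF that] abs_ge_zero order_trans by blast
  have BuLp: "(\<lambda>x. B x (u x)) \<in> L_p p \<Omega>"
  proof (rule L_p_dominated[OF meas[OF contB W_Lp(1)] L_p_scaleR[OF W_Lp(1), of K]])
    show "AE x in M. norm (B x (u x)) \<le> norm (K *\<^sub>R u x)"
      using AE_mem_domain
    proof eventually_elim
      case (elim x)
      show ?case using lip[OF elim, of "u x" 0] B0[OF elim] Kn[OF elim] by (simp add: abs_mult)
    qed
  qed
  have BxLp: "(\<lambda>x. Bx x (u x)) \<in> L_p p \<Omega>"
    by (rule L_p_bounded[OF meas[OF cont(1) W_Lp(1)], of K])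
      (use AE_mem_domain K(1) in \<open>auto elim!: eventually_mono\<close>)
  have BtLp: "(\<lambda>x. Bt x (w x) *\<^sub>R V x) \<in> L_p p \<Omega>" if "V \<in> L_p p \<Omega>" "w \<in> L_p p \<Omega>" for w and V :: "'a \<Rightarrow> 'a"
  proof (rule L_p_dominated[OF _ L_p_scaleR[OF that(1), of K]])
    show "(\<lambda>x. Bt x (w x) *\<^sub>R V x) \<in> borel_measurable M"
      using meas[OF cont(2) that(2)] L_p_measurable[OF that(1)] by measurable
    show "AE x in M. norm (Bt x (w x) *\<^sub>R V x) \<le> norm (K *\<^sub>R V x)"
      using AE_mem_domain by eventually_elim (use K(2) Kn in \<open>auto intro!: mult_right_mono\<close>)
  qed
  have 1: "Lp_tendsto f (\<lambda>x. B x (u x))"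
  proof (rule Lp_tendsto_le[OF C1c_L_p(1)[OF fF] BuLp])
    show "(\<lambda>n. \<bar>K\<bar> powr p * (LINT x|M. norm (\<phi> n x - u x) powr p)) \<longlonglongrightarrow> 0"
      using tendsto_mult_right_zero[OF \<phi>(2)[unfolded Lp_tendsto_def]] .
    fix n
    have "(LINT x|M. norm (f n x - B x (u x)) powr p) \<le> (LINT x|M. \<bar>K\<bar> powr p * norm (\<phi> n x - u x) powr p)"
    proof (rule integral_mono)
      fix x assume "x \<in> space M"
      then have x: "x \<in> \<Omega>" by simp
      have "norm (f n x - B x (u x)) \<le> \<bar>K\<bar> * norm (\<phi> n x - u x)"
        using lip[OF x] x Kn[OF x] by (simp add: f_def)
      then have "norm (f n x - B x (u x)) powr p \<le> (\<bar>K\<bar> * norm (\<phi> n x - u x)) powr p"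
        using p_gt_1 by (intro powr_mono2) auto
      then show "norm (f n x - B x (u x)) powr p \<le> \<bar>K\<bar> powr p * norm (\<phi> n x - u x) powr p"
        by (simp add: powr_mult)
    qed (intro integrable_mult_right L_p_integrable_powr L_p_diff C1c_L_p(1)[OF fF] BuLp \<phi>_Lp(1) W_Lp(1))+
    then show "(LINT x|M. norm (f n x - B x (u x)) powr p) \<le> \<bar>K\<bar> powr p * (LINT x|M. norm (\<phi> n x - u x) powr p)" by simp
  qed
  have lim: "(\<lambda>n. Q x (\<phi> n x)) \<longlonglongrightarrow> Q x (u x)"
    if "continuous_on UNIV (\<lambda>z. Q (fst z) (snd z))" "(\<lambda>n. \<phi> n x) \<longlonglongrightarrow> u x" for Q :: "'a \<Rightarrow> real \<Rightarrow> 'b::euclidean_space" and x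
  proof -
    have "(\<lambda>n. (x, \<phi> n x)) \<longlonglongrightarrow> (x, u x)" by (intro tendsto_intros that)
    from continuous_on_tendsto_compose[OF that(1) this] show ?thesis by simp
  qed
  \<comment> \<open>The gradient is split into three parts: \<open>Bx\<close>, the coefficient
    \<open>Bt\<close> applied to the fixed U, and \<open>Bt\<close> applied to the error of the
    gradients. Dominated convergence handles two of them, the bound on \<open>Bt\<close> the
    third.\<close>
  have A: "Lp_tendsto (\<lambda>n x. Bx x (\<phi> n x)) (\<lambda>x. Bx x (u x))"
  proof (rule Lp_tendsto_dominated[OF meas[OF cont(1) \<phi>_Lp(1)] BxLp L_p_bounded[of "\<lambda>x. K" "\<bar>K\<bar>"]])
    show "AE x in M. norm (Bx x (\<phi> n x)) \<le> norm K" for n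
      using AE_mem_domain by eventually_elim (use K(1) Kn in auto)
    show "AE x in M. (\<lambda>n. Bx x (\<phi> n x)) \<longlonglongrightarrow> Bx x (u x)"
      using \<phi>(4) by eventually_elim (rule lim[OF cont(1)])
  qed auto
  have B: "Lp_tendsto (\<lambda>n x. Bt x (\<phi> n x) *\<^sub>R U x) (\<lambda>x. Bt x (u x) *\<^sub>R U x)"
  proof (rule Lp_tendsto_dominated[OF L_p_measurable[OF BtLp[OF W_Lp(2) \<phi>_Lp(1)]] BtLp[OF W_Lp(2) W_Lp(1)] L_p_scaleR[OF W_Lp(2), of K]])
    show "AE x in M. norm (Bt x (\<phi> n x) *\<^sub>R U x) \<le> norm (K *\<^sub>R U x)" for n
      using AE_mem_domain by eventually_elim (use K(2) Kn in \<open>auto intro!: mult_right_mono\<close>)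
    show "AE x in M. (\<lambda>n. Bt x (\<phi> n x) *\<^sub>R U x) \<longlonglongrightarrow> Bt x (u x) *\<^sub>R U x"
      using \<phi>(4) by eventually_elim (intro tendsto_intros lim[OF cont(2)])
  qed
  have C: "Lp_tendsto (\<lambda>n x. Bt x (\<phi> n x) *\<^sub>R (grad (\<phi> n) x - U x)) (\<lambda>x. 0)"
  proof (rule Lp_tendsto_le)
    show "(\<lambda>x. Bt x (\<phi> n x) *\<^sub>R (grad (\<phi> n) x - U x)) \<in> L_p p \<Omega>" for n
      by (intro BtLp L_p_diff \<phi>_Lp W_Lp)
    show "(\<lambda>x. 0) \<in> L_p p \<Omega>" by (rule L_p_bounded[of _ 0]) auto
    show "(\<lambda>n. \<bar>K\<bar> powr p * (LINT x|M. norm (grad (\<phi> n) x - U x) powr p)) \<longlonglongrightarrow> 0"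
      using tendsto_mult_right_zero[OF \<phi>(3)[unfolded Lp_tendsto_def]] .
    fix n
    have "(LINT x|M. norm (Bt x (\<phi> n x) *\<^sub>R (grad (\<phi> n) x - U x) - 0) powr p)
       \<le> (LINT x|M. \<bar>K\<bar> powr p * norm (grad (\<phi> n) x - U x) powr p)"
    proof (rule integral_mono)
      show "integrable M (\<lambda>x. norm (Bt x (\<phi> n x) *\<^sub>R (grad (\<phi> n) x - U x) - 0) powr p)"
        unfolding diff_zero by (intro L_p_integrable_powr BtLp L_p_diff \<phi>_Lp W_Lp)
      show "integrable M (\<lambda>x. \<bar>K\<bar> powr p * norm (grad (\<phi> n) x - U x) powr p)"
        by (intro integrable_mult_right L_p_integrable_powr L_p_diff \<phi>_Lp W_Lp)
      fix x assume "x \<in> space M"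
      then have x: "x \<in> \<Omega>" by simp
      have "norm (Bt x (\<phi> n x) *\<^sub>R (grad (\<phi> n) x - U x)) \<le> \<bar>K\<bar> * norm (grad (\<phi> n) x - U x)"
        using K(2)[OF x, of "\<phi> n x"] by (auto intro!: mult_right_mono)
      then have "norm (Bt x (\<phi> n x) *\<^sub>R (grad (\<phi> n) x - U x)) powr p \<le> (\<bar>K\<bar> * norm (grad (\<phi> n) x - U x)) powr p"
        using p_gt_1 by (intro powr_mono2) auto
      then show "norm (Bt x (\<phi> n x) *\<^sub>R (grad (\<phi> n) x - U x) - 0) powr p \<le> \<bar>K\<bar> powr p * norm (grad (\<phi> n) x - U x) powr p"
        by (simp add: powr_mult)
    qed
    then show "(LINT x|M. norm (Bt x (\<phi> n x) *\<^sub>R (grad (\<phi> n) x - U x) - 0) powr p)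
       \<le> \<bar>K\<bar> powr p * (LINT x|M. norm (grad (\<phi> n) x - U x) powr p)" by simp
  qed
  have BxnLp: "(\<lambda>x. Bx x (\<phi> n x)) \<in> L_p p \<Omega>" for n
    by (rule L_p_bounded[OF meas[OF cont(1) \<phi>_Lp(1)], where B=K])
      (use AE_mem_domain K(1) in \<open>auto elim!: eventually_mono\<close>)
  have z: "(\<lambda>x. 0) \<in> L_p p \<Omega>" by (rule L_p_bounded[of _ 0]) auto
  have "Lp_tendsto (\<lambda>n x. (Bx x (\<phi> n x) + Bt x (\<phi> n x) *\<^sub>R U x) + Bt x (\<phi> n x) *\<^sub>R (grad (\<phi> n) x - U x))
      (\<lambda>x. (Bx x (u x) + Bt x (u x) *\<^sub>R U x) + 0)"
    by (rule Lp_tendsto_add[OF L_p_add[OF BxnLp BtLp[OF W_Lp(2) \<phi>_Lp(1)]] L_p_add[OF BxLp BtLp[OF W_Lp(2,1)]]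
        Lp_tendsto_add[OF BxnLp BxLp A BtLp[OF W_Lp(2) \<phi>_Lp(1)] BtLp[OF W_Lp(2,1)] B]
        BtLp[OF L_p_diff[OF \<phi>_Lp(2) W_Lp(2)] \<phi>_Lp(1)] z C])
  moreover have "(LINT x|M. norm ((Bx x (\<phi> n x) + Bt x (\<phi> n x) *\<^sub>R U x) + Bt x (\<phi> n x) *\<^sub>R (grad (\<phi> n) x - U x)
        - ((Bx x (u x) + Bt x (u x) *\<^sub>R U x) + 0)) powr p)
      = (LINT x|M. norm (F n x - (Bx x (u x) + Bt x (u x) *\<^sub>R U x)) powr p)" for n
    by (rule Bochner_Integration.integral_cong) (auto simp: F_def scaleR_diff_right)
  ultimately have 2: "Lp_tendsto F (\<lambda>x. Bx x (u x) + Bt x (u x) *\<^sub>R U x)"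
    by (simp add: Lp_tendsto_def)
  show ?thesis
    by (rule W0_closed[OF W0_C1c[OF fF] BuLp L_p_add[OF BxLp BtLp[OF W_Lp(2,1)]] 1 2])
qed

end

section \<open>The Poincare inequality\<close>

text \<open>With T chosen so that T^(1-p) = \<epsilon>, values up to T are covered by the constant,
  and for b > T one has b = b^(1-p) b^p \<le> \<epsilon> b^p.\<close>

lemma powr_young_const:
  fixes p \<epsilon> :: real
  assumes "p > 1" "\<epsilon> > 0"
  obtains C where "C > 0" "\<And>b. b \<ge> 0 \<Longrightarrow> b \<le> \<epsilon> * b powr p + C"
proof
  define T where "T = \<epsilon> powr (1 / (1 - p))"
  show T: "T > 0" using assms by (simp add: T_def)
  have TT: "T powr (1 - p) = \<epsilon>" using assms by (simp add: T_def powr_powr)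
  fix b :: real assume b: "b \<ge> 0"
  show "b \<le> \<epsilon> * b powr p + T"
  proof (cases "b \<le> T")
    case True
    then show ?thesis using assms by (simp add: add_increasing)
  next
    case False
    then have "b powr (1 - p) \<le> T powr (1 - p)" using T assms by (intro powr_mono2') auto
    then have "b powr (1 - p) * b powr p \<le> \<epsilon> * b powr p" unfolding TT by (intro mult_right_mono) auto
    moreover have "b powr (1 - p) * b powr p = b" using False T by (simp flip: powr_add)
    ultimately show ?thesis using T by simp
  qed
qed

context lebesgue_domain
begin

text \<open>Integrate by parts in one coordinate direction b: since (x \<bullet> b) |\<phi>|^p is
  C^1 with compact support, the integral of |\<phi>|^p equals minus that of p (x \<bullet> b)
  |\<phi>|^(p-2) \<phi> times the b-derivative of \<phi>. Young's inequality absorbs half of the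
  left side.\<close>

lemma poincare_C1c:
  obtains C where "C > 0" "\<And>\<phi> G. C1c \<phi> G \<Longrightarrow> (LINT x|M. norm (\<phi> x) powr p) \<le> C * (LINT x|M. norm (G x) powr p)"
proof -
  obtain b :: 'a where b: "b \<in> Basis" using nonempty_Basis by blast
  obtain R where R: "R > 0" "\<And>x. x \<in> \<Omega> \<Longrightarrow> norm x \<le> R"
    using bounded_domain by (auto simp: bounded_pos)
  \<comment> \<open>This is the value of the Young parameter for which the factor R p leaves exactly
    one half of the integral of |\<phi>|^p.\<close>
  have "1 / (2 * R * p) > 0" using R p_gt_1 by simp
  then obtain C where C: "C > 0" "\<And>a b. a \<ge> 0 \<Longrightarrow> b \<ge> 0 \<Longrightarrow> a powr (p - 1) * b \<le> 1 / (2 * R * p) * a powr p + C * b powr p"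
    using powr_young[OF p_gt_1] by metis
  have "(LINT x|M. norm (\<phi> x) powr p) \<le> 2 * R * p * C * (LINT x|M. norm (G x) powr p)" if \<phi>: "C1c \<phi> G" for \<phi> G
  proof -
    have Dp: "GDERIV (\<lambda>x. norm (\<phi> x) powr p) x :> (p * pflux p (\<phi> x)) *\<^sub>R G x" for x
    proof -
      have "DERIV (\<lambda>t. norm t powr p) (\<phi> x) :> p * pflux p (\<phi> x)"
        using GDERIV_norm_powr[OF p_gt_1, of "\<phi> x"]
        unfolding gderiv_deriv pflux_def real_scaleR_def by (simp only: mult.assoc)
      from GDERIV_DERIV_compose[OF C1cD(1)[OF \<phi>] this] show ?thesis .
    qed
    have "C1c (\<lambda>x. norm (\<phi> x) powr p) (\<lambda>x. (p * pflux p (\<phi> x)) *\<^sub>R G x)"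
      unfolding C1c_def
    proof (intro conjI allI Dp)
      show "continuous_on UNIV (\<lambda>x. (p * pflux p (\<phi> x)) *\<^sub>R G x)"
        by (intro continuous_intros C1cD[OF \<phi>] continuous_on_compose2[OF continuous_on_pflux[OF p_gt_1]]) auto
      show "\<exists>K. compact K \<and> K \<subseteq> \<Omega> \<and> (\<forall>x. x \<notin> K \<longrightarrow> norm (\<phi> x) powr p = 0)"
        using C1cE[OF \<phi>] by (metis norm_zero powr_0)
    qed
    moreover have "GDERIV (\<lambda>x. x \<bullet> b) x :> b" for x
      by (auto simp: gderiv_def intro!: derivative_eq_intros)
    ultimately
    have "(LINT x|M. (norm (\<phi> x) powr p *\<^sub>R b + (x \<bullet> b) *\<^sub>R (p * pflux p (\<phi> x)) *\<^sub>R G x) \<bullet> b) = 0"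
      by (rule C1c_integral_gradient[OF C1c_mult[OF _ _ continuous_on_const]])
    moreover have "(\<lambda>x. (norm (\<phi> x) powr p *\<^sub>R b + (x \<bullet> b) *\<^sub>R (p * pflux p (\<phi> x)) *\<^sub>R G x) \<bullet> b)
        = (\<lambda>x. norm (\<phi> x) powr p + (x \<bullet> b) * p * (pflux p (\<phi> x) * (G x \<bullet> b)))"
      using b by (auto simp: inner_add_left mult_ac)
    ultimately have 0: "(LINT x|M. norm (\<phi> x) powr p + (x \<bullet> b) * p * (pflux p (\<phi> x) * (G x \<bullet> b))) = 0" by simp
    note Lp = C1c_L_p[OF \<phi>]
    have bound: "\<bar>(x \<bullet> b) * p * (pflux p (\<phi> x) * (G x \<bullet> b))\<bar> \<le> 1 / 2 * norm (\<phi> x) powr p + R * p * C * norm (G x) powr p"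
      if x: "x \<in> \<Omega>" for x
    proof -
      have "\<bar>(x \<bullet> b) * p * (pflux p (\<phi> x) * (G x \<bullet> b))\<bar> \<le> R * p * (norm (\<phi> x) powr (p - 1) * norm (G x))"
        using R(2)[OF x] Basis_le_norm[OF b, of x] Basis_le_norm[OF b, of "G x"] p_gt_1 R(1) norm_pflux[of p "\<phi> x"]
        unfolding abs_mult by (intro mult_mono) auto
      also have "\<dots> \<le> R * p * (1 / (2 * R * p) * norm (\<phi> x) powr p + C * norm (G x) powr p)"
        using C(2)[of "norm (\<phi> x)" "norm (G x)"] R(1) p_gt_1 by (intro mult_left_mono) auto
      also have "\<dots> = (R * p * (1 / (2 * R * p))) * norm (\<phi> x) powr p + R * p * C * norm (G x) powr p"
        by (simp only: distrib_left mult.assoc)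
      also have "R * p * (1 / (2 * R * p)) = 1 / 2" using R(1) p_gt_1 by simp
      finally show ?thesis .
    qed
    have i1: "integrable M (\<lambda>x. 1 / 2 * norm (\<phi> x) powr p + R * p * C * norm (G x) powr p)"
      by (intro Bochner_Integration.integrable_add integrable_mult_right L_p_integrable_powr Lp)
    have i2: "integrable M (\<lambda>x. (x \<bullet> b) * p * (pflux p (\<phi> x) * (G x \<bullet> b)))"
    proof (rule Bochner_Integration.integrable_bound[OF i1])
      show "(\<lambda>x. (x \<bullet> b) * p * (pflux p (\<phi> x) * (G x \<bullet> b))) \<in> borel_measurable M"
        by (intro measurable_continuous continuous_intros C1cD[OF \<phi>] continuous_on_compose2[OF continuous_on_pflux[OF p_gt_1]]) auto
      show "AE x in M. norm ((x \<bullet> b) * p * (pflux p (\<phi> x) * (G x \<bullet> b))) \<le> norm (1 / 2 * norm (\<phi> x) powr p + R * p * C * norm (G x) powr p)"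
        using AE_mem_domain by eventually_elim (use bound in \<open>force intro: order_trans[OF _ abs_ge_self]\<close>)
    qed
    have "(LINT x|M. norm (\<phi> x) powr p) = - (LINT x|M. (x \<bullet> b) * p * (pflux p (\<phi> x) * (G x \<bullet> b)))"
      using 0 Bochner_Integration.integral_add[OF L_p_integrable_powr[OF Lp(1)] i2] by simp
    also have "\<dots> \<le> norm (LINT x|M. (x \<bullet> b) * p * (pflux p (\<phi> x) * (G x \<bullet> b)))" by simp
    also have "\<dots> \<le> (LINT x|M. 1 / 2 * norm (\<phi> x) powr p + R * p * C * norm (G x) powr p)"
      by (rule norm_integral_le_AE[OF i2 i1]) (use AE_mem_domain bound in \<open>auto elim!: eventually_mono\<close>)
    also have "\<dots> = 1 / 2 * (LINT x|M. norm (\<phi> x) powr p) + R * p * C * (LINT x|M. norm (G x) powr p)"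
      using L_p_integrable_powr[OF Lp(1)] L_p_integrable_powr[OF Lp(2)] by simp
    finally show ?thesis by simp
  qed
  moreover have "2 * R * p * C > 0" using R C p_gt_1 by simp
  ultimately show thesis using that by blast
qed

text \<open>By density of test functions; the two factors 2^p come from the two applications of the
  weakened triangle inequality.\<close>

lemma poincare:
  obtains C where "C > 0" "\<And>u U. W0 u U \<Longrightarrow> (LINT x|M. norm (u x) powr p) \<le> C * (LINT x|M. norm (U x) powr p)"
proof -
  obtain C where C: "C > 0" "\<And>\<phi> G. C1c \<phi> G \<Longrightarrow> (LINT x|M. norm (\<phi> x) powr p) \<le> C * (LINT x|M. norm (G x) powr p)"
    using poincare_C1c by blast
  have "(LINT x|M. norm (u x) powr p) \<le> 2 powr p * (0 + C * (2 powr p * (0 + (LINT x|M. norm (U x) powr p))))"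
    if W: "W0 u U" for u U
  proof -
    note Lp = W0_L_p[OF W]
    obtain \<phi> where \<phi>: "\<And>n. C1c (\<phi> n) (grad (\<phi> n))" "Lp_tendsto \<phi> u" "Lp_tendsto (\<lambda>n. grad (\<phi> n)) U"
      using W0E[OF W] by metis
    note \<phi>_Lp = C1c_L_p[OF \<phi>(1)]
    let ?Y = "\<lambda>n. 2 powr p * ((LINT x|M. norm (\<phi> n x - u x) powr p) + C * (2 powr p *
      ((LINT x|M. norm (grad (\<phi> n) x - U x) powr p) + (LINT x|M. norm (U x) powr p))))"
    have le: "(LINT x|M. norm (u x) powr p) \<le> ?Y n" for n
    proof -
      let ?A = "LINT x|M. norm (\<phi> n x - u x) powr p"
      let ?D = "2 powr p * ((LINT x|M. norm (grad (\<phi> n) x - U x) powr p) + (LINT x|M. norm (U x) powr p))"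
      have "(LINT x|M. norm ((grad (\<phi> n) x - U x) + U x) powr p) \<le> ?D"
        by (rule Lp_integral_add_le[OF L_p_diff[OF \<phi>_Lp(2) Lp(2)] Lp(2)])
      then have "C * (LINT x|M. norm (grad (\<phi> n) x) powr p) \<le> C * ?D"
        using C(1) by (intro mult_left_mono) auto
      with C(2)[OF \<phi>(1)[of n]] have 1: "(LINT x|M. norm (\<phi> n x) powr p) \<le> C * ?D" by (rule order_trans)
      have "(LINT x|M. norm ((u x - \<phi> n x) + \<phi> n x) powr p)
          \<le> 2 powr p * ((LINT x|M. norm (u x - \<phi> n x) powr p) + (LINT x|M. norm (\<phi> n x) powr p))"
        by (rule Lp_integral_add_le[OF L_p_diff[OF Lp(1) \<phi>_Lp(1)] \<phi>_Lp(1)])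
      also have "(\<lambda>x. norm ((u x - \<phi> n x) + \<phi> n x) powr p) = (\<lambda>x. norm (u x) powr p)" by simp
      also have "(\<lambda>x. norm (u x - \<phi> n x) powr p) = (\<lambda>x. norm (\<phi> n x - u x) powr p)"
        by (simp only: norm_minus_commute)
      also have "2 powr p * (?A + (LINT x|M. norm (\<phi> n x) powr p)) \<le> 2 powr p * (?A + C * ?D)"
        using 1 by (intro mult_left_mono add_left_mono) auto
      finally show ?thesis .
    qed
    have lim: "?Y \<longlonglongrightarrow> 2 powr p * (0 + C * (2 powr p * (0 + (LINT x|M. norm (U x) powr p))))"
      by (intro tendsto_intros \<phi>(2,3)[unfolded Lp_tendsto_def])
    show ?thesis by (rule LIMSEQ_le_const[OF lim]) (use le in blast)
  qed
  then show thesis using that[of "2 powr p * (C * 2 powr p)"] C(1) by (simp add: mult_ac)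
qed

text \<open>By the Poincare inequality the gradients control the functions, so it is enough that the
  gradients are Cauchy.\<close>

lemma W0_complete:
  assumes W: "\<And>n. W0 (u n) (U n)"
    and cauchy: "\<And>e. e > 0 \<Longrightarrow> \<exists>N. \<forall>m\<ge>N. \<forall>n\<ge>N. (LINT x|M. norm (U m x - U n x) powr p) < e"
  obtains v V where "W0 v V" "Lp_tendsto u v" "Lp_tendsto U V"
proof -
  obtain C where C: "C > 0" "\<And>u U. W0 u U \<Longrightarrow> (LINT x|M. norm (u x) powr p) \<le> C * (LINT x|M. norm (U x) powr p)"
    using poincare by blast
  obtain V where V: "V \<in> L_p p \<Omega>" "Lp_tendsto U V" using Lp_complete[OF W0_L_p(2)[OF W] cauchy] by metis
  have "\<exists>N. \<forall>m\<ge>N. \<forall>n\<ge>N. (LINT x|M. norm (u m x - u n x) powr p) < e" if e: "e > 0" for e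
  proof -
    obtain N where N: "\<forall>m\<ge>N. \<forall>n\<ge>N. (LINT x|M. norm (U m x - U n x) powr p) < e / C"
      using cauchy[of "e / C"] e C(1) by auto
    have "(LINT x|M. norm (u m x - u n x) powr p) < e" if "m \<ge> N" "n \<ge> N" for m n
    proof -
      have "C * (LINT x|M. norm (U m x - U n x) powr p) < e" using N that C(1) by (simp add: field_simps)
      then show ?thesis using C(2)[OF W0_diff[OF W W], of m n] by simp
    qed
    then show ?thesis by blast
  qed
  from Lp_complete[OF W0_L_p(1)[OF W] this]
  obtain v where v: "v \<in> L_p p \<Omega>" "Lp_tendsto u v" by metis
  show thesis by (rule that[OF W0_closed[OF W v(1) V(1) v(2) V(2)] v(2) V(2)])
qed

end

section \<open>The Dirichlet problem with bounded right-hand side\<close>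

context lebesgue_domain
begin

text \<open>Weak form of -\<Delta>_p v = h with zero boundary values. Testing against all of
  W_0^{1,p} allows positive parts, differences of solutions and functions of v to be inserted
  directly.\<close>

definition dirichlet_solution :: "('a \<Rightarrow> real) \<Rightarrow> ('a \<Rightarrow> real) \<Rightarrow> ('a \<Rightarrow> 'a) \<Rightarrow> bool" where
  "dirichlet_solution h v V \<longleftrightarrow> W0 v V \<and>
     (\<forall>\<psi> \<Psi>. W0 \<psi> \<Psi> \<longrightarrow> (LINT x|M. pflux p (V x) \<bullet> \<Psi> x) = (LINT x|M. h x * \<psi> x))"

text \<open>Direct method for J, which is p times the energy. The midpoint of two almost-minimisers
  is a competitor, so \<open>midgap\<close> of their gradients has small integral and the minimising
  sequence is Cauchy. The minimiser then satisfies the equation by one-sided variations.\<close>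

lemma dirichlet_solution_exists:
  assumes h: "h \<in> borel_measurable M" "AE x in M. \<bar>h x\<bar> \<le> B"
  obtains v V where "dirichlet_solution h v V"
proof -
  define J where "J u U = (LINT x|M. norm (U x) powr p) - p * (LINT x|M. h x * u x)"
    for u :: "'a \<Rightarrow> real" and U :: "'a \<Rightarrow> 'a"
  note ih = L_p_integrable_mult_bounded[OF _ h]
  obtain Cp where Cp: "Cp > 0" "\<And>u U. W0 u U \<Longrightarrow> (LINT x|M. norm (u x) powr p) \<le> Cp * (LINT x|M. norm (U x) powr p)"
    using poincare by blast
  define B' where "B' = \<bar>B\<bar> + 1"
  have B': "B' > 0" "AE x in M. \<bar>h x\<bar> \<le> B'"
    using h(2) by (auto simp: B'_def elim!: eventually_mono)
  \<comment> \<open>Chosen so that the linear term, after the Poincare inequality, consumes exactly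
    half of the gradient integral.\<close>
  define \<epsilon> where "\<epsilon> = 1 / (2 * p * B' * Cp)"
  have \<epsilon>: "\<epsilon> > 0" using B'(1) Cp(1) p_gt_1 by (simp add: \<epsilon>_def)
  obtain C where C: "C > 0" "\<And>b. b \<ge> 0 \<Longrightarrow> b \<le> \<epsilon> * b powr p + C"
    using powr_young_const[OF p_gt_1 \<epsilon>] by blast
  define C' where "C' = p * B' * C * measure M \<Omega>"
  have coercive: "J u U \<ge> (LINT x|M. norm (U x) powr p) / 2 - C'" if W: "W0 u U" for u U
  proof -
    note Lp = W0_L_p[OF W]
    have "(LINT x|M. h x * u x) \<le> norm (LINT x|M. h x * u x)" by simp
    also have "\<dots> \<le> (LINT x|M. B' * (\<epsilon> * norm (u x) powr p + C))"
    proof (rule norm_integral_le_AE[OF ih[OF Lp(1)]])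
      show "integrable M (\<lambda>x. B' * (\<epsilon> * norm (u x) powr p + C))"
        by (intro integrable_mult_right Bochner_Integration.integrable_add L_p_integrable_powr Lp
            finite_measure.integrable_const[OF finite_measure_M])
      show "AE x in M. norm (h x * u x) \<le> B' * (\<epsilon> * norm (u x) powr p + C)"
        using B'(2)
      proof eventually_elim
        case (elim x)
        have "\<bar>h x\<bar> * \<bar>u x\<bar> \<le> B' * (\<epsilon> * \<bar>u x\<bar> powr p + C)"
          using elim C(2)[of "\<bar>u x\<bar>"] B'(1) by (intro mult_mono) auto
        then show ?case by (simp add: abs_mult)
      qed
    qed
    also have "\<dots> = B' * (\<epsilon> * (LINT x|M. norm (u x) powr p) + C * measure M \<Omega>)"
      using L_p_integrable_powr[OF Lp(1)] by (simp add: finite_measure.integrable_const[OF finite_measure_M])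
    also have "\<dots> \<le> B' * (\<epsilon> * (Cp * (LINT x|M. norm (U x) powr p)) + C * measure M \<Omega>)"
      using Cp(2)[OF W] \<epsilon> B'(1) by (intro mult_left_mono add_right_mono) auto
    finally have "p * (LINT x|M. h x * u x) \<le> p * (B' * (\<epsilon> * (Cp * (LINT x|M. norm (U x) powr p)) + C * measure M \<Omega>))"
      using p_gt_1 by (intro mult_left_mono) auto
    also have "\<dots> = p * B' * \<epsilon> * Cp * (LINT x|M. norm (U x) powr p) + C'"
      by (simp add: C'_def algebra_simps)
    also have "p * B' * \<epsilon> * Cp = 1 / 2" using B'(1) Cp(1) p_gt_1 by (simp add: \<epsilon>_def)
    finally show ?thesis by (simp add: J_def)
  qed
  define S where "S = {J u U |u U. W0 u U}"
  have nonneg: "(LINT x|M. norm (U x) powr p) \<ge> 0" for U :: "'a \<Rightarrow> 'a"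
    by (intro Bochner_Integration.integral_nonneg) auto
  have bdd: "bdd_below S"
  proof (rule bdd_belowI[of _ "- C'"])
    fix s assume "s \<in> S"
    then obtain u U where uU: "W0 u U" "s = J u U" by (auto simp: S_def)
    show "- C' \<le> s" using coercive[OF uU(1)] nonneg[of U] uU(2) by linarith
  qed
  have "C1c (\<lambda>x. 0) (\<lambda>x. 0)" unfolding C1c_def using GDERIV_const[of 0] by (auto intro!: exI[of _ "{}"])
  then have "S \<noteq> {}" using W0_C1c unfolding S_def by blast
  define m where "m = Inf S"
  have m: "m \<le> J u U" if "W0 u U" for u U
    unfolding m_def by (rule cInf_lower[OF _ bdd]) (use that in \<open>auto simp: S_def\<close>)
  define \<delta> where "\<delta> n = inverse (real (Suc n))" for n
  have \<delta>: "\<delta> n > 0" "\<delta> n \<le> 1" "\<delta> \<longlonglongrightarrow> 0" for n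
    unfolding \<delta>_def using LIMSEQ_inverse_real_of_nat by (auto simp: field_simps)
  have "\<forall>n. \<exists>w. W0 (fst w) (snd w) \<and> J (fst w) (snd w) < m + \<delta> n"
  proof
    fix n
    obtain s where "s \<in> S" "s < m + \<delta> n"
      using cInf_lessD[OF \<open>S \<noteq> {}\<close>, of "m + \<delta> n"] \<delta>(1)[of n] by (auto simp: m_def)
    then show "\<exists>w. W0 (fst w) (snd w) \<and> J (fst w) (snd w) < m + \<delta> n" by (auto simp: S_def)
  qed
  from choice[OF this] obtain w where w: "\<And>n. W0 (fst (w n)) (snd (w n))" "\<And>n. J (fst (w n)) (snd (w n)) < m + \<delta> n" by blast
  define u where "u n = fst (w n)" for n
  define U where "U n = snd (w n)" for n
  have W: "W0 (u n) (U n)" and Jn: "J (u n) (U n) < m + \<delta> n" for n using w by (auto simp: u_def U_def)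
  note Lp = W0_L_p[OF W]
  define K where "K = 2 * (m + 1 + C')"
  have K: "(LINT x|M. norm (U n x) powr p) \<le> K" for n
    using coercive[OF W, of n] Jn[of n] \<delta>(2)[of n] by (simp add: K_def)
  have K0: "K \<ge> 0" using K[of 0] nonneg[of "U 0"] by linarith
  \<comment> \<open>The linear parts cancel in J(u_i) + J(u_j) - 2 J(midpoint), and J is at least m
    at the midpoint.\<close>
  have gap: "(LINT x|M. midgap p (U i x) (U j x)) \<le> \<delta> i + \<delta> j" and igap: "integrable M (\<lambda>x. midgap p (U i x) (U j x))" for i j
  proof -
    have mid: "W0 (\<lambda>x. (1/2) *\<^sub>R (u i x + u j x)) (\<lambda>x. (1/2) *\<^sub>R (U i x + U j x))"
      by (intro W0_scaleR W0_add W)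
    note LpU = W0_L_p[OF mid]
    show "integrable M (\<lambda>x. midgap p (U i x) (U j x))"
      unfolding midgap_def
      by (intro Bochner_Integration.integrable_diff Bochner_Integration.integrable_add integrable_mult_right L_p_integrable_powr Lp LpU)
    have "(LINT x|M. midgap p (U i x) (U j x)) = (LINT x|M. norm (U i x) powr p) + (LINT x|M. norm (U j x) powr p)
        - 2 * (LINT x|M. norm ((1/2) *\<^sub>R (U i x + U j x)) powr p)"
      unfolding midgap_def
      using L_p_integrable_powr[OF Lp(2), of i] L_p_integrable_powr[OF Lp(2), of j] L_p_integrable_powr[OF LpU(2)]
      by (simp del: norm_scaleR)
    moreover have "(LINT x|M. h x * ((1/2) *\<^sub>R (u i x + u j x))) = ((LINT x|M. h x * u i x) + (LINT x|M. h x * u j x)) / 2"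
      using ih[OF Lp(1), of i] ih[OF Lp(1), of j] by (simp add: distrib_left)
    ultimately have "(LINT x|M. midgap p (U i x) (U j x)) = J (u i) (U i) + J (u j) (U j)
        - 2 * J (\<lambda>x. (1/2) *\<^sub>R (u i x + u j x)) (\<lambda>x. (1/2) *\<^sub>R (U i x + U j x))"
      unfolding J_def by (simp add: algebra_simps del: norm_scaleR real_scaleR_def)
    also have "\<dots> \<le> \<delta> i + \<delta> j" using m[OF mid] Jn[of i] Jn[of j] by linarith
    finally show "(LINT x|M. midgap p (U i x) (U j x)) \<le> \<delta> i + \<delta> j" .
  qed
  have "\<exists>N. \<forall>i\<ge>N. \<forall>j\<ge>N. (LINT x|M. norm (U i x - U j x) powr p) < e" if e: "e > 0" for e
  proof -
    define \<eta> where "\<eta> = e / (4 * (K + 1))"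
    have \<eta>: "\<eta> > 0" "\<eta> * K < e / 4" using e K0 by (auto simp: \<eta>_def field_simps)
    obtain D where D: "D > 0" "\<And>a b::'a. norm (a - b) powr p \<le> \<eta> * (norm a powr p + norm b powr p) + D * midgap p a b"
      using norm_diff_powr_le_midgap[OF p_gt_1 \<eta>(1), where 'a='a] by blast
    obtain N where N: "\<And>n. n \<ge> N \<Longrightarrow> \<delta> n < e / (4 * D)"
      using order_tendstoD(2)[OF \<delta>(3), of "e / (4 * D)"] e D(1) by (auto simp: eventually_sequentially)
    have "(LINT x|M. norm (U i x - U j x) powr p) < e" if ij: "i \<ge> N" "j \<ge> N" for i j
    proof -
      have "(LINT x|M. norm (U i x - U j x) powr p)
         \<le> (LINT x|M. \<eta> * (norm (U i x) powr p + norm (U j x) powr p) + D * midgap p (U i x) (U j x))"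
        using D(2) by (intro integral_mono Bochner_Integration.integrable_add integrable_mult_right L_p_integrable_powr L_p_diff Lp igap) auto
      also have "\<dots> = \<eta> * ((LINT x|M. norm (U i x) powr p) + (LINT x|M. norm (U j x) powr p)) + D * (LINT x|M. midgap p (U i x) (U j x))"
        using L_p_integrable_powr[OF Lp(2), of i] L_p_integrable_powr[OF Lp(2), of j] igap[of i j] by simp
      also have "\<dots> \<le> \<eta> * (K + K) + D * (\<delta> i + \<delta> j)"
        using K[of i] K[of j] gap[of i j] \<eta>(1) D(1) by (intro add_mono mult_left_mono) auto
      also have "\<dots> < e"
        using N[OF ij(1)] N[OF ij(2)] \<eta>(2) D(1) by (simp add: field_simps)
      finally show ?thesis .
    qed
    then show ?thesis by blast
  qed
  from W0_complete[OF W this] obtain v V where v: "W0 v V" "Lp_tendsto u v" "Lp_tendsto U V" by metis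
  note vLp = W0_L_p[OF v(1)]
  \<comment> \<open>Lower semicontinuity from the tangent inequality at V: its linear correction
    tends to zero along the sequence.\<close>
  have "J v V \<le> m"
  proof -
    have 1: "(\<lambda>n. LINT x|M. h x * u n x) \<longlonglongrightarrow> (LINT x|M. h x * v x)"
      by (rule Lp_tendsto_integral_mult[OF Lp(1) vLp(1) v(2) h])
    have 2: "(\<lambda>n. LINT x|M. pflux p (V x) \<bullet> U n x) \<longlonglongrightarrow> (LINT x|M. pflux p (V x) \<bullet> V x)"
      by (rule Lp_tendsto_pflux_fixed[OF vLp(2) Lp(2) vLp(2) v(3)])
    have "J v V + p * ((LINT x|M. pflux p (V x) \<bullet> U n x) - (LINT x|M. pflux p (V x) \<bullet> V x))
        - p * ((LINT x|M. h x * u n x) - (LINT x|M. h x * v x)) \<le> m + \<delta> n" for n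
    proof -
      have "(LINT x|M. norm (V x) powr p + p * (pflux p (V x) \<bullet> (U n x - V x))) \<le> (LINT x|M. norm (U n x) powr p)"
        using norm_powr_subgradient[OF p_gt_1]
        by (intro integral_mono Bochner_Integration.integrable_add integrable_mult_right L_p_integrable_powr pflux_integrable L_p_diff Lp vLp) auto
      moreover have "(LINT x|M. norm (V x) powr p + p * (pflux p (V x) \<bullet> (U n x - V x))) = (LINT x|M. norm (V x) powr p)
          + p * ((LINT x|M. pflux p (V x) \<bullet> U n x) - (LINT x|M. pflux p (V x) \<bullet> V x))"
        using L_p_integrable_powr[OF vLp(2)] pflux_integrable[OF vLp(2) Lp(2), of n] pflux_integrable[OF vLp(2) vLp(2)]
        by (simp add: inner_diff_right)
      ultimately show ?thesis using Jn[of n] unfolding J_def by (simp add: algebra_simps)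
    qed
    moreover have "(\<lambda>n. J v V + p * ((LINT x|M. pflux p (V x) \<bullet> U n x) - (LINT x|M. pflux p (V x) \<bullet> V x))
        - p * ((LINT x|M. h x * u n x) - (LINT x|M. h x * v x))) \<longlonglongrightarrow> J v V
        + p * ((LINT x|M. pflux p (V x) \<bullet> V x) - (LINT x|M. pflux p (V x) \<bullet> V x))
        - p * ((LINT x|M. h x * v x) - (LINT x|M. h x * v x))"
      by (intro tendsto_intros 1 2)
    moreover have "(\<lambda>n. m + \<delta> n) \<longlonglongrightarrow> m + 0" by (intro tendsto_intros \<delta>(3))
    ultimately show ?thesis using LIMSEQ_le by fastforce
  qed
  then have min: "J v V \<le> J z Z" if "W0 z Z" for z Z using m[OF that] by simp
  \<comment> \<open>The subgradient inequality is taken at the perturbed gradient \<open>T n\<close>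
    rather than at V, so minimality gives an inequality after division by p \<delta>_n; continuity
    of the flux then moves it to V.\<close>
  have le: "(LINT x|M. h x * \<psi> x) \<le> (LINT x|M. pflux p (V x) \<bullet> \<Psi> x)" if \<psi>: "W0 \<psi> \<Psi>" for \<psi> \<Psi>
  proof -
    note \<psi>Lp = W0_L_p[OF \<psi>]
    define T where "T n x = V x + \<delta> n *\<^sub>R \<Psi> x" for n x
    have Wn: "W0 (\<lambda>x. v x + \<delta> n *\<^sub>R \<psi> x) (T n)" for n
      unfolding T_def[abs_def] by (intro W0_add W0_scaleR v(1) \<psi>)
    note TLp = W0_L_p(2)[OF Wn]
    have "Lp_tendsto T V"
    proof (rule Lp_tendsto_le[OF TLp vLp(2)])
      have "(\<lambda>n. \<delta> n powr p) \<longlonglongrightarrow> 0 powr p"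
        by (rule tendsto_powr') (use \<delta> p_gt_1 in \<open>auto intro!: always_eventually less_imp_le\<close>)
      then show "(\<lambda>n. \<delta> n powr p * (LINT x|M. norm (\<Psi> x) powr p)) \<longlonglongrightarrow> 0" by (auto intro!: tendsto_mult_left_zero)
      show "(LINT x|M. norm (T n x - V x) powr p) \<le> \<delta> n powr p * (LINT x|M. norm (\<Psi> x) powr p)" for n
        using \<delta>(1)[of n] by (simp add: T_def powr_mult)
    qed
    from Lp_tendsto_pflux[OF TLp vLp(2) this \<psi>Lp(2)]
    have lim: "(\<lambda>n. LINT x|M. pflux p (T n x) \<bullet> \<Psi> x) \<longlonglongrightarrow> (LINT x|M. pflux p (V x) \<bullet> \<Psi> x)" .
    have "(LINT x|M. h x * \<psi> x) \<le> (LINT x|M. pflux p (T n x) \<bullet> \<Psi> x)" for n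
    proof -
      have "(LINT x|M. norm (T n x) powr p + p * (pflux p (T n x) \<bullet> (V x - T n x))) \<le> (LINT x|M. norm (V x) powr p)"
        using norm_powr_subgradient[OF p_gt_1]
        by (intro integral_mono Bochner_Integration.integrable_add integrable_mult_right L_p_integrable_powr pflux_integrable L_p_diff TLp vLp) auto
      moreover have "(\<lambda>x. norm (T n x) powr p + p * (pflux p (T n x) \<bullet> (V x - T n x)))
          = (\<lambda>x. norm (T n x) powr p - p * \<delta> n * (pflux p (T n x) \<bullet> \<Psi> x))"
        by (auto simp: T_def)
      moreover have "(LINT x|M. norm (T n x) powr p - p * \<delta> n * (pflux p (T n x) \<bullet> \<Psi> x))
          = (LINT x|M. norm (T n x) powr p) - p * \<delta> n * (LINT x|M. pflux p (T n x) \<bullet> \<Psi> x)"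
        using L_p_integrable_powr[OF TLp] pflux_integrable[OF TLp \<psi>Lp(2)] by simp
      ultimately have 1: "(LINT x|M. norm (T n x) powr p) - p * \<delta> n * (LINT x|M. pflux p (T n x) \<bullet> \<Psi> x) \<le> (LINT x|M. norm (V x) powr p)"
        by simp
      have "(LINT x|M. h x * (v x + \<delta> n *\<^sub>R \<psi> x)) = (LINT x|M. h x * v x) + \<delta> n * (LINT x|M. h x * \<psi> x)"
        using ih[OF vLp(1)] ih[OF \<psi>Lp(1)] by (simp add: distrib_left mult.left_commute)
      with min[OF Wn, of n] 1 have "p * \<delta> n * (LINT x|M. h x * \<psi> x) \<le> p * \<delta> n * (LINT x|M. pflux p (T n x) \<bullet> \<Psi> x)"
        unfolding J_def by (simp add: algebra_simps)
      then show ?thesis using p_gt_1 \<delta>(1)[of n] by simp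
    qed
    with lim show ?thesis by (intro LIMSEQ_le_const) auto
  qed
  have "dirichlet_solution h v V"
    unfolding dirichlet_solution_def
  proof (intro conjI allI impI v(1))
    fix \<psi> \<Psi> assume \<psi>: "W0 \<psi> \<Psi>"
    \<comment> \<open>The opposite inequality is the same one for -\<psi>.\<close>
    from le[OF W0_scaleR[OF this, of "-1"]]
    show "(LINT x|M. pflux p (V x) \<bullet> \<Psi> x) = (LINT x|M. h x * \<psi> x)"
      using le[OF \<psi>] by simp
  qed
  then show thesis by (rule that)
qed

end

section \<open>Comparison and stability\<close>

lemma DERIV_pos_part_powr:
  fixes a t :: real
  assumes a: "a > 1"
  shows "DERIV (\<lambda>t. max 0 t powr a) t :> a * max 0 t powr (a - 1)"
proof -
  consider "t > 0" | "t < 0" | "t = 0" by linarith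
  then show ?thesis
  proof cases
    case 1
    have "DERIV (\<lambda>t. t powr a) t :> a * max 0 t powr (a - 1)"
      using 1 by (auto intro!: derivative_eq_intros)
    then show ?thesis
      by (rule has_field_derivative_transform_within_open[where S="{0<..}"]) (use 1 in auto)
  next
    case 2
    have "DERIV (\<lambda>t. 0) t :> a * max 0 t powr (a - 1)" using 2 by simp
    then show ?thesis
      by (rule has_field_derivative_transform_within_open[where S="{..<0}"]) (use 2 in auto)
  next
    case 3
    have "((\<lambda>h. max 0 h powr a / h) \<longlongrightarrow> 0) (at 0)"
    proof (rule Lim_null_comparison)
      have "((\<lambda>h. \<bar>h\<bar> powr (a - 1)) \<longlongrightarrow> 0 powr (a - 1)) (at 0)"
        by (rule tendsto_powr') (use a in \<open>auto intro!: tendsto_eq_intros\<close>)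
      then show "((\<lambda>h. \<bar>h\<bar> powr (a - 1)) \<longlongrightarrow> 0) (at 0)" by simp
      have "norm (max 0 h powr a / h) \<le> \<bar>h\<bar> powr (a - 1)" for h
      proof (cases "h > 0")
        case True
        then show ?thesis by (simp add: powr_diff)
      next
        case False
        then have "max 0 h = 0" by simp
        then show ?thesis by simp
      qed
      then show "\<forall>\<^sub>F h in at 0. norm (max 0 h powr a / h) \<le> \<bar>h\<bar> powr (a - 1)" by simp
    qed
    then show ?thesis using 3 by (simp add: DERIV_def)
  qed
qed

lemma continuous_pos_part_powr: "a > 0 \<Longrightarrow> continuous_on UNIV (\<lambda>t::real. max 0 t powr a)"
  by (intro continuous_on_powr' continuous_intros) auto

text \<open>A C^1 version of the positive part that is exactly 0 for t \<le> 0, as preservation of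
  the boundary values requires. The square is written as \<open>powr 2\<close> so that the
  derivative rule for powers of positive parts applies to it.\<close>

definition soft_pos :: "real \<Rightarrow> real \<Rightarrow> real" where
  "soft_pos \<epsilon> t = sqrt (max 0 t powr 2 + \<epsilon>\<^sup>2) - \<epsilon>"

definition soft_pos' :: "real \<Rightarrow> real \<Rightarrow> real" where
  "soft_pos' \<epsilon> t = max 0 t / sqrt (max 0 t powr 2 + \<epsilon>\<^sup>2)"

lemma soft_pos_radicand: "\<epsilon> > 0 \<Longrightarrow> max 0 t powr 2 + \<epsilon>\<^sup>2 > 0" for t \<epsilon> :: real
  by (simp add: add_nonneg_pos)

lemma DERIV_soft_pos:
  assumes "\<epsilon> > 0" shows "DERIV (soft_pos \<epsilon>) t :> soft_pos' \<epsilon> t"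
proof -
  have "DERIV (\<lambda>t. max 0 t powr 2 + \<epsilon>\<^sup>2) t :> 2 * max 0 t powr (2 - 1) + 0"
    by (intro DERIV_add DERIV_pos_part_powr DERIV_const) simp
  from DERIV_diff[OF DERIV_chain2[OF DERIV_real_sqrt[OF soft_pos_radicand[OF assms]] this] DERIV_const[of \<epsilon>]]
  show ?thesis
    unfolding soft_pos_def[abs_def] soft_pos'_def by (rule DERIV_cong) (simp add: field_simps)
qed

lemma continuous_soft_pos': "\<epsilon> > 0 \<Longrightarrow> continuous_on UNIV (soft_pos' \<epsilon>)"
  unfolding soft_pos'_def[abs_def]
  by (intro continuous_intros continuous_pos_part_powr ballI) (use soft_pos_radicand in \<open>force+\<close>)

lemma soft_pos_nonpos: "\<epsilon> > 0 \<Longrightarrow> t \<le> 0 \<Longrightarrow> soft_pos \<epsilon> t = 0"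
  by (simp add: soft_pos_def max_def)

lemma soft_pos_bounds:
  assumes "\<epsilon> > 0"
  shows "\<bar>soft_pos \<epsilon> t\<bar> \<le> \<bar>t\<bar>" "\<bar>soft_pos' \<epsilon> t\<bar> \<le> 1"
proof -
  define s where "s = max 0 t"
  have s: "s \<ge> 0" "s \<le> \<bar>t\<bar>" "s powr 2 = s\<^sup>2" by (auto simp: s_def powr_numeral)
  have "sqrt (s\<^sup>2 + \<epsilon>\<^sup>2) \<le> s + \<epsilon>" using assms s by (intro real_le_lsqrt) (auto simp: power2_sum)
  moreover have "sqrt (s\<^sup>2 + \<epsilon>\<^sup>2) \<ge> \<epsilon>" using assms by (intro real_le_rsqrt) auto
  ultimately show "\<bar>soft_pos \<epsilon> t\<bar> \<le> \<bar>t\<bar>" using s by (simp add: soft_pos_def flip: s_def)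
  have "sqrt (s\<^sup>2 + \<epsilon>\<^sup>2) \<ge> s" using assms by (intro real_le_rsqrt) auto
  moreover have "s\<^sup>2 + \<epsilon>\<^sup>2 > 0" using assms by (simp add: add_nonneg_pos)
  ultimately show "\<bar>soft_pos' \<epsilon> t\<bar> \<le> 1" using s by (simp add: soft_pos'_def flip: s_def)
qed

lemma soft_pos_tendsto:
  assumes "\<delta> \<longlonglongrightarrow> 0" "\<And>n. \<delta> n > 0"
  shows "(\<lambda>n. soft_pos (\<delta> n) t) \<longlonglongrightarrow> max 0 t" "(\<lambda>n. soft_pos' (\<delta> n) t) \<longlonglongrightarrow> (if t > 0 then 1 else 0)"
proof -
  define s where "s = max 0 t"
  have s: "s \<ge> 0" "s powr 2 = s\<^sup>2" by (auto simp: s_def powr_numeral)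
  have 1: "(\<lambda>n. sqrt (s\<^sup>2 + (\<delta> n)\<^sup>2)) \<longlonglongrightarrow> sqrt (s\<^sup>2 + 0\<^sup>2)" by (intro tendsto_intros assms)
  then have "(\<lambda>n. sqrt (s\<^sup>2 + (\<delta> n)\<^sup>2) - \<delta> n) \<longlonglongrightarrow> sqrt (s\<^sup>2 + 0\<^sup>2) - 0" by (intro tendsto_intros assms)
  then show "(\<lambda>n. soft_pos (\<delta> n) t) \<longlonglongrightarrow> max 0 t" using s by (simp add: soft_pos_def flip: s_def)
  show "(\<lambda>n. soft_pos' (\<delta> n) t) \<longlonglongrightarrow> (if t > 0 then 1 else 0)"
  proof (cases "t > 0")
    case True
    then have "s > 0" by (simp add: s_def)
    then have "(\<lambda>n. s / sqrt (s\<^sup>2 + (\<delta> n)\<^sup>2)) \<longlonglongrightarrow> s / sqrt (s\<^sup>2 + 0\<^sup>2)" by (intro tendsto_divide[OF tendsto_const 1]) auto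
    then show ?thesis using True s \<open>s > 0\<close> by (simp add: soft_pos'_def flip: s_def)
  qed (simp add: soft_pos'_def max_def)
qed

context lebesgue_domain
begin

lemma continuous_bounded_on_domain:
  fixes f :: "'a \<Rightarrow> 'b::real_normed_vector"
  assumes "continuous_on UNIV f"
  obtains B where "B \<ge> 0" "\<And>x. x \<in> \<Omega> \<Longrightarrow> norm (f x) \<le> B"
proof -
  have "bounded (f ` closure \<Omega>)"
    by (intro compact_imp_bounded compact_continuous_image continuous_on_subset[OF assms])
      (use bounded_domain in \<open>auto simp: compact_closure\<close>)
  then obtain B where "B > 0" "\<And>y. y \<in> f ` closure \<Omega> \<Longrightarrow> norm y \<le> B" unfolding bounded_pos by blast
  then show thesis using that[of B] closure_subset[of \<Omega>] by (meson image_eqI less_imp_le subsetD)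
qed

lemma L_p_continuous:
  fixes f :: "'a \<Rightarrow> 'b::euclidean_space"
  assumes "continuous_on UNIV f" shows "f \<in> L_p p \<Omega>"
proof -
  obtain B where "\<And>x. x \<in> \<Omega> \<Longrightarrow> norm (f x) \<le> B" using continuous_bounded_on_domain[OF assms] by metis
  then show ?thesis
    by (intro L_p_bounded[OF measurable_continuous[OF assms]]) (use AE_mem_domain in \<open>auto elim!: eventually_mono\<close>)
qed

text \<open>The difference u - \<zeta> need not vanish on the boundary, but \<zeta> \<ge> 0 makes
  its positive part vanish where u = 0, so composition with \<open>soft_pos\<close> stays in the
  space. Dominated convergence removes the regularisation; since \<open>soft_pos'\<close> is 0 at 0,
  the limit gradient is 0 on u = \<zeta>.\<close>

lemma W0_pos_part:
  assumes W: "W0 u U" and \<zeta>: "\<And>x. GDERIV \<zeta> x :> Z x" "continuous_on UNIV Z" "\<And>x. x \<in> \<Omega> \<Longrightarrow> \<zeta> x \<ge> 0"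
  shows "W0 (\<lambda>x. max 0 (u x - \<zeta> x)) (\<lambda>x. if u x - \<zeta> x > 0 then U x - Z x else 0)"
proof -
  have c\<zeta>: "continuous_on UNIV \<zeta>"
    using \<zeta>(1) by (auto simp: gderiv_def intro!: continuous_at_imp_continuous_on has_derivative_continuous)
  obtain B where B: "B \<ge> 0" "\<And>x. x \<in> \<Omega> \<Longrightarrow> norm (Z x) \<le> B"
    using continuous_bounded_on_domain[OF \<zeta>(2)] by metis
  have soft: "W0 (\<lambda>x. soft_pos \<epsilon> (u x - \<zeta> x)) (\<lambda>x. soft_pos' \<epsilon> (u x - \<zeta> x) *\<^sub>R (U x - Z x))"
    if \<epsilon>: "\<epsilon> > 0" for \<epsilon>
  proof -
    have "W0 (\<lambda>x. soft_pos \<epsilon> (u x - \<zeta> x))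
      (\<lambda>x. - (soft_pos' \<epsilon> (u x - \<zeta> x) *\<^sub>R Z x) + soft_pos' \<epsilon> (u x - \<zeta> x) *\<^sub>R U x)"
    proof (rule W0_compose[where B="\<lambda>x t. soft_pos \<epsilon> (t - \<zeta> x)" and Bx="\<lambda>x t. - (soft_pos' \<epsilon> (t - \<zeta> x) *\<^sub>R Z x)"
          and Bt="\<lambda>x t. soft_pos' \<epsilon> (t - \<zeta> x)" and K="max 1 B", OF W])
      fix x :: 'a and t :: real
      have "((\<lambda>z. \<zeta> (fst z)) has_derivative (\<lambda>z. fst z \<bullet> Z x)) (at (x, t))"
      proof -
        have "((\<lambda>z. fst z) has_derivative (\<lambda>z. fst z)) (at (x, t))"
          by (intro has_derivative_fst has_derivative_ident)
        from has_derivative_compose[OF this, of \<zeta> "\<lambda>h. h \<bullet> Z x"] \<zeta>(1)[of x]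
        show ?thesis by (simp add: gderiv_def)
      qed
      then have "((\<lambda>z. snd z - \<zeta> (fst z)) has_derivative (\<lambda>z. snd z - fst z \<bullet> Z x)) (at (x, t))"
        by (intro has_derivative_diff has_derivative_snd has_derivative_ident)
      from has_derivative_compose[OF this] DERIV_soft_pos[OF \<epsilon>, of "t - \<zeta> x"]
      have "((\<lambda>z. soft_pos \<epsilon> (snd z - \<zeta> (fst z))) has_derivative
          (\<lambda>z. soft_pos' \<epsilon> (t - \<zeta> x) * (snd z - fst z \<bullet> Z x))) (at (x, t))"
        by (simp add: has_field_derivative_def)
      then show "((\<lambda>z. soft_pos \<epsilon> (snd z - \<zeta> (fst z))) has_derivative
          (\<lambda>z. fst z \<bullet> - (soft_pos' \<epsilon> (t - \<zeta> x) *\<^sub>R Z x) + snd z * soft_pos' \<epsilon> (t - \<zeta> x))) (at (x, t))"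
        by (simp add: algebra_simps)
    next
      have c: "continuous_on UNIV (\<lambda>z. soft_pos' \<epsilon> (snd z - \<zeta> (fst z)))"
        by (rule continuous_on_compose2[OF continuous_soft_pos'[OF \<epsilon>]])
          (auto intro!: continuous_intros continuous_on_compose2[OF c\<zeta>])
      then show "continuous_on UNIV (\<lambda>z. soft_pos' \<epsilon> (snd z - \<zeta> (fst z)))" .
      show "continuous_on UNIV (\<lambda>z. - (soft_pos' \<epsilon> (snd z - \<zeta> (fst z)) *\<^sub>R Z (fst z)))"
        by (intro continuous_intros c continuous_on_compose2[OF \<zeta>(2)]) auto
    next
      fix x assume x: "x \<in> \<Omega>"
      show "soft_pos \<epsilon> (0 - \<zeta> x) = 0" using soft_pos_nonpos[OF \<epsilon>, of "0 - \<zeta> x"] \<zeta>(3)[OF x] by simp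
      fix t
      show "\<bar>soft_pos' \<epsilon> (t - \<zeta> x)\<bar> \<le> max 1 B" using soft_pos_bounds(2)[OF \<epsilon>, of "t - \<zeta> x"] by simp
      have "\<bar>soft_pos' \<epsilon> (t - \<zeta> x)\<bar> * norm (Z x) \<le> 1 * B"
        by (intro mult_mono soft_pos_bounds(2)[OF \<epsilon>] B x) auto
      then show "norm (- (soft_pos' \<epsilon> (t - \<zeta> x) *\<^sub>R Z x)) \<le> max 1 B" by simp
    qed
    then show ?thesis by (simp add: algebra_simps)
  qed
  define \<delta> where "\<delta> n = inverse (real (Suc n))" for n
  have \<delta>: "\<delta> n > 0" "\<delta> \<longlonglongrightarrow> 0" for n unfolding \<delta>_def using LIMSEQ_inverse_real_of_nat by auto
  have d1: "(\<lambda>x. u x - \<zeta> x) \<in> L_p p \<Omega>" by (intro L_p_diff W0_L_p(1)[OF W] L_p_continuous c\<zeta>)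
  have d2: "(\<lambda>x. U x - Z x) \<in> L_p p \<Omega>" by (intro L_p_diff W0_L_p(2)[OF W] L_p_continuous \<zeta>(2))
  note [measurable] = L_p_measurable[OF d1] L_p_measurable[OF d2] L_p_measurable[OF W0_L_p(1)[OF W]]
    L_p_measurable[OF W0_L_p(2)[OF W]] measurable_continuous[OF c\<zeta>] measurable_continuous[OF \<zeta>(2)]
  have m1: "(\<lambda>x. max 0 (u x - \<zeta> x)) \<in> L_p p \<Omega>" by (rule L_p_dominated[OF _ d1]) auto
  have m2: "(\<lambda>x. if u x - \<zeta> x > 0 then U x - Z x else 0) \<in> L_p p \<Omega>"
  proof (rule L_p_dominated[OF _ d2])
    show "(\<lambda>x. if u x - \<zeta> x > 0 then U x - Z x else 0) \<in> borel_measurable M" by measurable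
  qed auto
  show ?thesis
  proof (rule W0_closed[OF soft[OF \<delta>(1)] m1 m2])
    show "Lp_tendsto (\<lambda>n x. soft_pos (\<delta> n) (u x - \<zeta> x)) (\<lambda>x. max 0 (u x - \<zeta> x))"
      using soft_pos_bounds(1)[OF \<delta>(1)] soft_pos_tendsto(1)[OF \<delta>(2,1)]
      by (intro Lp_tendsto_dominated[OF L_p_measurable[OF W0_L_p(1)[OF soft[OF \<delta>(1)]]] m1 d1]) auto
    show "Lp_tendsto (\<lambda>n x. soft_pos' (\<delta> n) (u x - \<zeta> x) *\<^sub>R (U x - Z x)) (\<lambda>x. if u x - \<zeta> x > 0 then U x - Z x else 0)"
    proof (rule Lp_tendsto_dominated[OF L_p_measurable[OF W0_L_p(2)[OF soft[OF \<delta>(1)]]] m2 d2])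
      show "AE x in M. norm (soft_pos' (\<delta> n) (u x - \<zeta> x) *\<^sub>R (U x - Z x)) \<le> norm (U x - Z x)" for n
        using soft_pos_bounds(2)[OF \<delta>(1)[of n]] by (auto intro!: mult_left_le_one_le)
      show "AE x in M. (\<lambda>n. soft_pos' (\<delta> n) (u x - \<zeta> x) *\<^sub>R (U x - Z x)) \<longlonglongrightarrow> (if u x - \<zeta> x > 0 then U x - Z x else 0)"
      proof (rule AE_I2)
        fix x
        have "(\<lambda>n. soft_pos' (\<delta> n) (u x - \<zeta> x) *\<^sub>R (U x - Z x)) \<longlonglongrightarrow> (if u x - \<zeta> x > 0 then 1 else 0) *\<^sub>R (U x - Z x)"
          by (intro tendsto_intros soft_pos_tendsto(2)[OF \<delta>(2,1)])
        then show "(\<lambda>n. soft_pos' (\<delta> n) (u x - \<zeta> x) *\<^sub>R (U x - Z x)) \<longlonglongrightarrow> (if u x - \<zeta> x > 0 then U x - Z x else 0)"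
          by (cases "u x - \<zeta> x > 0") auto
      qed
    qed
  qed
qed

text \<open>Monotonicity makes the difference of the two flux pairings a nonnegative integrand, so
  \<open>le\<close> forces it to vanish; positivity of \<open>midgap\<close> then makes the gradient
  of the positive part zero, and Poincare the positive part itself. With d abstract,
  \<open>U2\<close> may belong to a function that does not vanish on the boundary.\<close>

lemma comparison_core:
  assumes U1: "U1 \<in> L_p p \<Omega>" and U2: "U2 \<in> L_p p \<Omega>"
    and W: "W0 (\<lambda>x. max 0 (d x)) (\<lambda>x. if d x > 0 then U1 x - U2 x else 0)" 
    and le: "(LINT x|M. pflux p (U1 x) \<bullet> (if d x > 0 then U1 x - U2 x else 0))
      \<le> (LINT x|M. pflux p (U2 x) \<bullet> (if d x > 0 then U1 x - U2 x else 0))"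
  shows "AE x in M. d x \<le> 0"
proof -
  let ?\<psi> = "\<lambda>x. max 0 (d x)" and ?\<Psi> = "\<lambda>x. if d x > 0 then U1 x - U2 x else 0"
  note Lp = W0_L_p[OF W]
  note i1 = pflux_integrable[OF U1 Lp(2)] and i2 = pflux_integrable[OF U2 Lp(2)]
  let ?D = "\<lambda>x. pflux p (U1 x) \<bullet> ?\<Psi> x - pflux p (U2 x) \<bullet> ?\<Psi> x"
  have D: "?D x = (if d x > 0 then (pflux p (U1 x) - pflux p (U2 x)) \<bullet> (U1 x - U2 x) else 0)" for x
    by (simp add: inner_diff_left)
  have nn: "?D x \<ge> 0" for x unfolding D by (simp add: pflux_mono[OF p_gt_1])
  have "(LINT x|M. ?D x) \<le> 0" using le Bochner_Integration.integral_diff[OF i1 i2] by simp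
  moreover have "(LINT x|M. ?D x) \<ge> 0" using nn by (intro Bochner_Integration.integral_nonneg)
  ultimately have "(LINT x|M. ?D x) = 0" by linarith
  then have "AE x in M. ?D x = 0"
    using integral_nonneg_eq_0_iff_AE[OF Bochner_Integration.integrable_diff[OF i1 i2]] nn by blast
  then have "AE x in M. ?\<Psi> x = 0"
  proof eventually_elim
    case (elim x)
    show ?case
    proof (rule ccontr)
      assume ne: "?\<Psi> x \<noteq> 0"
      then have d: "d x > 0" "U1 x \<noteq> U2 x" by (auto split: if_splits)
      have "midgap p (U1 x) (U2 x) \<le> p / 2 * ((pflux p (U1 x) - pflux p (U2 x)) \<bullet> (U1 x - U2 x))"
        by (rule midgap_le_pflux_mono[OF p_gt_1])
      also have "\<dots> = 0" using elim D[of x] d(1) by simp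
      finally show False using midgap_pos[OF p_gt_1 d(2)] by simp
    qed
  qed
  then have "(LINT x|M. norm (?\<Psi> x) powr p) = (LINT x|M. 0)"
    by (intro integral_cong_AE) (use L_p_measurable[OF Lp(2)] in \<open>auto elim!: eventually_mono\<close>)
  moreover obtain C where "\<And>u U. W0 u U \<Longrightarrow> (LINT x|M. norm (u x) powr p) \<le> C * (LINT x|M. norm (U x) powr p)"
    using poincare by metis
  ultimately have "(LINT x|M. norm (?\<psi> x) powr p) \<le> 0" using W by fastforce
  moreover have "(LINT x|M. norm (?\<psi> x) powr p) \<ge> 0" by (intro Bochner_Integration.integral_nonneg) auto
  ultimately have "(LINT x|M. norm (?\<psi> x) powr p) = 0" by linarith
  then have "AE x in M. norm (?\<psi> x) powr p = 0"
    using integral_nonneg_eq_0_iff_AE[OF L_p_integrable_powr[OF Lp(1)]] by simp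
  then show ?thesis by eventually_elim (auto split: if_splits simp: max_def)
qed

text \<open>Both equations are tested with the positive part of v - \<zeta>, which has zero boundary
  values because \<zeta> is nonnegative. The barrier is thus compared with v without belonging to
  W_0^{1,p}.\<close>

lemma dirichlet_le_supersolution:
  assumes v: "dirichlet_solution h v V" and h: "h \<in> borel_measurable M" "AE x in M. \<bar>h x\<bar> \<le> B"
    and \<zeta>: "\<And>x. GDERIV \<zeta> x :> Z x" "continuous_on UNIV Z" "\<And>x. x \<in> \<Omega> \<Longrightarrow> \<zeta> x \<ge> 0"
    and k: "k \<in> borel_measurable M" "AE x in M. \<bar>k x\<bar> \<le> B'"
    and eq: "\<And>\<psi> \<Psi>. W0 \<psi> \<Psi> \<Longrightarrow> (LINT x|M. pflux p (Z x) \<bullet> \<Psi> x) = (LINT x|M. k x * \<psi> x)"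
    and le: "AE x in M. h x \<le> k x"
  shows "AE x in M. v x \<le> \<zeta> x"
proof -
  have Wv: "W0 v V" using v by (simp add: dirichlet_solution_def)
  note P = W0_pos_part[OF Wv \<zeta>]
  have "AE x in M. v x - \<zeta> x \<le> 0"
  proof (rule comparison_core[OF W0_L_p(2)[OF Wv] L_p_continuous[OF \<zeta>(2)] P])
    have "(LINT x|M. h x * max 0 (v x - \<zeta> x)) \<le> (LINT x|M. k x * max 0 (v x - \<zeta> x))"
    proof (rule integral_mono_AE)
      show "AE x in M. h x * max 0 (v x - \<zeta> x) \<le> k x * max 0 (v x - \<zeta> x)"
        using le by eventually_elim (auto intro!: mult_right_mono)
      show "integrable M (\<lambda>x. h x * max 0 (v x - \<zeta> x))"
        by (rule L_p_integrable_mult_bounded[OF W0_L_p(1)[OF P] h])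
      show "integrable M (\<lambda>x. k x * max 0 (v x - \<zeta> x))"
        by (rule L_p_integrable_mult_bounded[OF W0_L_p(1)[OF P] k])
    qed
    then show "(LINT x|M. pflux p (V x) \<bullet> (if v x - \<zeta> x > 0 then V x - Z x else 0))
        \<le> (LINT x|M. pflux p (Z x) \<bullet> (if v x - \<zeta> x > 0 then V x - Z x else 0))"
      using v P eq[OF P] unfolding dirichlet_solution_def by simp
  qed
  then show ?thesis by eventually_elim simp
qed

lemma dirichlet_solution_mono:
  assumes v: "dirichlet_solution h v V" and h: "h \<in> borel_measurable M" "AE x in M. \<bar>h x\<bar> \<le> B"
    and w: "dirichlet_solution k w W" and k: "k \<in> borel_measurable M" "AE x in M. \<bar>k x\<bar> \<le> B'"
    and le: "AE x in M. h x \<le> k x"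
  shows "AE x in M. v x \<le> w x"
proof -
  have WW: "W0 v V" "W0 w W" using v w by (auto simp: dirichlet_solution_def)
  \<comment> \<open>Both functions vanish on the boundary here, so the barrier 0 applied to their
    difference gives the test function.\<close>
  note P = W0_pos_part[OF W0_diff[OF WW], of "\<lambda>x. 0" "\<lambda>x. 0", simplified diff_zero, OF GDERIV_const continuous_on_const order_refl]
  have "AE x in M. v x - w x \<le> 0"
  proof (rule comparison_core[OF W0_L_p(2)[OF WW(1)] W0_L_p(2)[OF WW(2)] P])
    have "(LINT x|M. h x * max 0 (v x - w x)) \<le> (LINT x|M. k x * max 0 (v x - w x))"
    proof (rule integral_mono_AE)
      show "AE x in M. h x * max 0 (v x - w x) \<le> k x * max 0 (v x - w x)"
        using le by eventually_elim (auto intro!: mult_right_mono)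
      show "integrable M (\<lambda>x. h x * max 0 (v x - w x))"
        by (rule L_p_integrable_mult_bounded[OF W0_L_p(1)[OF P] h])
      show "integrable M (\<lambda>x. k x * max 0 (v x - w x))"
        by (rule L_p_integrable_mult_bounded[OF W0_L_p(1)[OF P] k])
    qed
    then show "(LINT x|M. pflux p (V x) \<bullet> (if v x - w x > 0 then V x - W x else 0))
        \<le> (LINT x|M. pflux p (W x) \<bullet> (if v x - w x > 0 then V x - W x else 0))"
      using v w P unfolding dirichlet_solution_def by simp
  qed
  then show ?thesis by eventually_elim simp
qed

text \<open>Bounded right-hand sides and convergence of the solutions in L^1 already give strong
  convergence of the gradients: subtracting two equations and testing with the difference of the
  solutions bounds the monotonicity integral by a multiple of their L^1 distance.\<close>

lemma dirichlet_solution_limit: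
  assumes sol: "\<And>n. dirichlet_solution (h n) (v n) (V n)"
    and h: "\<And>n. h n \<in> borel_measurable M" "\<And>n. AE x in M. \<bar>h n x\<bar> \<le> B" "AE x in M. (\<lambda>n. h n x) \<longlonglongrightarrow> h' x"
      "h' \<in> borel_measurable M"
    and v: "\<And>n. AE x in M. \<bar>v n x\<bar> \<le> C" "AE x in M. (\<lambda>n. v n x) \<longlonglongrightarrow> v' x" "v' \<in> borel_measurable M"
  obtains V' where "dirichlet_solution h' v' V'"
proof -
  have W: "W0 (v n) (V n)" and eq: "W0 \<psi> \<Psi> \<Longrightarrow> (LINT x|M. pflux p (V n x) \<bullet> \<Psi> x) = (LINT x|M. h n x * \<psi> x)" for n \<psi> \<Psi>
    using sol[of n] by (auto simp: dirichlet_solution_def)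
  note Lp = W0_L_p[OF W]
  note ih = L_p_integrable_mult_bounded[OF _ h(1,2)]
  define B' where "B' = \<bar>B\<bar> + 1"
  have B'0: "B' > 0" by (simp add: B'_def)
  have B'h: "AE x in M. \<bar>h n x\<bar> \<le> B'" for n using h(2)[of n] by eventually_elim (simp add: B'_def)
  note B' = B'0 B'h
  have v'_bound: "AE x in M. \<bar>v' x\<bar> \<le> C"
  proof -
    have "AE x in M. \<forall>n. \<bar>v n x\<bar> \<le> C" using v(1) by (simp add: AE_all_countable)
    with v(2) show ?thesis
    proof eventually_elim
      case (elim x)
      show ?case by (rule LIMSEQ_le_const2[OF tendsto_rabs[OF elim(1)]]) (use elim(2) in auto)
    qed
  qed
  have v'Lp: "v' \<in> L_p p \<Omega>" by (rule L_p_bounded[OF v(3), of C]) (use v'_bound in simp)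
  have L1: "(\<lambda>n. LINT x|M. \<bar>v n x - v' x\<bar>) \<longlonglongrightarrow> 0"
  proof -
    have "(\<lambda>n. LINT x|M. \<bar>v n x - v' x\<bar>) \<longlonglongrightarrow> (LINT x|M. 0)"
    proof (rule integral_dominated_convergence)
      show "integrable M (\<lambda>x. 2 * C)" by (rule finite_measure.integrable_const[OF finite_measure_M])
      show "(\<lambda>x. \<bar>v n x - v' x\<bar>) \<in> borel_measurable M" for n
        using L_p_measurable[OF Lp(1)] v(3) by measurable
      show "AE x in M. norm \<bar>v n x - v' x\<bar> \<le> 2 * C" for n
        using v(1)[of n] v'_bound by eventually_elim auto
      show "AE x in M. (\<lambda>n. \<bar>v n x - v' x\<bar>) \<longlonglongrightarrow> 0"
        using v(2) by eventually_elim (simp add: LIM_zero tendsto_rabs_zero)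
    qed simp
    then show ?thesis by simp
  qed
  define Y where "Y n = (LINT x|M. \<bar>v n x - v' x\<bar>)" for n
  have Y: "Y \<longlonglongrightarrow> 0" using L1 by (simp add: Y_def[abs_def])
  have iv: "integrable M (\<lambda>x. \<bar>v i x - v' x\<bar>)" for i
    by (intro integrable_abs L_p_integrable L_p_diff Lp v'Lp)
  have mono: "(LINT x|M. (pflux p (V i x) - pflux p (V j x)) \<bullet> (V i x - V j x)) \<le> 2 * B' * (Y i + Y j)" for i j
  proof -
    note Wd = W0_diff[OF W[of i] W[of j]]
    have "(LINT x|M. (pflux p (V i x) - pflux p (V j x)) \<bullet> (V i x - V j x))
        = (LINT x|M. pflux p (V i x) \<bullet> (V i x - V j x)) - (LINT x|M. pflux p (V j x) \<bullet> (V i x - V j x))"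
      by (subst Bochner_Integration.integral_diff[symmetric]) (intro pflux_integrable Lp W0_L_p(2)[OF Wd], intro pflux_integrable Lp W0_L_p(2)[OF Wd], simp add: inner_diff_left)
    also have "\<dots> = (LINT x|M. h i x * (v i x - v j x)) - (LINT x|M. h j x * (v i x - v j x))"
      by (simp only: eq[OF Wd])
    also have "\<dots> = (LINT x|M. (h i x - h j x) * (v i x - v j x))"
      using ih[OF W0_L_p(1)[OF Wd], of i] ih[OF W0_L_p(1)[OF Wd], of j] by (simp add: left_diff_distrib)
    also have "\<dots> \<le> norm (LINT x|M. (h i x - h j x) * (v i x - v j x))" by simp
    also have "\<dots> \<le> (LINT x|M. 2 * B' * (\<bar>v i x - v' x\<bar> + \<bar>v j x - v' x\<bar>))"
    proof (rule norm_integral_le_AE)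
      show "integrable M (\<lambda>x. (h i x - h j x) * (v i x - v j x))"
        using ih[OF W0_L_p(1)[OF Wd], of i] ih[OF W0_L_p(1)[OF Wd], of j] by (simp add: left_diff_distrib)
      show "integrable M (\<lambda>x. 2 * B' * (\<bar>v i x - v' x\<bar> + \<bar>v j x - v' x\<bar>))" using iv by simp
      show "AE x in M. norm ((h i x - h j x) * (v i x - v j x)) \<le> 2 * B' * (\<bar>v i x - v' x\<bar> + \<bar>v j x - v' x\<bar>)"
        using B'(2)[of i] B'(2)[of j]
      proof eventually_elim
        case (elim x)
        have "\<bar>h i x - h j x\<bar> * \<bar>v i x - v j x\<bar> \<le> 2 * B' * (\<bar>v i x - v' x\<bar> + \<bar>v j x - v' x\<bar>)"
          using elim B'(1) by (intro mult_mono) auto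
        then show ?case by (simp add: abs_mult)
      qed
    qed
    also have "\<dots> = 2 * B' * (Y i + Y j)" using iv by (simp add: Y_def)
    finally show ?thesis .
  qed
  \<comment> \<open>Testing each equation with its own solution bounds the integral of |V_n|^p by
    that of |h_n v_n|, uniformly in n.\<close>
  define K where "K = B' * (\<bar>C\<bar> * measure M \<Omega>)"
  have K0: "K \<ge> 0" using B'(1) by (simp add: K_def)
  have K: "(LINT x|M. norm (V n x) powr p) \<le> K" for n
  proof -
    have "(LINT x|M. norm (V n x) powr p) = (LINT x|M. h n x * v n x)"
      using eq[OF W, of n n] by (simp add: pflux_inner_self)
    also have "\<dots> \<le> norm (LINT x|M. h n x * v n x)" by simp
    also have "\<dots> \<le> (LINT x|M. B' * \<bar>C\<bar>)"
    proof (rule norm_integral_le_AE[OF ih[OF Lp(1)]])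
      show "integrable M (\<lambda>x. B' * \<bar>C\<bar>)" by (rule finite_measure.integrable_const[OF finite_measure_M])
      show "AE x in M. norm (h n x * v n x) \<le> B' * \<bar>C\<bar>"
        using B'(2)[of n] v(1)[of n] by eventually_elim (use B'(1) in \<open>auto simp: abs_mult intro!: mult_mono\<close>)
    qed
    finally show ?thesis by (simp add: K_def mult_ac)
  qed
  have imono: "integrable M (\<lambda>x. (pflux p (V i x) - pflux p (V j x)) \<bullet> (V i x - V j x))" for i j
    unfolding inner_diff_left by (intro Bochner_Integration.integrable_diff pflux_integrable L_p_diff Lp)
  have "\<exists>N. \<forall>i\<ge>N. \<forall>j\<ge>N. (LINT x|M. norm (V i x - V j x) powr p) < e" if e: "e > 0" for e
  proof -
    define \<eta> where "\<eta> = e / (4 * (K + 1))"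
    have \<eta>: "\<eta> > 0" "\<eta> * K < e / 4" using e K0 by (auto simp: \<eta>_def field_simps)
    obtain D where D: "D > 0" "\<And>a b::'a. norm (a - b) powr p \<le> \<eta> * (norm a powr p + norm b powr p) + D * ((pflux p a - pflux p b) \<bullet> (a - b))"
      using norm_diff_powr_le_pflux_mono[OF p_gt_1 \<eta>(1), where 'a='a] by blast
    \<comment> \<open>Each of the two terms 2 D B' Y then stays below e/4, while the \<eta> terms
      use up less than e/2.\<close>
    have "e / (8 * D * B') > 0" using e D(1) B'(1) by simp
    then obtain N where N: "\<And>n. n \<ge> N \<Longrightarrow> Y n < e / (8 * D * B')"
      using order_tendstoD(2)[OF Y] by (auto simp: eventually_sequentially)
    have "(LINT x|M. norm (V i x - V j x) powr p) < e" if ij: "i \<ge> N" "j \<ge> N" for i j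
    proof -
      have "(LINT x|M. norm (V i x - V j x) powr p)
         \<le> (LINT x|M. \<eta> * (norm (V i x) powr p + norm (V j x) powr p) + D * ((pflux p (V i x) - pflux p (V j x)) \<bullet> (V i x - V j x)))"
        using D(2) by (intro integral_mono Bochner_Integration.integrable_add integrable_mult_right L_p_integrable_powr L_p_diff Lp imono) auto
      also have "\<dots> = \<eta> * ((LINT x|M. norm (V i x) powr p) + (LINT x|M. norm (V j x) powr p)) + D * (LINT x|M. (pflux p (V i x) - pflux p (V j x)) \<bullet> (V i x - V j x))"
        using L_p_integrable_powr[OF Lp(2), of i] L_p_integrable_powr[OF Lp(2), of j] imono[of i j] by simp
      also have "\<dots> \<le> \<eta> * (K + K) + D * (2 * B' * (Y i + Y j))"
        using K[of i] K[of j] mono[of i j] \<eta>(1) D(1) by (intro add_mono mult_left_mono) auto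
      also have "D * (2 * B' * (Y i + Y j)) = 2 * D * B' * Y i + 2 * D * B' * Y j" by (simp add: algebra_simps)
      also have "\<eta> * (K + K) + (2 * D * B' * Y i + 2 * D * B' * Y j) < e"
      proof -
        have "2 * D * B' * Y i < e / 4" "2 * D * B' * Y j < e / 4"
          using N[OF ij(1)] N[OF ij(2)] D(1) B'(1) by (simp_all add: field_simps)
        then show ?thesis using \<eta>(2) by (simp add: distrib_left)
      qed
      finally show ?thesis .
    qed
    then show ?thesis by blast
  qed
  from W0_complete[OF W this] obtain z V' where z: "W0 z V'" "Lp_tendsto v z" "Lp_tendsto V V'" by metis
  note zLp = W0_L_p[OF z(1)]
  obtain r where r: "strict_mono r" "AE x in M. (\<lambda>n. v (r n) x) \<longlonglongrightarrow> z x"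
    using Lp_tendsto_AE_subseq[OF Lp(1) zLp(1) z(2)] by metis
  have "AE x in M. v' x = z x"
    using r(2) v(2)
  proof eventually_elim
    case (elim x)
    show ?case by (rule LIMSEQ_unique[OF LIMSEQ_subseq_LIMSEQ[OF elim(2) r(1), unfolded o_def] elim(1)])
  qed
  from W0_AE_cong[OF z(1) v(3) this] have W': "W0 v' V'" .
  have "dirichlet_solution h' v' V'"
    unfolding dirichlet_solution_def
  proof (intro conjI allI impI W')
    fix \<psi> \<Psi> assume \<psi>: "W0 \<psi> \<Psi>"
    note \<psi>Lp = W0_L_p[OF \<psi>]
    have 1: "(\<lambda>n. LINT x|M. pflux p (V n x) \<bullet> \<Psi> x) \<longlonglongrightarrow> (LINT x|M. pflux p (V' x) \<bullet> \<Psi> x)"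
      by (rule Lp_tendsto_pflux[OF Lp(2) zLp(2) z(3) \<psi>Lp(2)])
    have 2: "(\<lambda>n. LINT x|M. h n x * \<psi> x) \<longlonglongrightarrow> (LINT x|M. h' x * \<psi> x)"
    proof (rule integral_dominated_convergence)
      show "integrable M (\<lambda>x. B' * \<bar>\<psi> x\<bar>)" using L_p_integrable[OF \<psi>Lp(1)] by simp
      show "(\<lambda>x. h' x * \<psi> x) \<in> borel_measurable M" using h(4) L_p_measurable[OF \<psi>Lp(1)] by measurable
      show "(\<lambda>x. h n x * \<psi> x) \<in> borel_measurable M" for n using h(1) L_p_measurable[OF \<psi>Lp(1)] by measurable
      show "AE x in M. (\<lambda>n. h n x * \<psi> x) \<longlonglongrightarrow> h' x * \<psi> x" using h(3) by eventually_elim (intro tendsto_intros)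
      show "AE x in M. norm (h n x * \<psi> x) \<le> B' * \<bar>\<psi> x\<bar>" for n
        using B'(2)[of n] by eventually_elim (auto simp: abs_mult intro!: mult_right_mono)
    qed
    show "(LINT x|M. pflux p (V' x) \<bullet> \<Psi> x) = (LINT x|M. h' x * \<psi> x)"
      using LIMSEQ_unique[OF 1] 2 by (simp add: eq[OF \<psi>])
  qed
  then show thesis by (rule that)
qed

end

section \<open>Radial functions\<close>

lemma pflux_neg_scale:
  assumes "c \<ge> 0" "p > 1"
  shows "pflux p (- (c *\<^sub>R w)) = - (c powr (p - 1) *\<^sub>R pflux p w)"
proof (cases "c = 0")
  case False
  then have "pflux p (- (c *\<^sub>R w)) = - pflux p (c *\<^sub>R w)" by (simp add: pflux_def)
  then show ?thesis using False assms by (simp add: pflux_scale)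
qed simp

text \<open>For r = p/(p-1) one has (r-1)(p-1) = 1, and the exponents of |y| add up to 0. This is
  why a profile in the variable |x - z|^r has a flux proportional to x - z.\<close>

lemma pflux_conjugate:
  assumes "p > 1"
  shows "pflux p (pflux (p / (p - 1)) y) = y"
proof (cases "y = 0")
  case False
  define r where "r = p / (p - 1)"
  have r: "(r - 1) * (p - 1) = 1" using assms by (simp add: r_def field_simps)
  have "pflux p (pflux r y) = (norm y powr (r - 1)) powr (p - 2) *\<^sub>R norm y powr (r - 2) *\<^sub>R y"
    unfolding pflux_def[of p "pflux r y"] norm_pflux by (simp add: pflux_def)
  also have "\<dots> = norm y powr ((r - 1) * (p - 2) + (r - 2)) *\<^sub>R y"
    by (simp add: powr_powr powr_add)
  also have "(r - 1) * (p - 2) + (r - 2) = 0" using r by (simp add: algebra_simps)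
  finally show ?thesis using False by (simp add: r_def)
qed simp

context lebesgue_domain
begin

lemma conjugate_gt_1: "p / (p - 1) > 1"
  using p_gt_1 by simp

lemma radial_gradient:
  fixes z :: 'a
  assumes \<theta>: "\<And>s. DERIV \<theta> s :> - \<tau> s"
  shows "GDERIV (\<lambda>x. \<theta> (norm (x - z) powr (p / (p - 1)))) x :>
    - ((p / (p - 1) * \<tau> (norm (x - z) powr (p / (p - 1)))) *\<^sub>R pflux (p / (p - 1)) (x - z))"
proof -
  let ?r = "p / (p - 1)"
  have "((\<lambda>x. x - z) has_derivative (\<lambda>h. h)) (at x)" by (auto intro!: derivative_eq_intros)
  from has_derivative_compose[OF this GDERIV_norm_powr[OF conjugate_gt_1, unfolded gderiv_def]]
  have "GDERIV (\<lambda>x. norm (x - z) powr ?r) x :> (?r * norm (x - z) powr (?r - 2)) *\<^sub>R (x - z)"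
    by (simp only: gderiv_def)
  from GDERIV_DERIV_compose[OF this \<theta>] show ?thesis
    by (rule GDERIV_subst) (simp add: pflux_def mult.commute)
qed

lemma continuous_radial:
  fixes z :: 'a
  assumes "continuous_on UNIV g"
  shows "continuous_on UNIV (\<lambda>x. g (norm (x - z) powr (p / (p - 1))))"
proof -
  define r where "r = p / (p - 1)"
  have "r > 0" using p_gt_1 by (simp add: r_def)
  then have "continuous_on UNIV (\<lambda>x. norm (x - z) powr r)"
    by (intro continuous_on_powr' continuous_intros) auto
  then show ?thesis unfolding r_def[symmetric] by (rule continuous_on_compose2[OF assms]) auto
qed

lemma continuous_radial_gradient:
  fixes z :: 'a
  assumes "continuous_on UNIV \<tau>"
  shows "continuous_on UNIV (\<lambda>x. - ((p / (p - 1) * \<tau> (norm (x - z) powr (p / (p - 1)))) *\<^sub>R pflux (p / (p - 1)) (x - z)))"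
  by (intro continuous_intros continuous_radial[OF assms]
      continuous_on_compose2[OF continuous_on_pflux[OF conjugate_gt_1]]) auto

text \<open>In the variable \<open>|x - z|\<^sup>p\<^sup>'\<close>, with \<open>p'\<close> conjugate to \<open>p\<close>, the flux of a decreasing radial
  function is just \<open>-\<kappa> (x - z)\<close>, and \<open>k\<close> is the divergence of \<open>\<kappa> (x - z)\<close>.\<close>

lemma radial_flux:
  fixes z :: 'a
  assumes \<tau>: "\<And>s. \<tau> s \<ge> 0" "continuous_on UNIV \<tau>"
    and \<kappa>: "\<And>s. \<kappa> s = (p / (p - 1) * \<tau> s) powr (p - 1)" "\<And>s. DERIV \<kappa> s :> \<kappa>' s" "continuous_on UNIV \<kappa>'"
    and W: "W0 \<psi> \<Psi>"
  defines "Z \<equiv> \<lambda>x. - ((p / (p - 1) * \<tau> (norm (x - z) powr (p / (p - 1)))) *\<^sub>R pflux (p / (p - 1)) (x - z))"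
    and "k \<equiv> \<lambda>x. real DIM('a) * \<kappa> (norm (x - z) powr (p / (p - 1)))
      + \<kappa>' (norm (x - z) powr (p / (p - 1))) * (p / (p - 1)) * norm (x - z) powr (p / (p - 1))"
  shows "(LINT x|M. pflux p (Z x) \<bullet> \<Psi> x) = (LINT x|M. k x * \<psi> x)"
proof -
  let ?r = "p / (p - 1)"
  let ?\<rho> = "\<lambda>x. norm (x - z) powr ?r"
  have Zp: "pflux p (Z x) = - (\<kappa> (?\<rho> x) *\<^sub>R (x - z))" for x
    unfolding Z_def using \<tau>(1) p_gt_1 by (subst pflux_neg_scale) (auto simp: pflux_conjugate \<kappa>(1))
  have c\<kappa>: "continuous_on UNIV \<kappa>"
    using \<kappa>(2) by (auto intro!: continuous_at_imp_continuous_on DERIV_isCont)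
  have ZLp: "Z \<in> L_p p \<Omega>" unfolding Z_def by (intro L_p_continuous continuous_radial_gradient \<tau>(2))
  have ck: "continuous_on UNIV k"
    unfolding k_def by (intro continuous_intros continuous_radial[OF c\<kappa>] continuous_radial[OF \<kappa>(3)] continuous_radial[OF continuous_on_id, simplified id_def])
  have km: "k \<in> borel_measurable M" by (rule measurable_continuous[OF ck])
  obtain B where "\<And>x. x \<in> \<Omega> \<Longrightarrow> norm (k x) \<le> B" using continuous_bounded_on_domain[OF ck] by metis
  then have kB: "AE x in M. \<bar>k x\<bar> \<le> B" using AE_mem_domain by (auto elim!: eventually_mono)
  have C1: "(LINT x|M. pflux p (Z x) \<bullet> G x) = (LINT x|M. k x * \<phi> x)" if \<phi>: "C1c \<phi> G" for \<phi> G
  proof -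
    \<comment> \<open>The divergence theorem by coordinates: g_b is the b-component of \<kappa> (x -
      z), the b-derivative of \<phi> g_b integrates to zero, and summing over the basis produces the
      divergence k.\<close>
    define g where "g b x = \<kappa> (?\<rho> x) * ((x - z) \<bullet> b)" for b x
    define H where "H b x = \<kappa> (?\<rho> x) *\<^sub>R b + ((x - z) \<bullet> b) *\<^sub>R (\<kappa>' (?\<rho> x) * ?r) *\<^sub>R pflux ?r (x - z)" for b x
    have gH: "GDERIV (g b) x :> H b x" for b x
    proof -
      have "GDERIV (\<lambda>x. \<kappa> (?\<rho> x)) x :> (\<kappa>' (?\<rho> x) * ?r) *\<^sub>R pflux ?r (x - z)"
        using radial_gradient[of \<kappa> "\<lambda>s. - \<kappa>' s" z x] \<kappa>(2) by (simp add: mult.commute)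
      moreover have "GDERIV (\<lambda>x. (x - z) \<bullet> b) x :> b"
        by (auto simp: gderiv_def intro!: derivative_eq_intros)
      ultimately show ?thesis unfolding g_def H_def by (rule GDERIV_mult)
    qed
    have cH: "continuous_on UNIV (H b)" for b
      unfolding H_def by (intro continuous_intros continuous_radial[OF c\<kappa>] continuous_radial[OF \<kappa>(3)]
          continuous_on_compose2[OF continuous_on_pflux[OF conjugate_gt_1]]) auto
    note CC = C1c_mult[OF \<phi> gH cH]
    have Ib: "integrable M (\<lambda>x. (\<phi> x *\<^sub>R H b x + g b x *\<^sub>R G x) \<bullet> b)" for b
      using L_p_integrable[OF C1c_L_p(2)[OF CC[of b]]] by (rule integrable_inner_left)
    have sum: "(\<Sum>b\<in>Basis. (\<phi> x *\<^sub>R H b x + g b x *\<^sub>R G x) \<bullet> b) = k x * \<phi> x - pflux p (Z x) \<bullet> G x" for x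
    proof -
      have "(\<Sum>b\<in>Basis. g b x * (G x \<bullet> b)) = \<kappa> (?\<rho> x) * ((x - z) \<bullet> G x)"
        unfolding g_def euclidean_inner[of "x - z" "G x"] sum_distrib_left by (simp add: mult.assoc)
      moreover have "(\<Sum>b\<in>Basis. H b x \<bullet> b) = k x"
      proof -
        have "(\<Sum>b\<in>Basis. ((x - z) \<bullet> b) * (pflux ?r (x - z) \<bullet> b)) = ?\<rho> x"
          unfolding euclidean_inner[symmetric] using pflux_inner_self[of ?r "x - z"] by (simp add: inner_commute)
        then have "(\<Sum>b\<in>Basis. \<kappa>' (?\<rho> x) * ?r * (((x - z) \<bullet> b) * (pflux ?r (x - z) \<bullet> b))) = \<kappa>' (?\<rho> x) * ?r * ?\<rho> x"
          unfolding sum_distrib_left[symmetric] by simp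
        moreover have "(\<Sum>b\<in>(Basis::'a set). \<kappa> (?\<rho> x) * (b \<bullet> b)) = real DIM('a) * \<kappa> (?\<rho> x)" by simp
        moreover have "H b x \<bullet> b = \<kappa> (?\<rho> x) * (b \<bullet> b) + \<kappa>' (?\<rho> x) * ?r * (((x - z) \<bullet> b) * (pflux ?r (x - z) \<bullet> b))" for b
          unfolding H_def inner_add_left inner_scaleR_left by (simp only: mult_ac)
        ultimately show ?thesis unfolding k_def by (simp only: sum.distrib)
      qed
      moreover have "(\<Sum>b\<in>Basis. (\<phi> x *\<^sub>R H b x + g b x *\<^sub>R G x) \<bullet> b)
          = \<phi> x * (\<Sum>b\<in>Basis. H b x \<bullet> b) + (\<Sum>b\<in>Basis. g b x * (G x \<bullet> b))"
        by (simp only: inner_add_left inner_scaleR_left sum.distrib sum_distrib_left)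
      ultimately show ?thesis by (simp add: Zp mult.commute)
    qed
    have "0 = (\<Sum>b\<in>Basis. (LINT x|M. (\<phi> x *\<^sub>R H b x + g b x *\<^sub>R G x) \<bullet> b))"
      by (simp add: C1c_integral_gradient[OF CC])
    also have "\<dots> = (LINT x|M. k x * \<phi> x - pflux p (Z x) \<bullet> G x)"
      unfolding sum[symmetric] by (rule Bochner_Integration.integral_sum[symmetric]) (rule Ib)
    also have "\<dots> = (LINT x|M. k x * \<phi> x) - (LINT x|M. pflux p (Z x) \<bullet> G x)"
      by (rule Bochner_Integration.integral_diff[OF L_p_integrable_mult_bounded[OF C1c_L_p(1)[OF \<phi>] km kB]
            pflux_integrable[OF ZLp C1c_L_p(2)[OF \<phi>]]])
    finally show ?thesis by simp
  qed
  obtain \<phi> where \<phi>: "\<And>n. C1c (\<phi> n) (grad (\<phi> n))" "Lp_tendsto \<phi> \<psi>" "Lp_tendsto (\<lambda>n. grad (\<phi> n)) \<Psi>"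
    using W0E[OF W] by metis
  have 1: "(\<lambda>n. LINT x|M. pflux p (Z x) \<bullet> grad (\<phi> n) x) \<longlonglongrightarrow> (LINT x|M. pflux p (Z x) \<bullet> \<Psi> x)"
    by (rule Lp_tendsto_pflux_fixed[OF ZLp C1c_L_p(2)[OF \<phi>(1)] W0_L_p(2)[OF W] \<phi>(3)])
  have 2: "(\<lambda>n. LINT x|M. k x * \<phi> n x) \<longlonglongrightarrow> (LINT x|M. k x * \<psi> x)"
    by (rule Lp_tendsto_integral_mult[OF C1c_L_p(1)[OF \<phi>(1)] W0_L_p(1)[OF W] \<phi>(2) km kB])
  show ?thesis
    using LIMSEQ_unique[OF 1] 2 by (simp add: C1[OF \<phi>(1)])
qed

end

section \<open>The change of variable on the real line\<close>

lemma exists_antiderivative: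
  fixes e :: "real \<Rightarrow> real"
  assumes "continuous_on UNIV e"
  obtains \<Phi> where "\<And>s. DERIV \<Phi> s :> e s" "\<Phi> 0 = 0"
proof -
  define \<Phi> where "\<Phi> u = (LBINT y=0..u. e y)" for u :: real
  have "DERIV \<Phi> s :> e s" for s
  proof -
    have c: "continuous_on {- \<bar>s\<bar> - 1..\<bar>s\<bar> + 1} e" using assms by (rule continuous_on_subset) auto
    have "(\<Phi> has_vector_derivative e s) (at s within {- \<bar>s\<bar> - 1..\<bar>s\<bar> + 1})"
      unfolding \<Phi>_def zero_ereal_def by (rule interval_integral_FTC2[OF _ _ c]) auto
    moreover have "at s within {- \<bar>s\<bar> - 1..\<bar>s\<bar> + 1} = at s"
      by (rule at_within_interior) (simp add: interior_atLeastAtMost_real abs_if)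
    ultimately show ?thesis by (simp add: has_real_derivative_iff_has_vector_derivative)
  qed
  moreover have "\<Phi> 0 = 0" unfolding \<Phi>_def zero_ereal_def by (simp only: interval_integral_endpoints_same)
  ultimately show thesis by (rule that)
qed

text \<open>A derivative of at least 1 makes \<Phi> expand distances: this gives injectivity, values
  beyond any v on the interval from -|v|-1 to |v|+1 and hence surjectivity, and an inverse with
  Lipschitz constant 1.\<close>

lemma expanding_inverse:
  fixes \<Phi> e :: "real \<Rightarrow> real"
  assumes D: "\<And>s. DERIV \<Phi> s :> e s" and e: "\<And>s. e s \<ge> 1" and 0: "\<Phi> 0 = 0"
  obtains \<Psi> where "strict_mono \<Phi>" "strict_mono \<Psi>" "\<And>s. \<Psi> (\<Phi> s) = s" "\<And>v. \<Phi> (\<Psi> v) = v"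
    "\<And>v. DERIV \<Psi> v :> inverse (e (\<Psi> v))" "continuous_on UNIV \<Psi>"
proof -
  have grow: "\<Phi> t - \<Phi> s \<ge> t - s" if st: "s < t" for s t
  proof -
    obtain z where "\<Phi> t - \<Phi> s = (t - s) * e z" using MVT2[OF st, of \<Phi> e] D by blast
    then show ?thesis using e[of z] st by (simp add: mult_le_cancel_left1)
  qed
  have mono: "strict_mono \<Phi>"
  proof (rule strict_monoI)
    fix s t :: real assume "s < t"
    then show "\<Phi> s < \<Phi> t" using grow[of s t] by simp
  qed
  have cont: "continuous_on UNIV \<Phi>" using D by (auto intro!: continuous_at_imp_continuous_on DERIV_isCont)
  have "\<exists>s. \<Phi> s = v" for v
  proof -
    have a: "- \<bar>v\<bar> - 1 < 0" and b: "0 < \<bar>v\<bar> + 1" by linarith+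
    have "\<Phi> (- \<bar>v\<bar> - 1) \<le> v" using grow[OF a] 0 by linarith
    moreover have "v \<le> \<Phi> (\<bar>v\<bar> + 1)" using grow[OF b] 0 by linarith
    ultimately show ?thesis
      using IVT'[of \<Phi> "- \<bar>v\<bar> - 1" v "\<bar>v\<bar> + 1"] continuous_on_subset[OF cont] by auto
  qed
  then have surj: "surj \<Phi>" unfolding surj_def by metis
  define \<Psi> where "\<Psi> = inv \<Phi>"
  have i1: "\<Psi> (\<Phi> s) = s" for s
    unfolding \<Psi>_def using strict_mono_imp_inj_on[OF mono] by (rule inv_f_f)
  have i2: "\<Phi> (\<Psi> v) = v" for v unfolding \<Psi>_def using surj by (rule surj_f_inv_f)
  have mono': "strict_mono \<Psi>"
    by (rule strict_monoI) (metis i2 mono strict_mono_less)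
  have lip: "\<bar>\<Psi> a - \<Psi> b\<bar> \<le> \<bar>a - b\<bar>" for a b
    using grow[of "\<Psi> a" "\<Psi> b"] grow[of "\<Psi> b" "\<Psi> a"] by (cases "\<Psi> a" "\<Psi> b" rule: linorder_cases) (auto simp: i2)
  have cont': "isCont \<Psi> v" for v
    unfolding isCont_def
  proof (rule LIM_zero_cancel, rule Lim_null_comparison)
    show "\<forall>\<^sub>F x in at v. norm (\<Psi> x - \<Psi> v) \<le> \<bar>x - v\<bar>" using lip by simp
    show "((\<lambda>x. \<bar>x - v\<bar>) \<longlongrightarrow> 0) (at v)" by (auto intro!: tendsto_eq_intros)
  qed
  have "DERIV \<Psi> v :> inverse (e (\<Psi> v))" for v
    by (rule DERIV_inverse_function[where f=\<Phi> and a="v - 1" and b="v + 1"])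
      (use D e[of "\<Psi> v"] i2 cont' in auto)
  moreover have "continuous_on UNIV \<Psi>" using cont' by (simp add: continuous_at_imp_continuous_on)
  ultimately show thesis using that mono mono' i1 i2 by blast
qed

section \<open>The Kazdan-Kramer substitution\<close>

text \<open>Taking the positive part first makes f and its primitive continuous and monotone on the
  whole line; on positive solutions nothing changes.\<close>

definition source :: "real \<Rightarrow> real \<Rightarrow> real \<Rightarrow> real" where
  "source lam q s = lam * max 0 s powr (q - 1)"

definition source_prim :: "real \<Rightarrow> real \<Rightarrow> real \<Rightarrow> real" where
  "source_prim lam q s = lam * max 0 s powr q / q"

lemma DERIV_source_prim:
  assumes "q > 1"
  shows "DERIV (source_prim lam q) s :> source lam q s"
proof -
  have "DERIV (\<lambda>s. lam * max 0 s powr q / q) s :> lam * (q * max 0 s powr (q - 1)) / q"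
    by (intro DERIV_cdivide DERIV_cmult DERIV_pos_part_powr assms)
  then show ?thesis unfolding source_prim_def[abs_def] source_def
    by (rule DERIV_cong) (use assms in simp)
qed

text \<open>The transformation is fixed by its properties, not by a formula. Both \<Phi> and its
  inverse \<Psi> live on the whole line, so compositions with Sobolev functions need no sign
  conditions.\<close>

locale kazdan_kramer = lebesgue_domain \<Omega> p for \<Omega> :: "'a::euclidean_space set" and p :: real +
  fixes q lam :: real and \<Phi> \<Psi> :: "real \<Rightarrow> real"
  assumes q_gt_1: "q > 1" and q_less_p: "q < p" and lam_pos: "lam > 0"
    and DERIV_\<Phi>: "\<And>s. DERIV \<Phi> s :> exp (source_prim lam q s / (p - 1))" and \<Phi>_0: "\<Phi> 0 = 0"
    and mono_\<Phi>: "strict_mono \<Phi>" and mono_\<Psi>: "strict_mono \<Psi>"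
    and \<Psi>_\<Phi>: "\<And>s. \<Psi> (\<Phi> s) = s" and \<Phi>_\<Psi>: "\<And>v. \<Phi> (\<Psi> v) = v"
    and DERIV_\<Psi>: "\<And>v. DERIV \<Psi> v :> inverse (exp (source_prim lam q (\<Psi> v) / (p - 1)))"
    and continuous_\<Psi>: "continuous_on UNIV \<Psi>"
begin

abbreviation f where "f \<equiv> source lam q"
abbreviation F where "F \<equiv> source_prim lam q"

text \<open>The factor exp(F) is \<Phi>'(u)^(p-1), the weight by which -\<Delta>_p u - f(u) |grad
  u|^p is multiplied on passing to v = \<Phi>(u).\<close>

definition g :: "real \<Rightarrow> real" where "g v = f (\<Psi> v) * exp (F (\<Psi> v))"

lemma \<Psi>_0: "\<Psi> 0 = 0" using \<Psi>_\<Phi>[of 0] \<Phi>_0 by simp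

lemma f_nonneg: "f s \<ge> 0"
  using lam_pos by (simp add: source_def)

lemma F_nonneg: "F s \<ge> 0"
  using lam_pos q_gt_1 by (simp add: source_prim_def)

lemma f_mono: "s \<le> t \<Longrightarrow> f s \<le> f t"
  unfolding source_def using lam_pos q_gt_1 by (intro mult_left_mono powr_mono2) auto

lemma F_mono: "s \<le> t \<Longrightarrow> F s \<le> F t"
  unfolding source_prim_def using lam_pos q_gt_1
  by (intro divide_right_mono mult_left_mono powr_mono2) auto

lemmas DERIV_F = DERIV_source_prim[OF q_gt_1]

lemma continuous_f: "continuous_on UNIV f"
  unfolding source_def[abs_def] using q_gt_1 by (intro continuous_intros continuous_pos_part_powr) auto

lemma continuous_F: "continuous_on UNIV F"
  using DERIV_F by (auto intro!: continuous_at_imp_continuous_on DERIV_isCont)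

lemma continuous_\<Phi>: "continuous_on UNIV \<Phi>"
  using DERIV_\<Phi> by (auto intro!: continuous_at_imp_continuous_on DERIV_isCont)

lemma g_nonneg: "g v \<ge> 0"
  unfolding g_def by (intro mult_nonneg_nonneg f_nonneg) auto

lemma g_mono: "v \<le> w \<Longrightarrow> g v \<le> g w"
  unfolding g_def using f_nonneg strict_mono_less_eq[OF mono_\<Psi>]
  by (intro mult_mono f_mono) (auto intro: F_mono)

lemma continuous_g: "continuous_on UNIV g"
  unfolding g_def[abs_def]
  by (intro continuous_intros continuous_on_compose2[OF continuous_f continuous_\<Psi>]
      continuous_on_compose2[OF continuous_F continuous_\<Psi>]) auto

text \<open>On [0, m] the derivative of \<Phi> is at most E, so t = \<Phi>(s) \<le> E s and g(t)
  \<ge> f(s) \<ge> \<lambda> (t/E)^(q-1). Near 0 the transformed source thus still dominates a power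
  below p - 1, which is what small subsolutions need.\<close>

lemma g_lower_bound:
  assumes m: "m > 0"
  obtains c where "c > 0" "\<And>t. 0 \<le> t \<Longrightarrow> t \<le> \<Phi> m \<Longrightarrow> c * t powr (q - 1) \<le> g t"
proof -
  define E where "E = exp (F m / (p - 1))"
  have E: "E > 0" by (simp add: E_def)
  have "lam * (1 / E) powr (q - 1) * t powr (q - 1) \<le> g t" if t: "0 \<le> t" "t \<le> \<Phi> m" for t
  proof -
    define s where "s = \<Psi> t"
    have s: "0 \<le> s" "s \<le> m" "\<Phi> s = t"
      using t strict_mono_less_eq[OF mono_\<Psi>] \<Psi>_0 \<Psi>_\<Phi> \<Phi>_\<Psi> unfolding s_def by metis+
    have "t \<le> s * E"
    proof (cases "s = 0")
      case True
      then show ?thesis using s \<Phi>_0 by simp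
    next
      case False
      with s have s0: "0 < s" by simp
      obtain z where z: "0 < z" "z < s" "\<Phi> s - \<Phi> 0 = (s - 0) * exp (F z / (p - 1))"
        using MVT2[OF s0, of \<Phi> "\<lambda>s. exp (F s / (p - 1))"] DERIV_\<Phi> by blast
      have "F z / (p - 1) \<le> F m / (p - 1)" using F_mono[of z m] z s p_gt_1 by (intro divide_right_mono) auto
      then have "s * exp (F z / (p - 1)) \<le> s * E" unfolding E_def using s0 by (intro mult_left_mono) auto
      then show ?thesis using z(3) s(3) \<Phi>_0 by simp
    qed
    then have "1 / E * t \<le> s" using E by (simp add: field_simps)
    then have "(1 / E * t) powr (q - 1) \<le> s powr (q - 1)" using E t q_gt_1 by (intro powr_mono2) auto
    then have "lam * ((1 / E) powr (q - 1) * t powr (q - 1)) \<le> f s"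
      unfolding source_def using lam_pos s E t by (subst powr_mult[symmetric]) auto
    also have "f s \<le> g t" unfolding g_def s_def[symmetric]
      using mult_left_mono[of 1 "exp (F s)" "f s"] F_nonneg[of s] f_nonneg[of s] by simp
    finally show ?thesis by (simp add: mult.assoc)
  qed
  moreover have "lam * (1 / E) powr (q - 1) > 0" using lam_pos E by simp
  ultimately show thesis using that by blast
qed

text \<open>For the untransformed barrier u = m (1 - \<sigma>), \<sigma> = |x - z|^r / R^r with r =
  p/(p-1), the p-Laplacian gives c N with N the dimension, and |grad u|^p = c m r \<sigma>. The flux
  coefficient of \<Phi>(u) is c exp(F(u)), and differentiating the exponential produces the gradient
  term: k = exp(F(u)) (c N - f(u) c m r \<sigma>). The claim k \<ge> g(\<Phi>(u)) follows from
  \<open>cond\<close> by enlarging u to m and \<sigma> to 1 independently.\<close>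

lemma supersolution:
  fixes z :: 'a
  assumes R: "R > 0" "\<Omega> \<subseteq> ball z R" and m: "m > 0"
    and c: "c = (p / (p - 1) * (m / R powr (p / (p - 1)))) powr (p - 1)"
    and cond: "f m * (1 + c * (m * (p / (p - 1)))) \<le> c * real DIM('a)"
  obtains v Z k where "\<And>x. GDERIV v x :> Z x" "continuous_on UNIV Z" "continuous_on UNIV v"
    "\<And>x. x \<in> \<Omega> \<Longrightarrow> 0 < v x" "\<And>x. x \<in> \<Omega> \<Longrightarrow> v x \<le> \<Phi> m" "continuous_on UNIV k"
    "\<And>\<psi> \<Psi>. W0 \<psi> \<Psi> \<Longrightarrow> (LINT x|M. pflux p (Z x) \<bullet> \<Psi> x) = (LINT x|M. k x * \<psi> x)"
    "\<And>x. x \<in> \<Omega> \<Longrightarrow> g (v x) \<le> k x"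
proof -
  define r where "r = p / (p - 1)"
  define T where "T = R powr r"
  have r: "r > 1" unfolding r_def by (rule conjugate_gt_1)
  have T: "T > 0" using R by (simp add: T_def)
  define y where "y s = m * (1 - s / T)" for s
  define \<tau> where "\<tau> s = exp (F (y s) / (p - 1)) * (m / T)" for s
  define \<kappa> where "\<kappa> s = c * exp (F (y s))" for s
  define \<kappa>' where "\<kappa>' s = c * (exp (F (y s)) * (f (y s) * (- (m / T))))" for s
  have Dy: "DERIV y s :> - (m / T)" for s
    unfolding y_def[abs_def] using T by (auto intro!: derivative_eq_intros)
  have cy: "continuous_on UNIV y" using Dy by (auto intro!: continuous_at_imp_continuous_on DERIV_isCont)
  have D\<theta>: "DERIV (\<lambda>s. \<Phi> (y s)) s :> - \<tau> s" for s
    using DERIV_chain2[OF DERIV_\<Phi> Dy] by (simp add: \<tau>_def)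
  have \<tau>0: "\<tau> s \<ge> 0" for s using m T by (simp add: \<tau>_def)
  have c\<tau>: "continuous_on UNIV \<tau>"
    unfolding \<tau>_def[abs_def] using p_gt_1
    by (intro continuous_intros continuous_on_compose2[OF continuous_F cy]) auto
  have \<kappa>: "\<kappa> s = (p / (p - 1) * \<tau> s) powr (p - 1)" for s
  proof -
    have "(p / (p - 1) * \<tau> s) powr (p - 1) = ((p / (p - 1) * (m / T)) * exp (F (y s) / (p - 1))) powr (p - 1)"
      by (simp only: \<tau>_def mult_ac)
    also have "\<dots> = c * exp (F (y s) / (p - 1)) powr (p - 1)"
      unfolding c T_def r_def using m p_gt_1 R by (subst powr_mult) auto
    also have "exp (F (y s) / (p - 1)) powr (p - 1) = exp (F (y s))"
      using p_gt_1 by (simp add: exp_powr_real)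
    finally show ?thesis by (simp add: \<kappa>_def)
  qed
  have D\<kappa>: "DERIV \<kappa> s :> \<kappa>' s" for s
    unfolding \<kappa>_def[abs_def] \<kappa>'_def
    by (intro DERIV_cmult DERIV_fun_exp DERIV_chain2[OF DERIV_F Dy])
  have c\<kappa>': "continuous_on UNIV \<kappa>'"
    unfolding \<kappa>'_def[abs_def]
    by (intro continuous_intros continuous_on_compose2[OF continuous_F cy] continuous_on_compose2[OF continuous_f cy]) auto
  define k where "k x = real DIM('a) * \<kappa> (norm (x - z) powr r) + \<kappa>' (norm (x - z) powr r) * r * norm (x - z) powr r" for x
  have in01: "0 < y (norm (x - z) powr r) \<and> y (norm (x - z) powr r) \<le> m
      \<and> 0 \<le> norm (x - z) powr r / T \<and> norm (x - z) powr r / T \<le> 1" if x: "x \<in> \<Omega>" for x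
  proof -
    have "norm (x - z) < R" using x R(2) by (auto simp: dist_norm norm_minus_commute)
    then have "norm (x - z) powr r < T" unfolding T_def using r by (intro powr_less_mono2) auto
    then have "0 \<le> norm (x - z) powr r / T" "norm (x - z) powr r / T < 1" using T by auto
    then show ?thesis unfolding y_def using m by (auto simp: mult_le_cancel_left1)
  qed
  have c0: "c \<ge> 0" by (simp add: c)
  show thesis
  proof (rule that[of "\<lambda>x. \<Phi> (y (norm (x - z) powr r))"
        "\<lambda>x. - ((p / (p - 1) * \<tau> (norm (x - z) powr (p / (p - 1)))) *\<^sub>R pflux (p / (p - 1)) (x - z))" k])
    show "GDERIV (\<lambda>x. \<Phi> (y (norm (x - z) powr r))) x :>
       - ((p / (p - 1) * \<tau> (norm (x - z) powr (p / (p - 1)))) *\<^sub>R pflux (p / (p - 1)) (x - z))" for x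
      unfolding r_def by (rule radial_gradient[OF D\<theta>])
    show "continuous_on UNIV (\<lambda>x. - ((p / (p - 1) * \<tau> (norm (x - z) powr (p / (p - 1)))) *\<^sub>R pflux (p / (p - 1)) (x - z)))"
      by (rule continuous_radial_gradient[OF c\<tau>])
    show "continuous_on UNIV (\<lambda>x. \<Phi> (y (norm (x - z) powr r)))"
      unfolding r_def by (intro continuous_radial continuous_on_compose2[OF continuous_\<Phi> cy]) auto
    show "continuous_on UNIV k"
      unfolding k_def[abs_def] r_def
      using D\<kappa> by (intro continuous_intros continuous_radial[OF c\<kappa>'] continuous_radial[of \<kappa>]
          continuous_radial[OF continuous_on_id, simplified id_def])
        (auto intro!: continuous_at_imp_continuous_on DERIV_isCont)
    show "(LINT x|M. pflux p (- ((p / (p - 1) * \<tau> (norm (x - z) powr (p / (p - 1)))) *\<^sub>R pflux (p / (p - 1)) (x - z))) \<bullet> \<Psi> x)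
      = (LINT x|M. k x * \<psi> x)" if "W0 \<psi> \<Psi>" for \<psi> \<Psi>
      unfolding k_def r_def by (rule radial_flux[OF \<tau>0 c\<tau> \<kappa> D\<kappa> c\<kappa>' that])
    fix x assume x: "x \<in> \<Omega>"
    note i = in01[OF x]
    show "0 < \<Phi> (y (norm (x - z) powr r))" using i strict_mono_less[OF mono_\<Phi>, of 0] \<Phi>_0 by auto
    show "\<Phi> (y (norm (x - z) powr r)) \<le> \<Phi> m" using i strict_mono_less_eq[OF mono_\<Phi>] by auto
    define \<sigma> where "\<sigma> = norm (x - z) powr r / T"
    define u where "u = y (norm (x - z) powr r)"
    have \<sigma>: "0 \<le> \<sigma>" "\<sigma> \<le> 1" and u: "u \<le> m" using i by (auto simp: \<sigma>_def u_def)
    have "m * r * \<sigma> \<le> m * r * 1" using \<sigma> m r by (intro mult_left_mono) auto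
    then have "1 + c * (m * r * \<sigma>) \<le> 1 + c * (m * r)"
      using c0 by (intro add_left_mono mult_left_mono) auto
    then have "f u * (1 + c * (m * r * \<sigma>)) \<le> f m * (1 + c * (m * r))"
      using f_mono[OF u] f_nonneg c0 m r \<sigma> by (intro mult_mono) auto
    also have "\<dots> \<le> c * real DIM('a)" using cond by (simp only: r_def)
    finally have "exp (F u) * (f u * (1 + c * (m * r * \<sigma>))) \<le> exp (F u) * (c * real DIM('a))"
      by (intro mult_left_mono) auto
    moreover have "k x = exp (F u) * (c * real DIM('a)) - exp (F u) * (f u * (c * (m * r * \<sigma>)))"
      unfolding k_def \<kappa>_def \<kappa>'_def u_def[symmetric] using T by (simp add: \<sigma>_def field_simps)
    ultimately show "g (\<Phi> (y (norm (x - z) powr r))) \<le> k x"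
      unfolding g_def \<Psi>_\<Phi> u_def[symmetric] by (simp add: algebra_simps)
  qed
qed

text \<open>The power a makes the truncated profile regular across the sphere and lets its
  right-hand side decay at least as fast as w^(q-1) there. Small amplitudes work because the
  p-Laplacian scales like \<epsilon>^(p-1), the source from below like \<epsilon>^(q-1), and q <
  p.\<close>

lemma subsolution:
  fixes z :: 'a
  assumes r: "r > 0" "cball z r \<subseteq> \<Omega>" and m: "m > 0" and \<epsilon>: "\<epsilon>0 > 0" "\<epsilon>0 \<le> \<Phi> m"
  obtains w W k B where "dirichlet_solution k w W" "continuous_on UNIV w" "k \<in> borel_measurable M" "AE x in M. \<bar>k x\<bar> \<le> B"
    "\<And>x. 0 \<le> w x \<and> w x \<le> \<epsilon>0" "\<And>x. x \<notin> cball z r \<Longrightarrow> w x = 0" "\<And>x. x \<in> ball z r \<Longrightarrow> w x > 0" "\<And>x. k x \<le> g (w x)"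
proof -
  define rr where "rr = p / (p - 1)"
  have rr: "rr > 1" unfolding rr_def by (rule conjugate_gt_1)
  define T where "T = r powr rr"
  have T: "T > 0" using r by (simp add: T_def)
  obtain c where c: "c > 0" "\<And>t. 0 \<le> t \<Longrightarrow> t \<le> \<Phi> m \<Longrightarrow> c * t powr (q - 1) \<le> g t"
    using g_lower_bound[OF m] by blast
  \<comment> \<open>The first entry is equivalent to (a-1)(p-1) \<ge> a (q-1), the comparison of
    decay rates at the sphere; the second gives b \<ge> 2, so that the flux coefficient is
    C^1.\<close>
  define a where "a = max ((p - 1) / (p - q)) (1 + 2 / (p - 1))"
  define b where "b = (a - 1) * (p - 1)"
  have a: "a > 1" "b > 1" "b \<ge> a * (q - 1)"
  proof -
    have "2 / (p - 1) > 0" using p_gt_1 by simp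
    then show "a > 1" unfolding a_def by linarith
    have "2 / (p - 1) * (p - 1) \<le> (a - 1) * (p - 1)" using p_gt_1 by (intro mult_right_mono) (auto simp: a_def)
    moreover have "2 / (p - 1) * (p - 1) = 2" using p_gt_1 by (simp add: field_simps)
    ultimately show "b > 1" unfolding b_def by linarith
    have "(p - 1) / (p - q) \<le> a" by (simp add: a_def)
    then have "p - 1 \<le> a * (p - q)" using q_less_p by (simp add: field_simps)
    then show "b \<ge> a * (q - 1)" by (simp add: b_def algebra_simps)
  qed
  define D where "D = real DIM('a) * (rr * (a / T)) powr (p - 1)"
  have D: "D > 0" using rr a T p_gt_1 by (simp add: D_def)
  \<comment> \<open>The second bound says D \<epsilon>^(p-q) \<le> c, where D is the size of the
    p-Laplacian of the profile at unit amplitude; the first keeps w in the range of the lower bound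
    for g.\<close>
  define \<epsilon> where "\<epsilon> = min \<epsilon>0 ((c / D) powr (1 / (p - q)))"
  have e: "\<epsilon> > 0" "\<epsilon> \<le> \<epsilon>0" "\<epsilon> \<le> \<Phi> m" using \<epsilon> c D by (auto simp: \<epsilon>_def)
  have eD: "D * \<epsilon> powr (p - 1) \<le> c * \<epsilon> powr (q - 1)"
  proof -
    have "\<epsilon> powr (p - q) \<le> ((c / D) powr (1 / (p - q))) powr (p - q)"
      using e q_less_p by (intro powr_mono2) (auto simp: \<epsilon>_def)
    also have "\<dots> = c / D" using c D q_less_p by (simp add: powr_powr)
    finally have "D * \<epsilon> powr (p - q) \<le> c" using D by (simp add: field_simps)
    then have "D * \<epsilon> powr (p - q) * \<epsilon> powr (q - 1) \<le> c * \<epsilon> powr (q - 1)" by (intro mult_right_mono) auto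
    moreover have "\<epsilon> powr (p - q) * \<epsilon> powr (q - 1) = \<epsilon> powr (p - 1)" by (simp flip: powr_add)
    ultimately show ?thesis by (simp add: mult.assoc)
  qed
  define y where "y s = 1 - s / T" for s
  have Dy: "DERIV y s :> - (1 / T)" for s
    unfolding y_def[abs_def] using T by (auto intro!: derivative_eq_intros)
  have cy: "continuous_on UNIV y" using Dy by (auto intro!: continuous_at_imp_continuous_on DERIV_isCont)
  define C where "C = (rr * (\<epsilon> * (a / T))) powr (p - 1)"
  define \<tau> where "\<tau> s = \<epsilon> * (a / T) * max 0 (y s) powr (a - 1)" for s
  define \<kappa> where "\<kappa> s = C * max 0 (y s) powr b" for s
  define \<kappa>' where "\<kappa>' s = C * (b * max 0 (y s) powr (b - 1) * (- (1 / T)))" for s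
  have D\<theta>: "DERIV (\<lambda>s. \<epsilon> * max 0 (y s) powr a) s :> - \<tau> s" for s
    by (rule DERIV_cong[OF DERIV_cmult[OF DERIV_chain2[OF DERIV_pos_part_powr[OF a(1)] Dy]]]) (simp add: \<tau>_def)
  have \<tau>0: "\<tau> s \<ge> 0" for s using e a T by (simp add: \<tau>_def)
  have cpow: "continuous_on UNIV (\<lambda>s. max 0 (y s) powr d)" if "d > 0" for d
    by (rule continuous_on_compose2[OF continuous_pos_part_powr[OF that] cy]) auto
  have c\<tau>: "continuous_on UNIV \<tau>"
    unfolding \<tau>_def[abs_def] using a by (intro continuous_intros cpow) auto
  have \<kappa>: "\<kappa> s = (p / (p - 1) * \<tau> s) powr (p - 1)" for s
  proof -
    have "(p / (p - 1) * \<tau> s) powr (p - 1) = ((rr * (\<epsilon> * (a / T))) * max 0 (y s) powr (a - 1)) powr (p - 1)"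
      by (simp only: \<tau>_def rr_def mult_ac)
    also have "\<dots> = C * (max 0 (y s) powr (a - 1)) powr (p - 1)"
      unfolding C_def using rr e a T by (subst powr_mult) auto
    finally show ?thesis by (simp add: \<kappa>_def powr_powr b_def)
  qed
  have D\<kappa>: "DERIV \<kappa> s :> \<kappa>' s" for s
    unfolding \<kappa>_def[abs_def] \<kappa>'_def
    by (intro DERIV_cmult DERIV_chain2[OF DERIV_pos_part_powr[OF a(2)] Dy])
  have c\<kappa>': "continuous_on UNIV \<kappa>'"
    unfolding \<kappa>'_def[abs_def] using a by (intro continuous_intros cpow) auto
  have c\<kappa>: "continuous_on UNIV \<kappa>" using D\<kappa> by (auto intro!: continuous_at_imp_continuous_on DERIV_isCont)
  define w where "w x = \<epsilon> * max 0 (y (norm (x - z) powr rr)) powr a" for x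
  define W where "W x = - ((p / (p - 1) * \<tau> (norm (x - z) powr (p / (p - 1)))) *\<^sub>R pflux (p / (p - 1)) (x - z))" for x
  define k where "k x = real DIM('a) * \<kappa> (norm (x - z) powr rr) + \<kappa>' (norm (x - z) powr rr) * rr * norm (x - z) powr rr" for x
  have DW: "GDERIV w x :> W x" for x
    unfolding w_def[abs_def] W_def rr_def by (rule radial_gradient[OF D\<theta>])
  have cW: "continuous_on UNIV W"
    unfolding W_def[abs_def] by (rule continuous_radial_gradient[OF c\<tau>])
  have w0: "w x = 0" if "x \<notin> cball z r" for x
  proof -
    have "norm (x - z) > r" using that by (auto simp: dist_norm norm_minus_commute)
    then have "norm (x - z) powr rr > T" unfolding T_def using rr r by (intro powr_less_mono2) auto
    then have "y (norm (x - z) powr rr) \<le> 0" using T by (simp add: y_def field_simps)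
    then show ?thesis by (simp add: w_def max_def)
  qed
  have "C1c w W" 
    unfolding C1c_def by (intro conjI allI impI exI[of _ "cball z r"] DW cW w0 r(2) compact_cball)
  then have Ww: "W0 w W" by (rule W0_C1c)
  have ck: "continuous_on UNIV k"
    unfolding k_def[abs_def] rr_def
    by (intro continuous_intros continuous_radial[OF c\<kappa>'] continuous_radial[OF c\<kappa>]
        continuous_radial[OF continuous_on_id, simplified id_def])
  have sol: "dirichlet_solution k w W"
    unfolding dirichlet_solution_def W_def k_def rr_def
    using radial_flux[OF \<tau>0 c\<tau> \<kappa> D\<kappa> c\<kappa>'] Ww[unfolded W_def[abs_def]] by blast
  have \<sigma>: "0 \<le> max 0 (y (norm (x - z) powr rr))" "max 0 (y (norm (x - z) powr rr)) \<le> 1" for x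
    using T by (auto simp: y_def)
  have wb: "0 \<le> w x" "w x \<le> \<epsilon>" for x
  proof -
    have "max 0 (y (norm (x - z) powr rr)) powr a \<le> 1" using \<sigma>[of x] a by (intro powr_le1) auto
    then show "0 \<le> w x" "w x \<le> \<epsilon>" unfolding w_def using e by (auto simp: mult_le_cancel_left2)
  qed
  obtain B where B: "\<And>x. x \<in> \<Omega> \<Longrightarrow> norm (k x) \<le> B" using continuous_bounded_on_domain[OF ck] by metis
  show thesis
  proof (rule that[OF sol])
    show "continuous_on UNIV w"
      using DW by (auto simp: gderiv_def intro!: continuous_at_imp_continuous_on has_derivative_continuous)
    show "k \<in> borel_measurable M" by (rule measurable_continuous[OF ck])
    show "AE x in M. \<bar>k x\<bar> \<le> B" using AE_mem_domain B by (auto elim!: eventually_mono)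
    show "0 \<le> w x \<and> w x \<le> \<epsilon>0" for x using wb[of x] e by auto
    show "x \<notin> cball z r \<Longrightarrow> w x = 0" for x by (rule w0)
    show "w x > 0" if "x \<in> ball z r" for x
    proof -
      have "norm (x - z) < r" using that by (auto simp: dist_norm norm_minus_commute)
      then have "norm (x - z) powr rr < T" unfolding T_def using rr by (intro powr_less_mono2) auto
      then have "y (norm (x - z) powr rr) > 0" using T by (simp add: y_def)
      then show ?thesis using e by (simp add: w_def)
    qed
    fix x
    define \<sigma>x where "\<sigma>x = max 0 (y (norm (x - z) powr rr))"
    have \<sigma>x: "0 \<le> \<sigma>x" "\<sigma>x \<le> 1" using \<sigma>[of x] by (simp_all add: \<sigma>x_def)
    have C0: "C \<ge> 0" by (simp add: C_def)
    \<comment> \<open>The flux coefficient decreases radially, so its derivative helps in an upper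
      bound for k and is dropped.\<close>
    have "\<kappa>' (norm (x - z) powr rr) * rr * norm (x - z) powr rr \<le> 0"
      unfolding \<kappa>'_def using C0 a T rr by (simp add: mult_le_0_iff zero_le_mult_iff)
    then have "k x \<le> real DIM('a) * (C * \<sigma>x powr b)"
      by (simp add: k_def \<kappa>_def \<sigma>x_def)
    also have "real DIM('a) * (C * \<sigma>x powr b) = D * \<epsilon> powr (p - 1) * \<sigma>x powr b"
    proof -
      have "C = (\<epsilon> * (rr * (a / T))) powr (p - 1)" by (simp only: C_def mult_ac)
      also have "\<dots> = \<epsilon> powr (p - 1) * (rr * (a / T)) powr (p - 1)" using e rr a T by (subst powr_mult) auto
      finally show ?thesis by (simp add: D_def)
    qed
    also have "\<dots> \<le> c * \<epsilon> powr (q - 1) * \<sigma>x powr (a * (q - 1))"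
    proof (rule mult_mono[OF eD])
      show "\<sigma>x powr b \<le> \<sigma>x powr (a * (q - 1))"
        using \<sigma>x a by (intro powr_mono') auto
    qed (use c in auto)
    also have "\<dots> = c * (w x) powr (q - 1)"
      unfolding w_def \<sigma>x_def[symmetric] using e \<sigma>x by (subst powr_mult) (auto simp: powr_powr)
    also have "\<dots> \<le> g (w x)" using wb[of x] e by (intro c(2)) auto
    finally show "k x \<le> g (w x)" .
  qed
qed

end

section \<open>Existence\<close>

context kazdan_kramer
begin

text \<open>Monotone iteration downwards from the supersolution. Every compactly supported subsolution lying
  below the supersolution stays below all iterates, which makes the limit positive.\<close>

lemma exists_transformed_solution:
  fixes z :: 'a
  assumes R: "R > 0" "\<Omega> \<subseteq> ball z R" and m: "m > 0"
    and c: "c = (p / (p - 1) * (m / R powr (p / (p - 1)))) powr (p - 1)"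
    and cond: "f m * (1 + c * (m * (p / (p - 1)))) \<le> c * real DIM('a)"
  obtains v V where "dirichlet_solution (\<lambda>x. g (v x)) v V" "AE x in M. 0 < v x \<and> v x \<le> \<Phi> m"
proof -
  obtain s Z k where s: "\<And>x. GDERIV s x :> Z x" "continuous_on UNIV Z" "continuous_on UNIV s"
    "\<And>x. x \<in> \<Omega> \<Longrightarrow> 0 < s x" "\<And>x. x \<in> \<Omega> \<Longrightarrow> s x \<le> \<Phi> m" "continuous_on UNIV k"
    "\<And>\<psi> \<Psi>. W0 \<psi> \<Psi> \<Longrightarrow> (LINT x|M. pflux p (Z x) \<bullet> \<Psi> x) = (LINT x|M. k x * \<psi> x)"
    "\<And>x. x \<in> \<Omega> \<Longrightarrow> g (s x) \<le> k x"
    using supersolution[OF R m c cond] by blast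
  \<comment> \<open>Truncation keeps every right-hand side bounded before an upper bound for the
    iterates is known; below \<Phi>(m) it changes nothing, so the limit solves the original
    equation.\<close>
  define G where "G t = min (g t) (g (\<Phi> m))" for t
  have G: "0 \<le> G t" "G t \<le> g (\<Phi> m)" "G t \<le> g t" "t \<le> \<Phi> m \<Longrightarrow> G t = g t" for t
    using g_nonneg g_mono by (auto simp: G_def min_absorb1)
  have G_mono: "t \<le> t' \<Longrightarrow> G t \<le> G t'" for t t' using g_mono[of t t'] by (auto simp: G_def)
  have cG: "continuous_on UNIV G" unfolding G_def[abs_def] by (intro continuous_intros continuous_g)
  have Gm: "(\<lambda>x. G (w x)) \<in> borel_measurable M" if "w \<in> borel_measurable M" for w
    using measurable_compose[OF that borel_measurable_continuous_onI[OF cG]] .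
  have Gb: "AE x in M. \<bar>G (w x)\<bar> \<le> g (\<Phi> m)" for w using G(1,2) by simp
  \<comment> \<open>Dependent choice over pairs of function and gradient. At step 0 only the
    function is prescribed, because s need not vanish on the boundary and enters merely as data for
    the next right-hand side.\<close>
  define P where "P n z \<longleftrightarrow> fst z \<in> borel_measurable M \<and> (n = 0 \<longrightarrow> fst z = s)" for n :: nat and z :: "('a \<Rightarrow> real) \<times> ('a \<Rightarrow> 'a)"
  define Q where "Q z z' \<longleftrightarrow> dirichlet_solution (\<lambda>x. G (fst z x)) (fst z') (snd z')" for z z' :: "('a \<Rightarrow> real) \<times> ('a \<Rightarrow> 'a)"
  have "\<exists>z. P 0 z" unfolding P_def using measurable_continuous[OF s(3)] by auto
  moreover have "\<exists>z'. P (Suc n) z' \<and> Q z z'" if Pz: "P n z" for n z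
  proof -
    obtain v V where v: "dirichlet_solution (\<lambda>x. G (fst z x)) v V"
      using dirichlet_solution_exists[OF Gm Gb] Pz unfolding P_def by blast
    then have "v \<in> borel_measurable M" unfolding dirichlet_solution_def using L_p_measurable[OF W0_L_p(1)] by blast
    then show ?thesis using v unfolding P_def Q_def by (intro exI[of _ "(v, V)"]) simp
  qed
  ultimately obtain a where a: "\<And>n. P n (a n)" "\<And>n. Q (a n) (a (Suc n))"
    using dependent_nat_choice[of P "\<lambda>n. Q"] by metis
  define v where "v n = fst (a n)" for n
  have v0: "v 0 = s" and vm: "v n \<in> borel_measurable M" for n using a(1) by (auto simp: P_def v_def)
  have sol: "dirichlet_solution (\<lambda>x. G (v n x)) (v (Suc n)) (snd (a (Suc n)))" for n
    using a(2)[of n] by (simp add: Q_def v_def)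
  note hm = Gm[OF vm] and hb = Gb
  obtain Bk where Bk: "\<And>x. x \<in> \<Omega> \<Longrightarrow> norm (k x) \<le> Bk" using continuous_bounded_on_domain[OF s(6)] by metis
  have kb: "AE x in M. \<bar>k x\<bar> \<le> Bk" using AE_mem_domain Bk by (auto elim!: eventually_mono)
  \<comment> \<open>The base case compares with the barrier, as G(s) \<le> g(s) \<le> k; afterwards
    monotonicity of G hands the ordering from right-hand sides to solutions.\<close>
  have dec: "AE x in M. v (Suc n) x \<le> v n x" for n
  proof (induction n)
    case 0
    have "AE x in M. G (v 0 x) \<le> k x"
      using AE_mem_domain by eventually_elim (use s(8) G(3) v0 order_trans in metis)
    from dirichlet_le_supersolution[OF sol hm hb s(1,2) less_imp_le[OF s(4)] measurable_continuous[OF s(6)] kb s(7) this]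
    show ?case by (simp add: v0)
  next
    case (Suc n)
    have "AE x in M. G (v (Suc n) x) \<le> G (v n x)" using Suc by eventually_elim (rule G_mono)
    from dirichlet_solution_mono[OF sol hm hb sol hm hb this] show ?case .
  qed
  \<comment> \<open>Used twice: with w = 0 for nonnegativity of the iterates, and with small local
    subsolutions for strict positivity of the limit.\<close>
  have low: "AE x in M. w x \<le> v n x"
    if w: "dirichlet_solution h w W" "h \<in> borel_measurable M" "AE x in M. \<bar>h x\<bar> \<le> B"
      and le: "\<And>x. x \<in> \<Omega> \<Longrightarrow> w x \<le> s x" "\<And>x. h x \<le> G (w x)" for w W h B n
  proof (induction n)
    case 0
    show ?case using AE_mem_domain by eventually_elim (simp add: le v0)
  next
    case (Suc n)
    have "AE x in M. h x \<le> G (v n x)"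
      using Suc by eventually_elim (use le(2) G_mono order_trans in metis)
    from dirichlet_solution_mono[OF w sol hm hb this] show ?case .
  qed
  have nonneg: "AE x in M. 0 \<le> v n x" for n
  proof (rule low)
    have "C1c (\<lambda>x. 0) (\<lambda>x. 0)" unfolding C1c_def using GDERIV_const[of 0] by (auto intro!: exI[of _ "{}"])
    then show "dirichlet_solution (\<lambda>x. 0) (\<lambda>x. 0) (\<lambda>x. 0)"
      unfolding dirichlet_solution_def using W0_C1c by simp
    show "AE x in M. \<bar>0::real\<bar> \<le> 0" by simp
  qed (use s(4) G(1) in \<open>auto intro: less_imp_le\<close>)
  have all: "AE x in M. x \<in> \<Omega> \<and> (\<forall>n. v (Suc n) x \<le> v n x) \<and> (\<forall>n. 0 \<le> v n x)"
    using AE_mem_domain dec nonneg by (simp add: AE_conj_iff AE_all_countable)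
  define v' where "v' x = lim (\<lambda>n. v n x)" for x
  have v'm: "v' \<in> borel_measurable M" unfolding v'_def using vm by (rule borel_measurable_lim_metric)
  have lim: "AE x in M. (\<lambda>n. v n x) \<longlonglongrightarrow> v' x"
    using all
  proof eventually_elim
    case (elim x)
    then obtain L where "(\<lambda>n. v n x) \<longlonglongrightarrow> L"
      using decseq_convergent[of "\<lambda>n. v n x" 0] decseq_SucI[of "\<lambda>n. v n x"] by metis
    then show ?case by (simp add: v'_def limI)
  qed
  have le_s: "AE x in M. \<forall>n. v n x \<le> \<Phi> m"
    using all
  proof eventually_elim
    case (elim x)
    show ?case
    proof
      fix n
      have "v n x \<le> v 0 x" using elim decseqD[OF decseq_SucI, of "\<lambda>n. v n x" 0 n] by simp
      then show "v n x \<le> \<Phi> m" using s(5)[of x] elim by (simp add: v0)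
    qed
  qed
  have lim_Suc: "AE x in M. (\<lambda>n. v (Suc n) x) \<longlonglongrightarrow> v' x" using lim by eventually_elim (rule LIMSEQ_Suc)
  have v_bound: "AE x in M. \<bar>v (Suc n) x\<bar> \<le> \<Phi> m" for n
    using all le_s by eventually_elim auto
  have limG: "AE x in M. (\<lambda>n. G (v n x)) \<longlonglongrightarrow> G (v' x)"
    using lim by eventually_elim (rule continuous_on_tendsto_compose[OF cG], auto)
  obtain V where V: "dirichlet_solution (\<lambda>x. G (v' x)) v' V"
    using dirichlet_solution_limit[OF sol hm hb limG Gm[OF v'm] v_bound lim_Suc v'm] by blast
  have v'_le: "AE x in M. v' x \<le> \<Phi> m"
    using lim le_s
  proof eventually_elim
    case (elim x)
    show ?case by (rule LIMSEQ_le_const2[OF elim(1)]) (use elim(2) in blast)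
  qed
  have "dirichlet_solution (\<lambda>x. g (v' x)) v' V"
    unfolding dirichlet_solution_def
  proof (intro conjI allI impI)
    show "W0 v' V" using V by (simp add: dirichlet_solution_def)
    fix \<psi> \<Psi>' assume \<psi>: "W0 \<psi> \<Psi>'"
    have "(LINT x|M. G (v' x) * \<psi> x) = (LINT x|M. g (v' x) * \<psi> x)"
    proof (rule integral_cong_AE)
      show "AE x in M. G (v' x) * \<psi> x = g (v' x) * \<psi> x" using v'_le by eventually_elim (simp add: G(4))
      show "(\<lambda>x. G (v' x) * \<psi> x) \<in> borel_measurable M"
        using Gm[OF v'm] L_p_measurable[OF W0_L_p(1)[OF \<psi>]] by measurable
      show "(\<lambda>x. g (v' x) * \<psi> x) \<in> borel_measurable M"
        using measurable_compose[OF v'm borel_measurable_continuous_onI[OF continuous_g]]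
          L_p_measurable[OF W0_L_p(1)[OF \<psi>]] by measurable
    qed
    then show "(LINT x|M. pflux p (V x) \<bullet> \<Psi>' x) = (LINT x|M. g (v' x) * \<psi> x)"
      using V \<psi> by (simp add: dirichlet_solution_def)
  qed
  moreover have "AE x in M. 0 < v' x"
  proof -
    have ball: "AE x in M. x \<in> ball z r \<longrightarrow> 0 < v' x" if zr: "r > 0" "cball z r \<subseteq> \<Omega>" for z r
    proof -
      \<comment> \<open>The minimum of s over the closed ball is the admissible height of the local
        subsolution: it stays below s there, and outside it is 0.\<close>
      obtain y where y: "y \<in> cball z r" "\<And>x. x \<in> cball z r \<Longrightarrow> s y \<le> s x"
        using continuous_attains_inf[of "cball z r" s] continuous_on_subset[OF s(3)] zr by auto
      have sy: "s y > 0" "s y \<le> \<Phi> m" using y(1) zr s(4,5) by auto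
      obtain w W h B where w: "dirichlet_solution h w W" "continuous_on UNIV w" "h \<in> borel_measurable M" "AE x in M. \<bar>h x\<bar> \<le> B"
        "\<And>x. 0 \<le> w x \<and> w x \<le> s y" "\<And>x. x \<notin> cball z r \<Longrightarrow> w x = 0" "\<And>x. x \<in> ball z r \<Longrightarrow> w x > 0" "\<And>x. h x \<le> g (w x)"
        by (rule subsolution[OF zr m sy]) (rule that; (assumption | blast))
      have "w x \<le> s x" if "x \<in> \<Omega>" for x
        using w(5)[of x] w(6)[of x] y(2)[of x] s(4)[OF that] by (cases "x \<in> cball z r") auto
      moreover have "h x \<le> G (w x)" for x
        using w(8)[of x] w(5)[of x] sy(2) G(4)[of "w x"] by auto
      ultimately have "AE x in M. w x \<le> v n x" for n by (rule low[OF w(1,3,4)])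
      then have "AE x in M. \<forall>n. w x \<le> v n x" by (simp add: AE_all_countable)
      with lim show ?thesis
      proof eventually_elim
        case (elim x)
        have "w x \<le> v' x" by (rule LIMSEQ_le_const[OF elim(1)]) (use elim(2) in blast)
        then show ?case using w(7)[of x] by auto
      qed
    qed
    \<comment> \<open>Each ball brings its own exceptional null set; a countable subcover keeps
      their union null.\<close>
    define \<F> where "\<F> = {ball z r |z r. r > 0 \<and> cball z r \<subseteq> \<Omega>}"
    obtain \<F>' where F': "\<F>' \<subseteq> \<F>" "countable \<F>'" "\<Union>\<F>' = \<Union>\<F>"
      using Lindelof[of \<F>] by (auto simp: \<F>_def)
    have "AE x in M. \<forall>S\<in>\<F>'. x \<in> S \<longrightarrow> 0 < v' x"
      using F'(1) ball by (subst AE_ball_countable[OF F'(2)]) (auto simp: \<F>_def)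
    with AE_mem_domain show ?thesis
    proof eventually_elim
      case (elim x)
      obtain r where "r > 0" "cball x r \<subseteq> \<Omega>" using open_domain elim(1) open_contains_cball by metis
      then have "x \<in> \<Union>\<F>" unfolding \<F>_def by (auto intro!: exI[of _ "ball x r"])
      then show ?case using elim(2) F'(3) by blast
    qed
  qed
  ultimately show thesis using that v'_le by (simp add: AE_conj_iff)
qed

text \<open>The equation for v is tested with \<theta>(v) \<phi>, where \<theta>(v) = exp(-F(u)) and
  u = \<Psi>(v). Then \<theta>(v) times the flux of V is the flux of U, the derivative of \<theta>
  produces -f(u) |U|^p \<phi>, and g(v) \<theta>(v) = f(u), which is the weak form for u.\<close>

lemma back_transform:
  assumes sol: "dirichlet_solution (\<lambda>x. g (v x)) v V" and v: "AE x in M. 0 < v x \<and> v x \<le> \<Phi> m"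
  shows "\<exists>u. positive_weak_solution p q lam \<Omega> u"
proof -
  have Wv: "W0 v V" using sol by (simp add: dirichlet_solution_def)
  note vLp = W0_L_p[OF Wv]
  note vm = L_p_measurable[OF vLp(1)]
  define J where "J t = inverse (exp (F (\<Psi> t) / (p - 1)))" for t
  have J: "0 < J t" "J t \<le> 1" for t
    using F_nonneg[of "\<Psi> t"] p_gt_1 by (auto simp: J_def inverse_le_1_iff)
  have cF\<Psi>: "continuous_on UNIV (\<lambda>t. F (\<Psi> t))" by (rule continuous_on_compose2[OF continuous_F continuous_\<Psi>]) auto
  have cf\<Psi>: "continuous_on UNIV (\<lambda>t. f (\<Psi> t))" by (rule continuous_on_compose2[OF continuous_f continuous_\<Psi>]) auto
  have cJ: "continuous_on UNIV J"
    unfolding J_def[abs_def] using p_gt_1 by (intro continuous_intros cF\<Psi>) auto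
  have D\<Psi>: "DERIV \<Psi> t :> J t" for t unfolding J_def by (rule DERIV_\<Psi>)
  have snd_D: "((\<lambda>z. h (snd z)) has_derivative (\<lambda>z. snd z * d)) (at (x, t))" if "DERIV h t :> d" for h d and x :: 'a and t :: real
  proof -
    have "((\<lambda>z. snd z) has_derivative (\<lambda>z. snd z)) (at (x, t))" by (intro has_derivative_snd has_derivative_ident)
    from has_derivative_compose[OF this, of h "(*) d"] that show ?thesis
      by (simp add: has_field_derivative_def mult.commute)
  qed
  define u0 where "u0 x = \<Psi> (v x)" for x
  define U where "U x = J (v x) *\<^sub>R V x" for x
  have Wu0: "W0 u0 U"
  proof -
    have "W0 (\<lambda>x. \<Psi> (v x)) (\<lambda>x. 0 + J (v x) *\<^sub>R V x)"
      by (rule W0_compose[where B="\<lambda>x. \<Psi>" and Bx="\<lambda>x t. 0" and Bt="\<lambda>x. J" and K=1, OF Wv])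
        (use snd_D[OF D\<Psi>] J in \<open>auto intro!: continuous_on_compose2[OF cJ] continuous_intros simp: \<Psi>_0 less_imp_le\<close>)
    then show ?thesis by (simp add: u0_def[abs_def] U_def[abs_def])
  qed
  have u0m: "u0 \<in> borel_measurable M" by (rule L_p_measurable[OF W0_L_p(1)[OF Wu0]])
  have u0: "AE x in M. 0 < u0 x \<and> u0 x \<le> m"
    using v
  proof eventually_elim
    case (elim x)
    show ?case unfolding u0_def
      using elim strict_mono_less[OF mono_\<Psi>, of 0 "v x"] strict_mono_less_eq[OF mono_\<Psi>, of "v x" "\<Phi> m"]
      by (simp add: \<Psi>_0 \<Psi>_\<Phi>)
  qed
  \<comment> \<open>The value 1 on the exceptional null set makes u positive at every point without
    altering its class.\<close>
  define u where "u x = (if u0 x > 0 then u0 x else 1)" for x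
  have um: "u \<in> borel_measurable M" unfolding u_def[abs_def] using u0m by measurable
  have uu0: "AE x in M. u x = u0 x" using u0 by eventually_elim (simp add: u_def)
  have Wu: "W0 u U" by (rule W0_AE_cong[OF Wu0 um uu0])
  define \<theta> where "\<theta> t = exp (- F (\<Psi> t))" for t
  define \<theta>' where "\<theta>' t = - (f (\<Psi> t) * \<theta> t * J t)" for t
  have D\<theta>: "DERIV (\<lambda>t. \<theta> t - 1) t :> \<theta>' t" for t
    unfolding \<theta>_def \<theta>'_def
    by (rule DERIV_cong[OF DERIV_diff[OF DERIV_fun_exp[OF DERIV_minus[OF DERIV_chain2[OF DERIV_F D\<Psi>]]] DERIV_const]]) simp
  have c\<theta>: "continuous_on UNIV \<theta>" unfolding \<theta>_def[abs_def] by (intro continuous_intros cF\<Psi>)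
  have c\<theta>': "continuous_on UNIV \<theta>'" unfolding \<theta>'_def[abs_def] by (intro continuous_intros cf\<Psi> c\<theta> cJ)
  have \<theta>: "0 < \<theta> t" "\<theta> t \<le> 1" for t using F_nonneg[of "\<Psi> t"] by (auto simp: \<theta>_def)
  \<comment> \<open>Composition needs a bound on the whole line. From s^(q-1) \<le> 1 + s^q one gets
    f \<le> \<lambda> + q F \<le> (\<lambda> + q) exp(F), so f exp(-F) is bounded.\<close>
  have \<theta>'_bound: "\<bar>\<theta>' t\<bar> \<le> lam + q" for t
  proof -
    define y where "y = \<Psi> t"
    have "max 0 y powr (q - 1) \<le> 1 + max 0 y powr q" using q_gt_1 by (intro powr_le_1_plus_powr) auto
    then have "f y \<le> lam * (1 + max 0 y powr q)" unfolding source_def using lam_pos by (intro mult_left_mono) auto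
    also have "\<dots> = lam + q * F y" using q_gt_1 by (simp add: source_prim_def algebra_simps)
    also have "\<dots> \<le> (lam + q) * (1 + F y)" using lam_pos q_gt_1 F_nonneg[of y] by (simp add: algebra_simps)
    also have "\<dots> \<le> (lam + q) * exp (F y)" using lam_pos q_gt_1 exp_ge_add_one_self[of "F y"] by (intro mult_left_mono) auto
    finally have "f y * exp (- F y) \<le> (lam + q) * exp (F y) * exp (- F y)" by (intro mult_right_mono) auto
    moreover have "exp (F y) * exp (- F y) = 1" by (simp flip: exp_add)
    ultimately have 1: "f y * \<theta> t \<le> lam + q"
      unfolding \<theta>_def y_def[symmetric] by (simp only: mult.assoc mult_1_right)
    have "\<bar>\<theta>' t\<bar> = f y * \<theta> t * J t" using f_nonneg[of y] \<theta>(1)[of t] J(1)[of t] by (simp add: \<theta>'_def y_def abs_mult)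
    also have "\<dots> \<le> (lam + q) * 1" using 1 J[of t] lam_pos q_gt_1 by (intro mult_mono) auto
    finally show ?thesis by simp
  qed
  have pU: "pflux p (U x) = \<theta> (v x) *\<^sub>R pflux p (V x)" for x
  proof -
    have "J (v x) powr (p - 1) = \<theta> (v x)"
      unfolding J_def \<theta>_def exp_minus[symmetric] using p_gt_1 by (simp add: exp_powr_real)
    then show ?thesis unfolding U_def by (simp add: pflux_scale[OF J(1)])
  qed
  have nU: "norm (U x) powr p = \<theta> (v x) * J (v x) * norm (V x) powr p" for x
  proof -
    have "norm (U x) powr p = pflux p (U x) \<bullet> U x" by (rule pflux_inner_self[symmetric])
    also have "\<dots> = \<theta> (v x) * (J (v x) * (pflux p (V x) \<bullet> V x))"
      unfolding pU by (simp only: U_def inner_scaleR_left inner_scaleR_right mult.left_commute)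
    finally show ?thesis by (simp only: pflux_inner_self mult.assoc)
  qed
  have eq: "(LINT x|M. pflux p (U x) \<bullet> grad \<phi> x) = (LINT x|M. lam * u x powr (q - 1) * (1 + norm (U x) powr p) * \<phi> x)"
    if \<phi>: "\<phi> \<in> test_functions \<Omega>" for \<phi>
  proof -
    note c\<phi> = test_functions_C1c[OF \<phi>]
    obtain B where B: "B \<ge> 0" "\<And>x. \<bar>\<phi> x\<bar> \<le> B" "\<And>x. norm (grad \<phi> x) \<le> B" using C1c_bounded[OF c\<phi>] by metis
    \<comment> \<open>Since \<theta>(0) = 1, only \<theta> - 1 satisfies the vanishing condition at
      0 of the composition rule; \<phi> itself is added afterwards.\<close>
    have W1: "W0 (\<lambda>x. (\<theta> (v x) - 1) * \<phi> x) (\<lambda>x. (\<theta> (v x) - 1) *\<^sub>R grad \<phi> x + (\<theta>' (v x) * \<phi> x) *\<^sub>R V x)"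
    proof (rule W0_compose[where B="\<lambda>x t. (\<theta> t - 1) * \<phi> x" and Bx="\<lambda>x t. (\<theta> t - 1) *\<^sub>R grad \<phi> x"
          and Bt="\<lambda>x t. \<theta>' t * \<phi> x" and K="B + (lam + q) * B", OF Wv])
      fix x :: 'a and t :: real
      have "((\<lambda>z. fst z) has_derivative (\<lambda>z. fst z)) (at (x, t))"
        by (intro has_derivative_fst has_derivative_ident)
      from has_derivative_compose[OF this, of \<phi> "\<lambda>h. h \<bullet> grad \<phi> x"] C1cD(1)[OF c\<phi>, of x]
      have "((\<lambda>z. \<phi> (fst z)) has_derivative (\<lambda>z. fst z \<bullet> grad \<phi> x)) (at (x, t))" by (simp add: gderiv_def)
      from has_derivative_mult[OF snd_D[OF D\<theta>] this]
      show "((\<lambda>z. (\<theta> (snd z) - 1) * \<phi> (fst z)) has_derivative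
         (\<lambda>z. fst z \<bullet> ((\<theta> t - 1) *\<^sub>R grad \<phi> x) + snd z * (\<theta>' t * \<phi> x))) (at (x, t))"
        by (simp add: mult.assoc)
    next
      show "continuous_on UNIV (\<lambda>z. (\<theta> (snd z) - 1) *\<^sub>R grad \<phi> (fst z))"
        by (intro continuous_intros continuous_on_compose2[OF c\<theta>] continuous_on_compose2[OF C1cD(2)[OF c\<phi>]]) auto
      show "continuous_on UNIV (\<lambda>z. \<theta>' (snd z) * \<phi> (fst z))"
        by (intro continuous_intros continuous_on_compose2[OF c\<theta>'] continuous_on_compose2[OF C1cD(3)[OF c\<phi>]]) auto
      show "(\<theta> 0 - 1) * \<phi> x = 0" for x
        using q_gt_1 by (simp add: \<theta>_def \<Psi>_0 source_prim_def)
      fix x t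
      have "(lam + q) * B \<ge> 0" using lam_pos q_gt_1 B(1) by simp
      moreover have "\<bar>\<theta> t - 1\<bar> * norm (grad \<phi> x) \<le> 1 * B" using \<theta>[of t] B by (intro mult_mono) auto
      ultimately show "norm ((\<theta> t - 1) *\<^sub>R grad \<phi> x) \<le> B + (lam + q) * B" by simp
      have "\<bar>\<theta>' t\<bar> * \<bar>\<phi> x\<bar> \<le> (lam + q) * B" using \<theta>'_bound[of t] B lam_pos q_gt_1 by (intro mult_mono) auto
      then show "\<bar>\<theta>' t * \<phi> x\<bar> \<le> B + (lam + q) * B" using B(1) by (simp add: abs_mult)
    qed
    have W2: "W0 (\<lambda>x. \<theta> (v x) * \<phi> x) (\<lambda>x. \<theta> (v x) *\<^sub>R grad \<phi> x + (\<theta>' (v x) * \<phi> x) *\<^sub>R V x)"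
      using W0_add[OF W1 W0_C1c[OF c\<phi>]] by (simp add: algebra_simps)
    note i0 = pflux_integrable[OF vLp(2) W0_L_p(2)[OF W2]]
    note i1 = pflux_integrable[OF W0_L_p(2)[OF Wu] C1c_L_p(2)[OF c\<phi>]]
    let ?S = "\<lambda>x. f (u0 x) * norm (U x) powr p * \<phi> x"
    have split: "pflux p (V x) \<bullet> (\<theta> (v x) *\<^sub>R grad \<phi> x + (\<theta>' (v x) * \<phi> x) *\<^sub>R V x)
        = pflux p (U x) \<bullet> grad \<phi> x - ?S x" for x
      unfolding pU nU inner_add_right inner_scaleR_right inner_scaleR_left pflux_inner_self
      by (simp add: \<theta>'_def u0_def)
    \<comment> \<open>Integrability of the gradient term needs no separate estimate: it is the
      difference of the two integrable flux pairings.\<close>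
    have iS: "integrable M ?S"
      using Bochner_Integration.integrable_diff[OF i1 i0] unfolding split by simp
    have fb: "AE x in M. \<bar>f (u0 x)\<bar> \<le> f m"
      using u0 by eventually_elim (use f_mono f_nonneg in \<open>auto simp: abs_of_nonneg\<close>)
    have fm: "(\<lambda>x. f (u0 x)) \<in> borel_measurable M"
      using measurable_compose[OF u0m borel_measurable_continuous_onI[OF continuous_f]] .
    note i2 = L_p_integrable_mult_bounded[OF C1c_L_p(1)[OF c\<phi>] fm fb]
    have "(LINT x|M. pflux p (U x) \<bullet> grad \<phi> x - ?S x) = (LINT x|M. g (v x) * (\<theta> (v x) * \<phi> x))"
      unfolding split[symmetric] using sol W2 unfolding dirichlet_solution_def by blast
    then have "(LINT x|M. pflux p (U x) \<bullet> grad \<phi> x) - (LINT x|M. ?S x) = (LINT x|M. g (v x) * (\<theta> (v x) * \<phi> x))"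
      by (simp only: Bochner_Integration.integral_diff[OF i1 iS])
    also have "(\<lambda>x. g (v x) * (\<theta> (v x) * \<phi> x)) = (\<lambda>x. f (u0 x) * \<phi> x)"
      by (auto simp: g_def \<theta>_def u0_def exp_minus)
    finally have "(LINT x|M. pflux p (U x) \<bullet> grad \<phi> x) = (LINT x|M. f (u0 x) * \<phi> x + ?S x)"
      using Bochner_Integration.integral_add[OF i2 iS] by simp
    also have "\<dots> = (LINT x|M. lam * u x powr (q - 1) * (1 + norm (U x) powr p) * \<phi> x)"
    proof (rule integral_cong_AE)
      show "AE x in M. f (u0 x) * \<phi> x + ?S x = lam * u x powr (q - 1) * (1 + norm (U x) powr p) * \<phi> x"
        using u0 uu0 by eventually_elim (simp add: source_def algebra_simps)
      show "(\<lambda>x. f (u0 x) * \<phi> x + ?S x) \<in> borel_measurable M"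
        by (intro borel_measurable_integrable Bochner_Integration.integrable_add i2 iS)
      show "(\<lambda>x. lam * u x powr (q - 1) * (1 + norm (U x) powr p) * \<phi> x) \<in> borel_measurable M"
        using um L_p_measurable[OF W0_L_p(2)[OF Wu]] L_p_measurable[OF C1c_L_p(1)[OF c\<phi>]] by measurable
    qed
    finally show ?thesis .
  qed
  have "u \<in> L_infinity \<Omega>"
    unfolding L_infinity_def using um u0 uu0
    by (auto intro!: exI[of _ m] elim!: eventually_elim2)
  then have "weak_solution p q lam \<Omega> u"
    unfolding weak_solution_def
    using W0_W1p_0[OF Wu] W0_L_p(2)[OF Wu] W0_has_weak_gradient[OF Wu] eq[unfolded pflux_def] by blast
  moreover have "\<forall>x\<in>\<Omega>. u x > 0" by (simp add: u_def)
  ultimately show ?thesis unfolding positive_weak_solution_def by blast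
qed

end

section \<open>From the barrier inequality to the theorem\<close>

lemma exists_positive_weak_solution:
  fixes \<Omega> :: "'a::euclidean_space set"
  assumes \<Omega>: "open \<Omega>" "bounded \<Omega>" and q: "1 < q" "q < p" and lam: "lam > 0"
    and R: "R > 0" "\<Omega> \<subseteq> ball z R" and m: "m > 0"
    and c: "c = (p / (p - 1) * (m / R powr (p / (p - 1)))) powr (p - 1)"
    and cond: "lam * m powr (q - 1) * (1 + c * (m * (p / (p - 1)))) \<le> c * real DIM('a)"
  shows "\<exists>u. positive_weak_solution p q lam \<Omega> u"
proof -
  have p: "p > 1" using q by simp
  have "continuous_on UNIV (source_prim lam q)"
    using DERIV_source_prim[OF q(1)] by (auto intro!: continuous_at_imp_continuous_on DERIV_isCont)
  then have "continuous_on UNIV (\<lambda>s. exp (source_prim lam q s / (p - 1)))"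
    using p by (intro continuous_intros) auto
  then obtain \<Phi> where \<Phi>: "\<And>s. DERIV \<Phi> s :> exp (source_prim lam q s / (p - 1))" "\<Phi> 0 = 0"
    using exists_antiderivative by blast
  have "exp (source_prim lam q s / (p - 1)) \<ge> 1" for s
    using lam q p by (simp add: source_prim_def)
  from expanding_inverse[OF \<Phi>(1) this \<Phi>(2)] obtain \<Psi> where
    \<Psi>: "strict_mono \<Phi>" "strict_mono \<Psi>" "\<And>s. \<Psi> (\<Phi> s) = s" "\<And>v. \<Phi> (\<Psi> v) = v"
    "\<And>v. DERIV \<Psi> v :> inverse (exp (source_prim lam q (\<Psi> v) / (p - 1)))" "continuous_on UNIV \<Psi>"
    by blast
  interpret kazdan_kramer \<Omega> p q lam \<Phi> \<Psi>
    by unfold_locales (use \<Omega> p q lam \<Phi> \<Psi> in auto)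
  have "f m = lam * m powr (q - 1)" using m by (simp add: source_def)
  then have "f m * (1 + c * (m * (p / (p - 1)))) \<le> c * real DIM('a)" using cond by simp
  from exists_transformed_solution[OF R m c this] show ?thesis
    using back_transform by metis
qed

theorem mainTheorem3:
  fixes \<Omega> :: "(real ^ 'n) set"
    and x\<^sub>0 y\<^sub>0 :: "real ^ 'n"
    and p q \<rho> R k\<^sub>1 \<gamma> Mstar lstar lam :: real
    and H :: "real \<Rightarrow> real"
  assumes "CARD('n) > 1"
    and "smooth_bounded_domain \<Omega>"
    and "1 < q" and "q < p"
    and "largest_ball_in \<Omega> x\<^sub>0 \<rho>"
    and "y\<^sub>0 \<in> \<Omega>" and "\<Omega> \<subseteq> ball y\<^sub>0 R"
    and "k\<^sub>1 = ((p - 1) / p) powr (1 - p) * real CARD('n) * R powr (- p)"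
    and "\<gamma> = p / (p - 1) * (1 / \<rho>)"
    and "\<And>M. M > 0 \<Longrightarrow> H M = M powr (q - p) * (1 + \<gamma> powr p * M powr p)"
    and "Mstar > 0" and "\<gamma> powr p * Mstar powr p = p / q - 1"
    and "lstar = k\<^sub>1 / H Mstar"
    and "lam \<in> {0<..lstar}"
  shows "\<exists>u. positive_weak_solution p q lam \<Omega> u"
proof -
  define m where "m = Mstar"
  define r where "r = p / (p - 1)"
  have p: "p > 1" using assms by simp
  have m: "m > 0" using assms(11) by (simp add: m_def)
  have r: "r > 1" "r * (p - 1) = p" using p by (auto simp: r_def)
  have \<rho>: "\<rho> > 0" "ball x\<^sub>0 \<rho> \<subseteq> \<Omega>" using assms(5) by (auto simp: largest_ball_in_def)
  have R: "R > 0" using assms(6,7) by (metis ball_eq_empty empty_iff not_le subsetD)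
  \<comment> \<open>The barrier lives on the ball of radius R, whereas \<gamma> is built from the
    inner radius \<rho>; this makes \<gamma> M an upper bound for the gradient of the
    barrier.\<close>
  have "\<rho> \<le> R"
  proof -
    have "ball x\<^sub>0 \<rho> \<subseteq> ball y\<^sub>0 R" using \<rho>(2) assms(7) by blast
    then have "dist x\<^sub>0 y\<^sub>0 + \<rho> \<le> R" using \<rho>(1) by (simp add: ball_subset_ball_iff)
    then show ?thesis using zero_le_dist[of x\<^sub>0 y\<^sub>0] by linarith
  qed
  define c where "c = (r * (m / R powr r)) powr (p - 1)"
  have c: "c = (r * m) powr (p - 1) * R powr (- p)"
  proof -
    have "c = (r * m / R powr r) powr (p - 1)" by (simp add: c_def)
    also have "\<dots> = (r * m) powr (p - 1) / (R powr r) powr (p - 1)" by (rule powr_divide)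
    also have "(R powr r) powr (p - 1) = R powr p" by (simp add: powr_powr r(2))
    finally show ?thesis by (simp add: powr_minus divide_inverse)
  qed
  \<comment> \<open>The constant value of minus the p-Laplacian of the barrier of height m; this is
    where k_1 comes from.\<close>
  have cN: "c * real CARD('n) = k\<^sub>1 * m powr (p - 1)"
  proof -
    have "((p - 1) / p) powr (1 - p) = r powr (p - 1)"
    proof -
      have "(p - 1) / p = inverse r" using p by (simp add: r_def)
      then have "((p - 1) / p) powr (1 - p) = inverse (r powr (1 - p))" using r by (simp add: inverse_powr)
      also have "\<dots> = r powr (p - 1)" by (simp flip: powr_minus)
      finally show ?thesis .
    qed
    then show ?thesis using r m unfolding c assms(8) by (simp add: powr_mult)
  qed
  \<comment> \<open>The left side is (r m / R)^p, the maximum of |grad u|^p for the barrier,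
    attained on the bounding sphere.\<close>
  have cm: "c * (m * r) \<le> \<gamma> powr p * m powr p"
  proof -
    have "(r * m) powr (p - 1) * (r * m) = (r * m) powr p" using r m by (simp add: powr_diff)
    then have "c * (m * r) = (r * m) powr p * R powr (- p)" unfolding c by (simp add: mult_ac)
    also have "\<dots> \<le> (r * m) powr p * \<rho> powr (- p)"
      using \<rho>(1) \<open>\<rho> \<le> R\<close> p by (intro mult_left_mono powr_mono2') auto
    also have "\<dots> = \<gamma> powr p * m powr p"
      unfolding assms(9) r_def[symmetric] using r m \<rho>(1)
      by (simp add: powr_mult powr_minus divide_inverse inverse_powr mult_ac)
    finally show ?thesis .
  qed
  have Hm: "H m = m powr (q - p) * (1 + \<gamma> powr p * m powr p)" using assms(10)[OF m] .
  have "1 + \<gamma> powr p * m powr p > 0" by (intro add_pos_nonneg) auto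
  then have "H m > 0" unfolding Hm using m by simp
  moreover have "lam \<le> k\<^sub>1 / H m" using assms(13,14) by (simp add: m_def)
  ultimately have "lam * H m \<le> k\<^sub>1" by (simp add: field_simps)
  \<comment> \<open>Multiplying by m^(p-1) turns the factor m^(q-p) of H into the m^(q-1) of the
    source term.\<close>
  then have "lam * H m * m powr (p - 1) \<le> k\<^sub>1 * m powr (p - 1)" by (intro mult_right_mono) auto
  moreover have "m powr (q - 1) = m powr (q - p) * m powr (p - 1)" by (simp flip: powr_add)
  then have "lam * m powr (q - 1) * (1 + \<gamma> powr p * m powr p) = lam * H m * m powr (p - 1)"
    unfolding Hm by (simp only: mult_ac)
  ultimately have 1: "lam * m powr (q - 1) * (1 + \<gamma> powr p * m powr p) \<le> k\<^sub>1 * m powr (p - 1)"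
    by (simp only:)
  have "lam * m powr (q - 1) * (1 + c * (m * r)) \<le> lam * m powr (q - 1) * (1 + \<gamma> powr p * m powr p)"
    using cm assms(14) by (intro mult_left_mono) auto
  also note 1
  also note cN[symmetric]
  finally have cond: "lam * m powr (q - 1) * (1 + c * (m * r)) \<le> c * real DIM(real ^ 'n)" by simp
  show ?thesis
    by (rule exists_positive_weak_solution[OF _ _ assms(3,4) _ R assms(7) m c_def[unfolded r_def] cond[unfolded r_def]])
      (use assms(2,14) in \<open>auto simp: smooth_bounded_domain_def\<close>)
qed

end
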